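(* (1) Let $(M,\nabla)$ be a connected affine projective Osserman manifold. Then the scaling function $s(x,y)$, defined for non-zero tangent vectors $x,y$ and satisfying $\operatorname{Spec}\{\mathcal{J}(y)\}=s(x,y)\cdot\operatorname{Spec}\{\mathcal{J}(x)\}$, can be taken to be positive and smooth. (2) Let $(M,g)$ be a connected spacelike projective Osserman (resp. timelike projective Osserman) manifold. Then the scaling function $s(x,y)$, defined for $x,y\in S^+(M,g)$ (resp. $x,y\in S^-(M,g)$) and satisfying $\operatorname{Spec}\{\mathcal{J}(y)\}=s(x,y)\cdot\operatorname{Spec}\{\mathcal{J}(x)\}$, can be taken to be positive and smooth.
   Context: An affine manifold $(M,\nabla)$ is a smooth manifold $M$ with a torsion-free connection $\nabla$. Let $\mathcal{R}(x,y)=\nabla_x\nabla_y-\nabla_y\nabla_x-\nabla_{[x,y]}$ be its curvature operator. The Jacobi operator of $x\in T_PM$ is the endomorphism $\mathcal{J}(x):y\mapsto\mathcal{R}(y,x)x$ of $T_PM$; for a pseudo-Riemannian manifold it is defined using the Levi-Civita connection. For a linear map $T$ of a finite-dimensional real vector space, $\operatorname{Spec}\{T\}\subset\mathbb{C}$ is the set of complex roots of the characteristic polynomial $\det(T-\lambda\operatorname{Id})$. $(M,\nabla)$ is an affine projective Osserman manifold if for any pair of non-zero tangent vectors $x,y\in TM$ (possibly with different base points) there is a real number $s(x,y)\ne0$ with $\operatorname{Spec}\{\mathcal{J}(y)\}=s(x,y)\cdot\operatorname{Spec}\{\mathcal{J}(x)\}\ne\{0\}$. Let $(M,g)$ be a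 pseudo-Riemannian manifold and let $S^\pm(M,g)=\{\xi\in TM:g(\xi,\xi)=\pm1\}$. $(M,g)$ is spacelike projective Osserman (resp. timelike projective Osserman) if for any pair of vectors $x,y$ in $S^+(M,g)$ (resp. $S^-(M,g)$) there is a real number $s(x,y)\ne0$ with $\operatorname{Spec}\{\mathcal{J}(y)\}=s(x,y)\cdot\operatorname{Spec}\{\mathcal{J}(x)\}\ne\{0\}$. *)

theory Defs
  imports "HOL-Analysis.Analysis"
begin

section \<open>Smooth maps between open subsets of normed spaces\<close>

(* Meant for open S and finite-dimensional 'a, where it is the usual class C^k. *)
primrec Ck_on :: "nat \<Rightarrow> 'a::real_normed_vector set \<Rightarrow> ('a \<Rightarrow> 'b::real_normed_vector) \<Rightarrow> bool" where
  "Ck_on 0 S f \<longleftrightarrow> continuous_on S f"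
| "Ck_on (Suc k) S f \<longleftrightarrow>
     (\<forall>x\<in>S. f differentiable (at x)) \<and>
     (\<forall>v. Ck_on k S (\<lambda>x. frechet_derivative f (at x) v))"

definition smooth_on :: "'a::real_normed_vector set \<Rightarrow> ('a \<Rightarrow> 'b::real_normed_vector) \<Rightarrow> bool" where
  "smooth_on S f \<longleftrightarrow> (\<forall>k. Ck_on k S f)"


section \<open>Smooth manifolds\<close>

(* A chart is a pair (domain, coordinate map); values of the map off the domain are irrelevant. *)
type_synonym ('m, 'n) chart = "'m set \<times> ('m \<Rightarrow> real ^ 'n)"

abbreviation chart_dom :: "('m, 'n::finite) chart \<Rightarrow> 'm set" where
  "chart_dom c \<equiv> fst c"

abbreviation chart_map :: "('m, 'n::finite) chart \<Rightarrow> 'm \<Rightarrow> real ^ 'n" where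
  "chart_map c \<equiv> snd c"

definition chart_inv :: "('m, 'n::finite) chart \<Rightarrow> real ^ 'n \<Rightarrow> 'm" where
  "chart_inv c = inv_into (chart_dom c) (chart_map c)"

definition is_chart :: "'m topology \<Rightarrow> ('m, 'n::finite) chart \<Rightarrow> bool" where
  "is_chart X c \<longleftrightarrow>
     openin X (chart_dom c) \<and> open (chart_map c ` chart_dom c) \<and>
     homeomorphic_map (subtopology X (chart_dom c))
       (top_of_set (chart_map c ` chart_dom c)) (chart_map c)"

definition smooth_atlas :: "'m topology \<Rightarrow> ('m, 'n::finite) chart set \<Rightarrow> bool" where
  "smooth_atlas X A \<longleftrightarrow>
     (\<forall>c\<in>A. is_chart X c) \<and> (\<Union>c\<in>A. chart_dom c) = topspace X \<and>
     (\<forall>c\<in>A. \<forall>d\<in>A. smooth_on (chart_map c ` (chart_dom c \<inter> chart_dom d)) (chart_map d \<circ> chart_inv c))"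

definition smooth_manifold :: "'m topology \<Rightarrow> ('m, 'n::finite) chart set \<Rightarrow> bool" where
  "smooth_manifold X A \<longleftrightarrow> Hausdorff_space X \<and> second_countable X \<and> smooth_atlas X A"

definition smooth_fun :: "('m, 'n::finite) chart set \<Rightarrow> 'm set \<Rightarrow> ('m \<Rightarrow> real) \<Rightarrow> bool" where
  "smooth_fun A U f \<longleftrightarrow> (\<forall>c\<in>A. smooth_on (chart_map c ` (U \<inter> chart_dom c)) (f \<circ> chart_inv c))"


section \<open>Tangent vectors and vector fields\<close>

(* A tangent vector at p is given by its components w c in all the charts c around p, subject to
   the transformation law; by convention w c = 0 if c is not a chart around p, so that the
   pointwise operations make the tangent space at p a real vector space. *)
type_synonym ('m, 'n) tvec = "('m, 'n) chart \<Rightarrow> real ^ 'n"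

definition tangent_space :: "('m, 'n::finite) chart set \<Rightarrow> 'm \<Rightarrow> ('m, 'n) tvec set" where
  "tangent_space A p =
     {w. (\<forall>c. \<not> (c \<in> A \<and> p \<in> chart_dom c) \<longrightarrow> w c = 0) \<and>
         (\<forall>c\<in>A. \<forall>d\<in>A. p \<in> chart_dom c \<and> p \<in> chart_dom d \<longrightarrow>
            w d = frechet_derivative (chart_map d \<circ> chart_inv c) (at (chart_map c p)) (w c))}"

definition tangent_bundle :: "'m topology \<Rightarrow> ('m, 'n::finite) chart set \<Rightarrow> ('m \<times> ('m, 'n) tvec) set" where
  "tangent_bundle X A = Sigma (topspace X) (tangent_space A)"

definition chart_at :: "('m, 'n::finite) chart set \<Rightarrow> 'm \<Rightarrow> ('m, 'n) chart" where
  "chart_at A p = (SOME c. c \<in> A \<and> p \<in> chart_dom c)"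

(* The tangent vector at p whose components in the chart c are a. *)
definition tangent_of :: "('m, 'n::finite) chart set \<Rightarrow> ('m, 'n) chart \<Rightarrow> 'm \<Rightarrow> real ^ 'n \<Rightarrow> ('m, 'n) tvec" where
  "tangent_of A c p a =
     (\<lambda>d. if d \<in> A \<and> p \<in> chart_dom d
          then frechet_derivative (chart_map d \<circ> chart_inv c) (at (chart_map c p)) a else 0)"

(* v(f), which does not depend on the chart used, by the chain rule. *)
definition dir_deriv :: "('m, 'n::finite) chart set \<Rightarrow> 'm \<Rightarrow> ('m, 'n) tvec \<Rightarrow> ('m \<Rightarrow> real) \<Rightarrow> real" where
  "dir_deriv A p v f =
     (let c = chart_at A p in frechet_derivative (f \<circ> chart_inv c) (at (chart_map c p)) (v c))"

type_synonym ('m, 'n) vfield = "'m \<Rightarrow> ('m, 'n) tvec"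

definition smooth_vfield :: "('m, 'n::finite) chart set \<Rightarrow> 'm set \<Rightarrow> ('m, 'n) vfield \<Rightarrow> bool" where
  "smooth_vfield A U V \<longleftrightarrow>
     (\<forall>p\<in>U. V p \<in> tangent_space A p) \<and>
     (\<forall>c\<in>A. smooth_on (chart_map c ` (U \<inter> chart_dom c)) (\<lambda>x. V (chart_inv c x) c))"

definition lie_bracket :: "('m, 'n::finite) chart set \<Rightarrow> ('m, 'n) vfield \<Rightarrow> ('m, 'n) vfield \<Rightarrow> ('m, 'n) vfield" where
  "lie_bracket A V W = (\<lambda>p c.
     if c \<in> A \<and> p \<in> chart_dom c
     then frechet_derivative (\<lambda>x. W (chart_inv c x) c) (at (chart_map c p)) (V p c)
        - frechet_derivative (\<lambda>x. V (chart_inv c x) c) (at (chart_map c p)) (W p c)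
     else 0)"


section \<open>Connections, curvature and Jacobi operator\<close>

(* A connection acts on vector fields that are smooth on an open set U, compatibly with
   restriction; only the values on U of "nabla V W" are meaningful. As connections are local
   operators, this is the same as a connection acting on globally defined vector fields. *)
definition connection ::
  "'m topology \<Rightarrow> ('m, 'n::finite) chart set \<Rightarrow> (('m, 'n) vfield \<Rightarrow> ('m, 'n) vfield \<Rightarrow> ('m, 'n) vfield) \<Rightarrow> bool" where
  "connection X A nabla \<longleftrightarrow>
    (\<forall>U. openin X U \<longrightarrow>
      (\<forall>V W. smooth_vfield A U V \<and> smooth_vfield A U W \<longrightarrow> smooth_vfield A U (nabla V W)) \<and>
      (\<forall>V V' W W'. smooth_vfield A U V \<and> smooth_vfield A U W \<and>
         (\<forall>p\<in>U. V' p = V p \<and> W' p = W p) \<longrightarrow> (\<forall>p\<in>U. nabla V' W' p = nabla V W p)) \<and>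
      (\<forall>V V' W. smooth_vfield A U V \<and> smooth_vfield A U V' \<and> smooth_vfield A U W \<longrightarrow>
         (\<forall>p\<in>U. nabla (\<lambda>q c. V q c + V' q c) W p = (\<lambda>c. nabla V W p c + nabla V' W p c))) \<and>
      (\<forall>f V W. smooth_fun A U f \<and> smooth_vfield A U V \<and> smooth_vfield A U W \<longrightarrow>
         (\<forall>p\<in>U. nabla (\<lambda>q c. f q *\<^sub>R V q c) W p = (\<lambda>c. f p *\<^sub>R nabla V W p c))) \<and>
      (\<forall>V W W'. smooth_vfield A U V \<and> smooth_vfield A U W \<and> smooth_vfield A U W' \<longrightarrow>
         (\<forall>p\<in>U. nabla V (\<lambda>q c. W q c + W' q c) p = (\<lambda>c. nabla V W p c + nabla V W' p c))) \<and>
      (\<forall>f V W. smooth_fun A U f \<and> smooth_vfield A U V \<and> smooth_vfield A U W \<longrightarrow>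
         (\<forall>p\<in>U. nabla V (\<lambda>q c. f q *\<^sub>R W q c) p =
                 (\<lambda>c. dir_deriv A p (V p) f *\<^sub>R W p c + f p *\<^sub>R nabla V W p c))))"

definition torsion_free ::
  "'m topology \<Rightarrow> ('m, 'n::finite) chart set \<Rightarrow> (('m, 'n) vfield \<Rightarrow> ('m, 'n) vfield \<Rightarrow> ('m, 'n) vfield) \<Rightarrow> bool" where
  "torsion_free X A nabla \<longleftrightarrow>
    (\<forall>U V W. openin X U \<and> smooth_vfield A U V \<and> smooth_vfield A U W \<longrightarrow>
       (\<forall>p\<in>U. (\<lambda>c. nabla V W p c - nabla W V p c) = lie_bracket A V W p))"

definition affine_manifold ::
  "'m topology \<Rightarrow> ('m, 'n::finite) chart set \<Rightarrow> (('m, 'n) vfield \<Rightarrow> ('m, 'n) vfield \<Rightarrow> ('m, 'n) vfield) \<Rightarrow> bool" where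
  "affine_manifold X A nabla \<longleftrightarrow>
     smooth_manifold X A \<and> connection X A nabla \<and> torsion_free X A nabla"

definition curvature_field ::
  "('m, 'n::finite) chart set \<Rightarrow> (('m, 'n) vfield \<Rightarrow> ('m, 'n) vfield \<Rightarrow> ('m, 'n) vfield) \<Rightarrow>
   ('m, 'n) vfield \<Rightarrow> ('m, 'n) vfield \<Rightarrow> ('m, 'n) vfield \<Rightarrow> ('m, 'n) vfield" where
  "curvature_field A nabla V W Z = (\<lambda>p c.
     nabla V (nabla W Z) p c - nabla W (nabla V Z) p c - nabla (lie_bracket A V W) Z p c)"

(* R(u,v)w at p, computed with any smooth local extensions V, W, Z of u, v, w;
   the value is unique because the curvature is tensorial. *)
definition curvature ::
  "'m topology \<Rightarrow> ('m, 'n::finite) chart set \<Rightarrow> (('m, 'n) vfield \<Rightarrow> ('m, 'n) vfield \<Rightarrow> ('m, 'n) vfield) \<Rightarrow>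
   'm \<Rightarrow> ('m, 'n) tvec \<Rightarrow> ('m, 'n) tvec \<Rightarrow> ('m, 'n) tvec \<Rightarrow> ('m, 'n) tvec" where
  "curvature X A nabla p u v w = (THE r. \<exists>U V W Z. openin X U \<and> p \<in> U \<and>
     smooth_vfield A U V \<and> smooth_vfield A U W \<and> smooth_vfield A U Z \<and>
     V p = u \<and> W p = v \<and> Z p = w \<and> r = curvature_field A nabla V W Z p)"

definition jacobi_operator ::
  "'m topology \<Rightarrow> ('m, 'n::finite) chart set \<Rightarrow> (('m, 'n) vfield \<Rightarrow> ('m, 'n) vfield \<Rightarrow> ('m, 'n) vfield) \<Rightarrow>
   'm \<times> ('m, 'n) tvec \<Rightarrow> ('m, 'n) tvec \<Rightarrow> ('m, 'n) tvec" where
  "jacobi_operator X A nabla \<xi> = (\<lambda>y. curvature X A nabla (fst \<xi>) y (snd \<xi>) (snd \<xi>))"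

definition Spec :: "(real ^ 'n \<Rightarrow> real ^ 'n) \<Rightarrow> complex set" where
  "Spec T = {z. det (map_matrix complex_of_real (matrix T) - mat z) = 0}"

(* Spec of an endomorphism of the tangent space at p, which is identified with R^n by means of
   the coordinate basis of a chart; the determinant does not depend on the chart. *)
definition tangent_Spec ::
  "('m, 'n::finite) chart set \<Rightarrow> 'm \<Rightarrow> (('m, 'n) tvec \<Rightarrow> ('m, 'n) tvec) \<Rightarrow> complex set" where
  "tangent_Spec A p T = (let c = chart_at A p in Spec (\<lambda>a. T (tangent_of A c p a) c))"

definition jacobi_Spec ::
  "'m topology \<Rightarrow> ('m, 'n::finite) chart set \<Rightarrow> (('m, 'n) vfield \<Rightarrow> ('m, 'n) vfield \<Rightarrow> ('m, 'n) vfield) \<Rightarrow>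
   'm \<times> ('m, 'n) tvec \<Rightarrow> complex set" where
  "jacobi_Spec X A nabla \<xi> = tangent_Spec A (fst \<xi>) (jacobi_operator X A nabla \<xi>)"


section \<open>Pseudo-Riemannian metrics\<close>

definition pseudo_riemannian_metric ::
  "'m topology \<Rightarrow> ('m, 'n::finite) chart set \<Rightarrow> ('m \<Rightarrow> ('m, 'n) tvec \<Rightarrow> ('m, 'n) tvec \<Rightarrow> real) \<Rightarrow> bool" where
  "pseudo_riemannian_metric X A g \<longleftrightarrow>
    (\<forall>p\<in>topspace X. \<forall>u\<in>tangent_space A p. \<forall>v\<in>tangent_space A p. g p u v = g p v u) \<and>
    (\<forall>p\<in>topspace X. \<forall>u\<in>tangent_space A p. \<forall>u'\<in>tangent_space A p. \<forall>v\<in>tangent_space A p. \<forall>a b.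
       g p (\<lambda>c. a *\<^sub>R u c + b *\<^sub>R u' c) v = a * g p u v + b * g p u' v) \<and>
    (\<forall>p\<in>topspace X. \<forall>u\<in>tangent_space A p.
       (\<forall>v\<in>tangent_space A p. g p u v = 0) \<longrightarrow> u = (\<lambda>c. 0)) \<and>
    (\<forall>U V W. openin X U \<and> smooth_vfield A U V \<and> smooth_vfield A U W \<longrightarrow>
       smooth_fun A U (\<lambda>q. g q (V q) (W q)))"

definition pseudo_riemannian_manifold ::
  "'m topology \<Rightarrow> ('m, 'n::finite) chart set \<Rightarrow> ('m \<Rightarrow> ('m, 'n) tvec \<Rightarrow> ('m, 'n) tvec \<Rightarrow> real) \<Rightarrow> bool" where
  "pseudo_riemannian_manifold X A g \<longleftrightarrow> smooth_manifold X A \<and> pseudo_riemannian_metric X A g"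

definition levi_civita_connection ::
  "'m topology \<Rightarrow> ('m, 'n::finite) chart set \<Rightarrow> ('m \<Rightarrow> ('m, 'n) tvec \<Rightarrow> ('m, 'n) tvec \<Rightarrow> real) \<Rightarrow>
   (('m, 'n) vfield \<Rightarrow> ('m, 'n) vfield \<Rightarrow> ('m, 'n) vfield) \<Rightarrow> bool" where
  "levi_civita_connection X A g nabla \<longleftrightarrow>
    connection X A nabla \<and> torsion_free X A nabla \<and>
    (\<forall>U V W Z. openin X U \<and> smooth_vfield A U V \<and> smooth_vfield A U W \<and> smooth_vfield A U Z \<longrightarrow>
       (\<forall>p\<in>U. dir_deriv A p (V p) (\<lambda>q. g q (W q) (Z q)) =
               g p (nabla V W p) (Z p) + g p (W p) (nabla V Z p)))"


section \<open>Projective Osserman manifolds\<close>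

definition nonzero_vectors :: "'m topology \<Rightarrow> ('m, 'n::finite) chart set \<Rightarrow> ('m \<times> ('m, 'n) tvec) set" where
  "nonzero_vectors X A = {\<xi> \<in> tangent_bundle X A. snd \<xi> \<noteq> (\<lambda>c. 0)}"

definition spacelike_unit_vectors ::
  "'m topology \<Rightarrow> ('m, 'n::finite) chart set \<Rightarrow> ('m \<Rightarrow> ('m, 'n) tvec \<Rightarrow> ('m, 'n) tvec \<Rightarrow> real) \<Rightarrow> ('m \<times> ('m, 'n) tvec) set" where
  "spacelike_unit_vectors X A g = {\<xi> \<in> tangent_bundle X A. g (fst \<xi>) (snd \<xi>) (snd \<xi>) = 1}"

definition timelike_unit_vectors ::
  "'m topology \<Rightarrow> ('m, 'n::finite) chart set \<Rightarrow> ('m \<Rightarrow> ('m, 'n) tvec \<Rightarrow> ('m, 'n) tvec \<Rightarrow> real) \<Rightarrow> ('m \<times> ('m, 'n) tvec) set" where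
  "timelike_unit_vectors X A g = {\<xi> \<in> tangent_bundle X A. g (fst \<xi>) (snd \<xi>) (snd \<xi>) = - 1}"

definition scale_set :: "real \<Rightarrow> complex set \<Rightarrow> complex set" where
  "scale_set s E = (\<lambda>z. complex_of_real s * z) ` E"

definition projective_osserman_on ::
  "'m topology \<Rightarrow> ('m, 'n::finite) chart set \<Rightarrow> (('m, 'n) vfield \<Rightarrow> ('m, 'n) vfield \<Rightarrow> ('m, 'n) vfield) \<Rightarrow>
   ('m \<times> ('m, 'n) tvec) set \<Rightarrow> bool" where
  "projective_osserman_on X A nabla S \<longleftrightarrow>
     (\<forall>x\<in>S. \<forall>y\<in>S. \<exists>s::real. s \<noteq> 0 \<and>
        jacobi_Spec X A nabla y = scale_set s (jacobi_Spec X A nabla x) \<and>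
        scale_set s (jacobi_Spec X A nabla x) \<noteq> {0})"

definition affine_projective_osserman ::
  "'m topology \<Rightarrow> ('m, 'n::finite) chart set \<Rightarrow> (('m, 'n) vfield \<Rightarrow> ('m, 'n) vfield \<Rightarrow> ('m, 'n) vfield) \<Rightarrow> bool" where
  "affine_projective_osserman X A nabla \<longleftrightarrow>
     affine_manifold X A nabla \<and> projective_osserman_on X A nabla (nonzero_vectors X A)"

(* nabla is the Levi-Civita connection of g in the next two definitions. *)
definition spacelike_projective_osserman ::
  "'m topology \<Rightarrow> ('m, 'n::finite) chart set \<Rightarrow> ('m \<Rightarrow> ('m, 'n) tvec \<Rightarrow> ('m, 'n) tvec \<Rightarrow> real) \<Rightarrow>
   (('m, 'n) vfield \<Rightarrow> ('m, 'n) vfield \<Rightarrow> ('m, 'n) vfield) \<Rightarrow> bool" where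
  "spacelike_projective_osserman X A g nabla \<longleftrightarrow>
     pseudo_riemannian_manifold X A g \<and> levi_civita_connection X A g nabla \<and>
     projective_osserman_on X A nabla (spacelike_unit_vectors X A g)"

definition timelike_projective_osserman ::
  "'m topology \<Rightarrow> ('m, 'n::finite) chart set \<Rightarrow> ('m \<Rightarrow> ('m, 'n) tvec \<Rightarrow> ('m, 'n) tvec \<Rightarrow> real) \<Rightarrow>
   (('m, 'n) vfield \<Rightarrow> ('m, 'n) vfield \<Rightarrow> ('m, 'n) vfield) \<Rightarrow> bool" where
  "timelike_projective_osserman X A g nabla \<longleftrightarrow>
     pseudo_riemannian_manifold X A g \<and> levi_civita_connection X A g nabla \<and>
     projective_osserman_on X A nabla (timelike_unit_vectors X A g)"


section \<open>Smooth scaling functions\<close>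

(* The chart of TM induced by a chart c of M. *)
definition bundle_chart :: "('m, 'n::finite) chart \<Rightarrow> 'm \<times> ('m, 'n) tvec \<Rightarrow> (real ^ 'n) \<times> (real ^ 'n)" where
  "bundle_chart c \<xi> = (chart_map c (fst \<xi>), snd \<xi> c)"

(* Smoothness on S \<times> S for a subset S of TM: in the charts of TM \<times> TM, the function s is locally
   the restriction of a smooth function on an open set. If S is open or an embedded submanifold
   (such as the unit vectors), this is smoothness on the manifold S \<times> S. *)
definition smooth_on_pairs ::
  "('m, 'n::finite) chart set \<Rightarrow> ('m \<times> ('m, 'n) tvec) set \<Rightarrow>
   ('m \<times> ('m, 'n) tvec \<Rightarrow> 'm \<times> ('m, 'n) tvec \<Rightarrow> real) \<Rightarrow> bool" where
  "smooth_on_pairs A S s \<longleftrightarrow>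
    (\<forall>x\<in>S. \<forall>y\<in>S. \<forall>c\<in>A. \<forall>d\<in>A. fst x \<in> chart_dom c \<and> fst y \<in> chart_dom d \<longrightarrow>
       (\<exists>N F. open N \<and> (bundle_chart c x, bundle_chart d y) \<in> N \<and> smooth_on N F \<and>
          (\<forall>x'\<in>S. \<forall>y'\<in>S. fst x' \<in> chart_dom c \<and> fst y' \<in> chart_dom d \<and>
             (bundle_chart c x', bundle_chart d y') \<in> N \<longrightarrow>
             s x' y' = F (bundle_chart c x', bundle_chart d y'))))"

definition positive_smooth_scaling ::
  "'m topology \<Rightarrow> ('m, 'n::finite) chart set \<Rightarrow> (('m, 'n) vfield \<Rightarrow> ('m, 'n) vfield \<Rightarrow> ('m, 'n) vfield) \<Rightarrow>
   ('m \<times> ('m, 'n) tvec) set \<Rightarrow> ('m \<times> ('m, 'n) tvec \<Rightarrow> 'm \<times> ('m, 'n) tvec \<Rightarrow> real) \<Rightarrow> bool" where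
  "positive_smooth_scaling X A nabla S s \<longleftrightarrow>
     (\<forall>x\<in>S. \<forall>y\<in>S. s x y > 0 \<and>
        jacobi_Spec X A nabla y = scale_set (s x y) (jacobi_Spec X A nabla x)) \<and>
     smooth_on_pairs A S s"

end

theory Submission
  imports Defs "HOL-Computational_Algebra.Fundamental_Theorem_Algebra"
begin

text \<open>
  Let n be the dimension and consider the characteristic polynomial of the Jacobi operator J(x) of a
  tangent vector x. Its coefficient of degree n - j, called a(j) in the following, is homogeneous of
  degree j in the eigenvalues. The weight w(x), the sum over j of the j-th roots of the moduli of the
  a(j), is thus multiplied by t when the eigenvalues are multiplied by t > 0, and the shape of x, the
  family of the quotients a(j) / w(x)^j, does not change.

  The projective Osserman condition prescribes the spectrum up to a real factor, as a set without
  multiplicities. Nevertheless it leaves only finitely many shapes: after a positive rescaling all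
  eigenvalues lie in one finite set, and there are only finitely many polynomials of degree n with given
  leading coefficient and all roots in a finite set (lemma \<open>finite_shapes\<close>). On the other hand the
  shape is continuous, since the matrix of J(x) depends smoothly on x. Consequently it is constant where
  connectedness can be used, and this takes care of the sign of the scaling factor and of the
  multiplicities at the same time.

  The unit vectors over a point may be disconnected. As J(t x) = t^2 J(x), the shape extends to the cone
  of all non-zero multiples of the given vectors and is even. Two vectors u and v in the same fibre of
  the cone are joined in it by a segment from u to v or from u to -v, so that the shape depends on the
  base point only. There it is locally constant, and the points over which the cone is empty form an open
  set: in the spacelike case these are the points where the metric is negative definite. So a connected
  base has a single shape (lemma \<open>shape_constant\<close>). Timelike vectors are spacelike for the
  metric -g.

  Equal shapes mean that the spectrum of J(y) is w(y) / w(x) times the spectrum of J(x). If a(j) is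
  non-zero at one vector it is non-zero at all of them, because the shape is constant, and w(y) / w(x)
  is the j-th root of the quotient of the two values of a(j). This is a positive and smooth function.

  It remains to see that J(x) has smooth components in the charts of the tangent bundle. The curvature
  is defined by extending vectors to fields; computing with Christoffel symbols shows that the result is
  independent of the extensions and equals the classical formula (lemmas \<open>nabla_chart\<close>,
  \<open>curvature_field_chart\<close>, \<open>curvature\<close>). The second derivatives that appear cancel by
  their symmetry, which is proved from the mean value theorem.
\<close>

section \<open>Calculus of smooth maps\<close>

lemma Ck_on_subset: "Ck_on k S f \<Longrightarrow> T \<subseteq> S \<Longrightarrow> Ck_on k T f"
  by (induction k arbitrary: f) (auto intro: continuous_on_subset)

lemma Ck_on_cong:
  assumes "open S" and "\<And>x. x \<in> S \<Longrightarrow> f x = g x" and "Ck_on k S f"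
  shows "Ck_on k S g"
  using assms(2,3)
proof (induction k arbitrary: f g)
  case 0
  then show ?case by (simp cong: continuous_on_cong)
next
  case (Suc k)
  have D: "(g has_derivative frechet_derivative f (at x)) (at x)" if "x \<in> S" for x
    using has_derivative_transform_within_open[OF _ \<open>open S\<close> that Suc.prems(1)] Suc.prems(2) that
    by (auto simp: frechet_derivative_works)
  have "Ck_on k S (\<lambda>x. frechet_derivative g (at x) v)" for v
  proof (rule Suc.IH)
    show "Ck_on k S (\<lambda>x. frechet_derivative f (at x) v)" using Suc.prems(2) by simp
    show "frechet_derivative f (at x) v = frechet_derivative g (at x) v" if "x \<in> S" for x
      using frechet_derivative_at[OF D[OF that]] by simp
  qed
  then show ?case using D by (auto simp: differentiable_def)
qed

lemma Ck_on_Suc_imp: "Ck_on (Suc k) S f \<Longrightarrow> Ck_on k S f"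
proof (induction k arbitrary: f)
  case 0
  then show ?case
    by (simp add: continuous_at_imp_continuous_on differentiable_imp_continuous_within)
next
  case (Suc k)
  from Suc.prems show ?case
    unfolding Ck_on.simps(2)[of "Suc k"] Ck_on.simps(2)[of k S f] using Suc.IH by blast
qed

lemma Ck_on_SucI:
  assumes "open S"
    and "\<And>x. x \<in> S \<Longrightarrow> (f has_derivative f' x) (at x)"
    and "\<And>v. Ck_on k S (\<lambda>x. f' x v)"
  shows "Ck_on (Suc k) S f"
proof -
  have "Ck_on k S (\<lambda>x. frechet_derivative f (at x) v)" for v
    by (rule Ck_on_cong[OF assms(1) _ assms(3)]) (simp add: frechet_derivative_at[OF assms(2), symmetric])
  moreover have "f differentiable (at x)" if "x \<in> S" for x
    using assms(2)[OF that] by (rule differentiableI)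
  ultimately show ?thesis by simp
qed

lemma Ck_on_SucD:
  assumes "Ck_on (Suc k) S f"
  shows "\<And>x. x \<in> S \<Longrightarrow> (f has_derivative frechet_derivative f (at x)) (at x)"
    and "\<And>v. Ck_on k S (\<lambda>x. frechet_derivative f (at x) v)"
  using assms by (simp_all flip: frechet_derivative_works)

lemma Ck_on_const: "open S \<Longrightarrow> Ck_on k S (\<lambda>x. c)"
  by (induction k arbitrary: c) auto

lemma Ck_on_bounded_linear:
  assumes "open S" "bounded_linear L" "Ck_on k S f"
  shows "Ck_on k S (\<lambda>x. L (f x))"
  using assms(3)
proof (induction k arbitrary: f)
  case 0
  then show ?case using bounded_linear.continuous_on[OF assms(2)] by simp
next
  case (Suc k)
  show ?case
    by (rule Ck_on_SucI[OF \<open>open S\<close> bounded_linear.has_derivative[OF assms(2) Ck_on_SucD(1)[OF Suc.prems]]])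
      (auto intro: Suc.IH Ck_on_SucD(2)[OF Suc.prems])
qed

lemma Ck_on_ident: assumes "open S" shows "Ck_on k S (\<lambda>x. x)"
proof (cases k)
  case (Suc j)
  show ?thesis unfolding Suc by (rule Ck_on_SucI[OF assms has_derivative_ident Ck_on_const[OF assms]])
qed simp

lemma Ck_on_add:
  assumes "open S" "Ck_on k S f" "Ck_on k S g"
  shows "Ck_on k S (\<lambda>x. f x + g x)"
  using assms(2,3)
proof (induction k arbitrary: f g)
  case 0
  then show ?case by (auto intro!: continuous_intros)
next
  case (Suc k)
  show ?case
    by (rule Ck_on_SucI[OF \<open>open S\<close> has_derivative_add[OF Ck_on_SucD(1)[OF Suc.prems(1)] Ck_on_SucD(1)[OF Suc.prems(2)]]])
      (auto intro: Suc.IH Ck_on_SucD(2)[OF Suc.prems(1)] Ck_on_SucD(2)[OF Suc.prems(2)])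
qed

lemma Ck_on_scaleR:
  fixes f :: "'a::real_normed_vector \<Rightarrow> real"
  assumes "open S" "Ck_on k S f" "Ck_on k S g"
  shows "Ck_on k S (\<lambda>x. f x *\<^sub>R g x)"
  using assms(2,3)
proof (induction k arbitrary: f g)
  case 0
  then show ?case by (auto intro!: continuous_intros)
next
  case (Suc k)
  show ?case
    by (rule Ck_on_SucI[OF \<open>open S\<close> has_derivative_scaleR[OF Ck_on_SucD(1)[OF Suc.prems(1)] Ck_on_SucD(1)[OF Suc.prems(2)]]])
      (auto intro!: Ck_on_add \<open>open S\<close> Suc.IH Ck_on_SucD(2)[OF Suc.prems(1)] Ck_on_SucD(2)[OF Suc.prems(2)]
         Ck_on_Suc_imp[OF Suc.prems(1)] Ck_on_Suc_imp[OF Suc.prems(2)])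
qed

lemma Ck_on_sum:
  assumes "open S" "\<And>i. i \<in> I \<Longrightarrow> Ck_on k S (f i)"
  shows "Ck_on k S (\<lambda>x. \<Sum>i\<in>I. f i x)"
  using assms(2) by (induction I rule: infinite_finite_induct) (auto intro: Ck_on_const Ck_on_add assms(1))

lemma linear_euclidean_expand:
  fixes L :: "'a::euclidean_space \<Rightarrow> 'b::real_normed_vector"
  assumes "linear L" shows "L w = (\<Sum>b\<in>Basis. (w \<bullet> b) *\<^sub>R L b)"
proof -
  have "L w = L (\<Sum>b\<in>Basis. (w \<bullet> b) *\<^sub>R b)" by (simp add: euclidean_representation)
  also have "\<dots> = (\<Sum>b\<in>Basis. (w \<bullet> b) *\<^sub>R L b)"
    using assms by (simp add: linear_sum linear_scale)
  finally show ?thesis .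
qed

text \<open>The directional derivatives of a composite are expanded in a basis of the intermediate space: each
summand is then a product of functions of the same two shapes, with one degree of smoothness less, and
the induction goes through. This is where the intermediate space has to be finite-dimensional.\<close>

lemma Ck_on_compose:
  fixes f :: "'a::real_normed_vector \<Rightarrow> 'b::euclidean_space"
  assumes "open S" "open T" "f ` S \<subseteq> T" "Ck_on k S f" "Ck_on k T g"
  shows "Ck_on k S (\<lambda>x. g (f x))"
  using assms(4,5)
proof (induction k arbitrary: g)
  case 0
  then show ?case using continuous_on_compose2[of T g S f] assms(3) by auto
next
  case (Suc k)
  have T: "f x \<in> T" if "x \<in> S" for x using that assms(3) by auto
  let ?D = "\<lambda>y. frechet_derivative g (at y)"
  have D: "((\<lambda>x. g (f x)) has_derivative
      (\<lambda>v. \<Sum>b\<in>Basis. (frechet_derivative f (at x) v \<bullet> b) *\<^sub>R ?D (f x) b)) (at x)" if "x \<in> S" for x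
  proof -
    have g': "(g has_derivative ?D (f x)) (at (f x))" by (rule Ck_on_SucD(1)[OF Suc.prems(2) T[OF that]])
    have "?D (f x) \<circ> frechet_derivative f (at x) =
        (\<lambda>v. \<Sum>b\<in>Basis. (frechet_derivative f (at x) v \<bullet> b) *\<^sub>R ?D (f x) b)"
      by (rule ext) (simp add: linear_euclidean_expand[OF has_derivative_linear[OF g'], symmetric])
    then show ?thesis
      using diff_chain_at[OF Ck_on_SucD(1)[OF Suc.prems(1) that] g'] by (simp add: o_def)
  qed
  show ?case
    by (rule Ck_on_SucI[OF \<open>open S\<close> D])
      (auto intro!: Ck_on_sum Ck_on_scaleR \<open>open S\<close> Suc.IH Ck_on_Suc_imp[OF Suc.prems(1)]
        Ck_on_bounded_linear[OF _ bounded_linear_inner_left]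
        Ck_on_SucD(2)[OF Suc.prems(1)] Ck_on_SucD(2)[OF Suc.prems(2)])
qed

lemma smooth_on_subset: "smooth_on S f \<Longrightarrow> T \<subseteq> S \<Longrightarrow> smooth_on T f"
  by (auto simp: smooth_on_def intro: Ck_on_subset)

lemma smooth_on_cong:
  "open S \<Longrightarrow> (\<And>x. x \<in> S \<Longrightarrow> f x = g x) \<Longrightarrow> smooth_on S f \<Longrightarrow> smooth_on S g"
  unfolding smooth_on_def by (blast intro: Ck_on_cong)

lemma smooth_on_const: "open S \<Longrightarrow> smooth_on S (\<lambda>x. c)"
  by (simp add: smooth_on_def Ck_on_const)

lemma smooth_on_ident: "open S \<Longrightarrow> smooth_on S (\<lambda>x. x)"
  by (simp add: smooth_on_def Ck_on_ident)

lemma smooth_on_bounded_linear: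
  "open S \<Longrightarrow> bounded_linear L \<Longrightarrow> smooth_on S f \<Longrightarrow> smooth_on S (\<lambda>x. L (f x))"
  by (simp add: smooth_on_def Ck_on_bounded_linear)

lemma smooth_on_add:
  "open S \<Longrightarrow> smooth_on S f \<Longrightarrow> smooth_on S g \<Longrightarrow> smooth_on S (\<lambda>x. f x + g x)"
  by (simp add: smooth_on_def Ck_on_add)

lemma smooth_on_scaleR:
  fixes f :: "'a::real_normed_vector \<Rightarrow> real"
  shows "open S \<Longrightarrow> smooth_on S f \<Longrightarrow> smooth_on S g \<Longrightarrow> smooth_on S (\<lambda>x. f x *\<^sub>R g x)"
  by (simp add: smooth_on_def Ck_on_scaleR)

lemma smooth_on_mult:
  fixes f g :: "'a::real_normed_vector \<Rightarrow> real"
  shows "open S \<Longrightarrow> smooth_on S f \<Longrightarrow> smooth_on S g \<Longrightarrow> smooth_on S (\<lambda>x. f x * g x)"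
  using smooth_on_scaleR[of S f g] by simp

lemma smooth_on_sum:
  "open S \<Longrightarrow> (\<And>i. i \<in> I \<Longrightarrow> smooth_on S (f i)) \<Longrightarrow> smooth_on S (\<lambda>x. \<Sum>i\<in>I. f i x)"
  by (simp add: smooth_on_def Ck_on_sum)

lemma smooth_on_minus: "open S \<Longrightarrow> smooth_on S f \<Longrightarrow> smooth_on S (\<lambda>x. - f x)"
  using smooth_on_scaleR[of S "\<lambda>_. -1" f] by (simp add: smooth_on_const)

lemma smooth_on_diff:
  "open S \<Longrightarrow> smooth_on S f \<Longrightarrow> smooth_on S g \<Longrightarrow> smooth_on S (\<lambda>x. f x - g x)"
  using smooth_on_add[of S f "\<lambda>x. - g x"] by (simp add: smooth_on_minus)

lemma smooth_on_vec_nth: "open S \<Longrightarrow> smooth_on S f \<Longrightarrow> smooth_on S (\<lambda>x. f x $ i)"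
  by (rule smooth_on_bounded_linear[OF _ bounded_linear_vec_nth])

lemma smooth_on_compose:
  fixes f :: "'a::real_normed_vector \<Rightarrow> 'b::euclidean_space"
  shows "open S \<Longrightarrow> open T \<Longrightarrow> f ` S \<subseteq> T \<Longrightarrow> smooth_on S f \<Longrightarrow> smooth_on T g \<Longrightarrow>
    smooth_on S (\<lambda>x. g (f x))"
  unfolding smooth_on_def by (blast intro: Ck_on_compose)

lemma smooth_on_frechet_derivative:
  "smooth_on S f \<Longrightarrow> smooth_on S (\<lambda>x. frechet_derivative f (at x) v)"
  unfolding smooth_on_def using Ck_on_SucD(2) by blast

lemma smooth_on_has_derivative:
  "smooth_on S f \<Longrightarrow> x \<in> S \<Longrightarrow> (f has_derivative frechet_derivative f (at x)) (at x)"
  using Ck_on_SucD(1)[of 0 S f x] unfolding smooth_on_def by blast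

lemma smooth_on_continuous_on: "smooth_on S f \<Longrightarrow> continuous_on S f"
  by (auto simp: smooth_on_def dest: spec[of _ 0])

text \<open>Differentiability of order k is defined through derivatives in fixed directions; expanding the
direction in a basis makes it available for a direction that varies with the point.\<close>

lemma smooth_on_frechet_derivative_apply:
  fixes f :: "'a::euclidean_space \<Rightarrow> 'b::real_normed_vector"
  assumes "open S" "smooth_on S f" "open T" "g ` T \<subseteq> S" "smooth_on T g" "smooth_on T h"
  shows "smooth_on T (\<lambda>x. frechet_derivative f (at (g x)) (h x))"
proof (rule smooth_on_cong[OF \<open>open T\<close>])
  show "smooth_on T (\<lambda>x. \<Sum>b\<in>Basis. (h x \<bullet> b) *\<^sub>R frechet_derivative f (at (g x)) b)"
    by (auto intro!: smooth_on_sum smooth_on_scaleR smooth_on_bounded_linear[OF _ bounded_linear_inner_left]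
        smooth_on_compose[OF \<open>open T\<close> \<open>open S\<close> assms(4,5)] smooth_on_frechet_derivative assms)
  show "(\<Sum>b\<in>Basis. (h x \<bullet> b) *\<^sub>R frechet_derivative f (at (g x)) b) =
      frechet_derivative f (at (g x)) (h x)" if "x \<in> T" for x
    using linear_euclidean_expand[OF has_derivative_linear[OF smooth_on_has_derivative[OF assms(2)]]] that assms(4)
    by (metis image_subset_iff)
qed

lemma smooth_on_powr: "smooth_on {0<..} (\<lambda>x::real. x powr a)"
proof -
  have "Ck_on k {0<..} (\<lambda>x::real. x powr a)" for k
  proof (induction k arbitrary: a)
    case 0
    then show ?case by (auto intro!: continuous_intros)
  next
    case (Suc k)
    show ?case
    proof (rule Ck_on_SucI)
      show "((\<lambda>x. x powr a) has_derivative (\<lambda>v. v *\<^sub>R (a *\<^sub>R x powr (a - 1)))) (at x)" if "x \<in> {0<..}" for x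
        using has_real_derivative_powr[of x a] that
        unfolding has_field_derivative_def real_scaleR_def by (simp add: mult.commute[of _ "a * x powr (a - 1)"])
      show "Ck_on k {0<..} (\<lambda>x. v *\<^sub>R (a *\<^sub>R x powr (a - 1)))" for v
        by (intro Ck_on_scaleR Ck_on_const Suc.IH open_greaterThan)
    qed simp
  qed
  then show ?thesis by (simp add: smooth_on_def)
qed

section \<open>Symmetry of second derivatives\<close>

text \<open>The second difference on the left does not change when v and w are exchanged, whereas two
applications of the mean value theorem express it by the derivative along v followed by the one along
w. Doing this for both orders and letting t tend to 0 compares the two mixed second derivatives.\<close>

lemma second_difference_mvt:
  fixes f :: "'a::real_normed_vector \<Rightarrow> real"
  assumes f: "smooth_on S f" and sub: "ball x d \<subseteq> S" and t: "0 < t" "t * (norm v + norm w) < d"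
  shows "\<exists>y\<in>ball x d. f (x + t *\<^sub>R v + t *\<^sub>R w) - f (x + t *\<^sub>R v) - f (x + t *\<^sub>R w) + f x =
    t * t * frechet_derivative (\<lambda>z. frechet_derivative f (at z) v) (at y) w"
proof -
  have mem: "x + r *\<^sub>R v + s *\<^sub>R w \<in> ball x d" if "0 \<le> r" "r \<le> t" "0 \<le> s" "s \<le> t" for r s
  proof -
    have "norm (r *\<^sub>R v + s *\<^sub>R w) \<le> r * norm v + s * norm w"
      using norm_triangle_ineq[of "r *\<^sub>R v" "s *\<^sub>R w"] that by simp
    also have "\<dots> \<le> t * norm v + t * norm w" using that by (intro add_mono mult_right_mono) auto
    also have "\<dots> = t * (norm v + norm w)" by (simp add: distrib_left)
    finally have "norm (r *\<^sub>R v + s *\<^sub>R w) < d" using t by linarith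
    moreover have "x - (x + r *\<^sub>R v + s *\<^sub>R w) = - (r *\<^sub>R v + s *\<^sub>R w)" by simp
    ultimately show ?thesis unfolding mem_ball dist_norm by (metis norm_minus_cancel)
  qed
  let ?D = "\<lambda>z. frechet_derivative f (at z)"
  let ?E = "\<lambda>z. frechet_derivative (\<lambda>z. frechet_derivative f (at z) v) (at z)"
  have fD: "(f has_derivative ?D z) (at z)" if "z \<in> ball x d" for z
    using smooth_on_has_derivative[OF f] that sub by blast
  have fE: "((\<lambda>z. ?D z v) has_derivative ?E z) (at z)" if "z \<in> ball x d" for z
    using smooth_on_has_derivative[OF smooth_on_frechet_derivative[OF f]] that sub by blast
  define \<phi> where "\<phi> r = f (x + r *\<^sub>R v + t *\<^sub>R w) - f (x + r *\<^sub>R v)" for r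
  have d\<phi>: "(\<phi> has_real_derivative (?D (x + r *\<^sub>R v + t *\<^sub>R w) v - ?D (x + r *\<^sub>R v) v)) (at r)"
    if "0 \<le> r" "r \<le> t" for r
  proof -
    have 1: "((\<lambda>r. f (x + r *\<^sub>R v + t *\<^sub>R w)) has_derivative (\<lambda>h. ?D (x + r *\<^sub>R v + t *\<^sub>R w) (h *\<^sub>R v))) (at r)"
      by (rule has_derivative_compose[where f = "\<lambda>r. x + r *\<^sub>R v + t *\<^sub>R w" and f' = "\<lambda>h. h *\<^sub>R v"])
        (use t in \<open>auto intro!: derivative_eq_intros fD mem that\<close>)
    have m: "x + r *\<^sub>R v \<in> ball x d" using mem[OF that, of 0] t by simp
    have 2: "((\<lambda>r. f (x + r *\<^sub>R v)) has_derivative (\<lambda>h. ?D (x + r *\<^sub>R v) (h *\<^sub>R v))) (at r)"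
      by (rule has_derivative_compose[where f = "\<lambda>r. x + r *\<^sub>R v" and f' = "\<lambda>h. h *\<^sub>R v"])
        (auto intro!: derivative_eq_intros fD m)
    have l: "linear (?D (x + r *\<^sub>R v + t *\<^sub>R w))" "linear (?D (x + r *\<^sub>R v))"
      using fD[OF mem[OF that, of t]] fD[OF m] t by (simp_all add: has_derivative_linear)
    show ?thesis unfolding \<phi>_def has_field_derivative_def
      by (rule has_derivative_eq_rhs[OF has_derivative_diff[OF 1 2]])
        (use l in \<open>auto simp: fun_eq_iff linear_scale algebra_simps\<close>)
  qed
  obtain r where r: "0 < r" "r < t" "\<phi> t - \<phi> 0 = (t - 0) * (?D (x + r *\<^sub>R v + t *\<^sub>R w) v - ?D (x + r *\<^sub>R v) v)"
    using MVT2[OF t(1) d\<phi>] by blast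
  define \<psi> where "\<psi> s = ?D (x + r *\<^sub>R v + s *\<^sub>R w) v" for s
  have d\<psi>: "(\<psi> has_real_derivative ?E (x + r *\<^sub>R v + s *\<^sub>R w) w) (at s)" if "0 \<le> s" "s \<le> t" for s
  proof -
    have m: "x + r *\<^sub>R v + s *\<^sub>R w \<in> ball x d" using mem r that by simp
    have 1: "((\<lambda>s. ?D (x + r *\<^sub>R v + s *\<^sub>R w) v) has_derivative (\<lambda>h. ?E (x + r *\<^sub>R v + s *\<^sub>R w) (h *\<^sub>R w))) (at s)"
      by (rule has_derivative_compose[where f = "\<lambda>s. x + r *\<^sub>R v + s *\<^sub>R w" and f' = "\<lambda>h. h *\<^sub>R w"])
        (auto intro!: derivative_eq_intros fE m)
    show ?thesis unfolding \<psi>_def has_field_derivative_def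
      by (rule has_derivative_eq_rhs[OF 1])
        (use has_derivative_linear[OF fE[OF m]] in \<open>auto simp: fun_eq_iff linear_scale algebra_simps\<close>)
  qed
  obtain s where s: "0 < s" "s < t" "\<psi> t - \<psi> 0 = (t - 0) * ?E (x + r *\<^sub>R v + s *\<^sub>R w) w"
    using MVT2[OF t(1) d\<psi>] by blast
  have "\<phi> t - \<phi> 0 = t * t * ?E (x + r *\<^sub>R v + s *\<^sub>R w) w"
    using r(3) s(3) by (simp add: \<psi>_def)
  then show ?thesis using mem[of r s] r s by (intro bexI[of _ "x + r *\<^sub>R v + s *\<^sub>R w"]) (auto simp: \<phi>_def algebra_simps)
qed

lemma symmetric_second_derivative_real:
  fixes f :: "'a::real_normed_vector \<Rightarrow> real"
  assumes f: "smooth_on S f" and S: "open S" "x \<in> S"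
  shows "frechet_derivative (\<lambda>z. frechet_derivative f (at z) v) (at x) w =
    frechet_derivative (\<lambda>z. frechet_derivative f (at z) w) (at x) v"
proof -
  let ?A = "\<lambda>v w y. frechet_derivative (\<lambda>z. frechet_derivative f (at z) v) (at y) w"
  have c: "isCont (?A v w) x" for v w
    using smooth_on_continuous_on[OF smooth_on_frechet_derivative[OF smooth_on_frechet_derivative[OF f]]] S
    by (simp add: continuous_on_eq_continuous_at)
  have "\<bar>?A v w x - ?A w v x\<bar> \<le> e" if e: "e > 0" for e
  proof -
    obtain d1 where d1: "d1 > 0" "\<And>y. dist y x < d1 \<Longrightarrow> dist (?A v w y) (?A v w x) < e/2"
      using c[of v w] e unfolding continuous_at_eps_delta by (metis half_gt_zero)
    obtain d2 where d2: "d2 > 0" "\<And>y. dist y x < d2 \<Longrightarrow> dist (?A w v y) (?A w v x) < e/2"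
      using c[of w v] e unfolding continuous_at_eps_delta by (metis half_gt_zero)
    obtain d3 where d3: "d3 > 0" "ball x d3 \<subseteq> S" using S openE by blast
    define d where "d = min d1 (min d2 d3)"
    define t where "t = d / (2 * (norm v + norm w + 1))"
    have d: "d > 0" "ball x d \<subseteq> S" using d1 d2 d3 by (auto simp: d_def)
    have p: "norm v + norm w + 1 > 0" by (simp add: add_nonneg_pos)
    have t: "t > 0" using d p by (simp add: t_def)
    have "t * (norm v + norm w) \<le> t * (norm v + norm w + 1)" using t by (simp add: algebra_simps)
    also have "\<dots> = d / 2" using p unfolding t_def by (simp add: divide_simps del: distrib_left_numeral)
    also have "\<dots> < d" using d by simp
    finally have td: "t * (norm v + norm w) < d" .
    then have td': "t * (norm w + norm v) < d" by (simp add: add.commute)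
    obtain y where y: "y \<in> ball x d" "f (x + t *\<^sub>R v + t *\<^sub>R w) - f (x + t *\<^sub>R v) - f (x + t *\<^sub>R w) + f x = t * t * ?A v w y"
      using second_difference_mvt[OF f d(2) t td] by blast
    obtain z where z: "z \<in> ball x d" "f (x + t *\<^sub>R w + t *\<^sub>R v) - f (x + t *\<^sub>R w) - f (x + t *\<^sub>R v) + f x = t * t * ?A w v z"
      using second_difference_mvt[OF f d(2) t td'] by blast
    have "t * t * ?A v w y = t * t * ?A w v z"
      using y(2) z(2) by (simp add: algebra_simps)
    then have "?A v w y = ?A w v z" using t by simp
    moreover have "dist (?A v w y) (?A v w x) < e/2" using y by (intro d1) (auto simp: d_def dist_commute)
    moreover have "dist (?A w v z) (?A w v x) < e/2" using z by (intro d2) (auto simp: d_def dist_commute)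
    ultimately show ?thesis unfolding dist_real_def by linarith
  qed
  then have "\<bar>?A v w x - ?A w v x\<bar> \<le> 0" by (rule field_le_epsilon[of _ 0, simplified])
  then show ?thesis by simp
qed

lemma frechet_derivative_bounded_linear:
  assumes "bounded_linear L" "f differentiable at x"
  shows "frechet_derivative (\<lambda>z. L (f z)) (at x) = (\<lambda>v. L (frechet_derivative f (at x) v))"
  using frechet_derivative_at[OF bounded_linear.has_derivative[OF assms(1)]] assms(2)
  by (metis frechet_derivative_works)

lemma symmetric_second_derivative:
  fixes f :: "'a::real_normed_vector \<Rightarrow> 'b::euclidean_space"
  assumes f: "smooth_on S f" and S: "open S" "x \<in> S"
  shows "frechet_derivative (\<lambda>z. frechet_derivative f (at z) v) (at x) w =
    frechet_derivative (\<lambda>z. frechet_derivative f (at z) w) (at x) v"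
proof (rule euclidean_eqI)
  fix b :: 'b
  let ?L = "\<lambda>y. y \<bullet> b"
  have L: "bounded_linear ?L" by (rule bounded_linear_inner_left)
  have fd: "f differentiable at z" "(\<lambda>z. frechet_derivative f (at z) v) differentiable at z" if "z \<in> S" for z v
    using smooth_on_has_derivative[OF f that] smooth_on_has_derivative[OF smooth_on_frechet_derivative[OF f] that]
    by (auto simp: differentiable_def)
  have eq: "frechet_derivative (\<lambda>z. frechet_derivative (\<lambda>z. ?L (f z)) (at z) v) (at x) w =
      ?L (frechet_derivative (\<lambda>z. frechet_derivative f (at z) v) (at x) w)" for v w
  proof -
    have "frechet_derivative (\<lambda>z. ?L (frechet_derivative f (at z) v)) (at x) =
        frechet_derivative (\<lambda>z. frechet_derivative (\<lambda>z. ?L (f z)) (at z) v) (at x)"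
    proof (rule frechet_derivative_transform_within_open[OF _ S])
      show "(\<lambda>z. ?L (frechet_derivative f (at z) v)) differentiable at x"
        using bounded_linear.has_derivative[OF L] fd(2)[OF S(2), of v] unfolding differentiable_def by blast
      show "?L (frechet_derivative f (at z) v) = frechet_derivative (\<lambda>z. ?L (f z)) (at z) v" if "z \<in> S" for z
        using frechet_derivative_bounded_linear[OF L fd(1)[OF that]] by simp
    qed
    then show ?thesis using frechet_derivative_bounded_linear[OF L fd(2)[OF S(2)]] by metis
  qed
  show "?L (frechet_derivative (\<lambda>z. frechet_derivative f (at z) v) (at x) w) =
      ?L (frechet_derivative (\<lambda>z. frechet_derivative f (at z) w) (at x) v)"
    using symmetric_second_derivative_real[OF smooth_on_bounded_linear[OF S(1) L f] S] unfolding eq .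
qed

section \<open>Characteristic polynomials\<close>

text \<open>The sign convention det (M - X) is the one of the spectrum; the leading coefficient is therefore
(-1)^n.\<close>

definition charpoly :: "real ^ 'n ^ 'n \<Rightarrow> real poly" where
  "charpoly M = det (\<chi> i j. if i = j then [:M $ i $ j, -1:] else [:M $ i $ j:])"

text \<open>Applied to the evaluation of polynomials at a real or a complex number, this relates the determinant
over the polynomial ring to determinants of matrices of numbers.\<close>

lemma det_ring_hom:
  fixes h :: "'a::comm_ring_1 \<Rightarrow> 'b::comm_ring_1" and B :: "'a ^ 'n ^ 'n"
  assumes add: "\<And>x y. h (x + y) = h x + h y" and mult: "\<And>x y. h (x * y) = h x * h y" and one: "h 1 = 1"
  shows "h (det B) = det (\<chi> i j. h (B $ i $ j))"
proof -
  have zero: "h 0 = 0" using add[of 0 0] by simp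
  have neg: "h (- x) = - h x" for x using add[of x "- x"] zero by (simp add: eq_neg_iff_add_eq_0 add.commute)
  have sum: "h (sum f I) = (\<Sum>i\<in>I. h (f i))" for f :: "('n \<Rightarrow> 'n) \<Rightarrow> 'a" and I
    by (induction I rule: infinite_finite_induct) (simp_all add: add zero)
  have prod: "h (prod f I) = (\<Prod>i\<in>I. h (f i))" for f :: "'n \<Rightarrow> 'a" and I
    by (induction I rule: infinite_finite_induct) (simp_all add: mult one)
  have sign: "h (of_int (sign p)) = of_int (sign p)" for p :: "'n \<Rightarrow> 'n"
    by (simp add: sign_def one neg)
  show ?thesis by (simp add: det_def sum mult prod sign)
qed

lemma poly_charpoly: "poly (charpoly M) x = det (M - mat x)"
  unfolding charpoly_def
  by (subst det_ring_hom[of "\<lambda>p. poly p x"]) (auto intro!: arg_cong[of _ _ det] simp: vec_eq_iff mat_def)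

lemma map_poly_of_real_add:
  "map_poly complex_of_real (p + q) = map_poly complex_of_real p + map_poly complex_of_real q"
  by (rule poly_eqI) (simp add: coeff_map_poly)

lemma map_poly_of_real_mult:
  "map_poly complex_of_real (p * q) = map_poly complex_of_real p * map_poly complex_of_real q"
  by (rule poly_eqI) (simp add: coeff_map_poly coeff_mult)

definition complex_roots :: "real poly \<Rightarrow> complex set" where
  "complex_roots p = {z. poly (map_poly complex_of_real p) z = 0}"

lemma Spec_eq_complex_roots: "Spec T = complex_roots (charpoly (matrix T))"
proof -
  have "poly (map_poly complex_of_real (charpoly M)) z = det (map_matrix complex_of_real M - mat z)"
    for M :: "real ^ 'n ^ 'n" and z
    unfolding charpoly_def
    by (subst det_ring_hom[of "\<lambda>p. poly (map_poly complex_of_real p) z"])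
      (auto intro!: arg_cong[of _ _ det] simp: vec_eq_iff mat_def map_poly_of_real_add
        map_poly_of_real_mult map_poly_pCons map_matrix_def)
  then show ?thesis unfolding Spec_def complex_roots_def by metis
qed

text \<open>Real polynomials with the same values at all real points are equal, so that the multiplicativity of
the determinant is only used for real matrices.\<close>

lemma charpoly_similar:
  fixes M P Q :: "real ^ 'n ^ 'n"
  assumes "P ** Q = mat 1"
  shows "charpoly (P ** M ** Q) = charpoly M"
proof -
  have *: "P ** mat x ** Q = mat x" for x
  proof -
    have "mat x = x *\<^sub>R (mat 1 :: real ^ 'n ^ 'n)" by (simp add: vec_eq_iff mat_def)
    then show ?thesis using assms by (simp add: matrix_scalar_ac scalar_matrix_assoc[symmetric])
  qed
  have d: "det P * det Q = 1" using assms by (metis det_I det_mul)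
  have "poly (charpoly (P ** M ** Q)) x = poly (charpoly M) x" for x
  proof -
    have "P ** M ** Q - mat x = P ** (M - mat x) ** Q"
      using *[of x] by (simp add: vec_eq_iff matrix_matrix_mult_def sum_subtractf right_diff_distrib left_diff_distrib)
    then show ?thesis using d by (simp add: poly_charpoly det_mul algebra_simps)
  qed
  then show ?thesis by (simp add: poly_eq_poly_eq_iff[symmetric] fun_eq_iff)
qed

lemma coeff_pcompose_scale: "coeff (pcompose p [:0, t::real:]) k = t ^ k * coeff p k"
  using coeff_pcompose_linear[of p t k] by (simp add: mult.commute)

lemma coeff_charpoly_scaleR:
  fixes M :: "real ^ 'n ^ 'n"
  assumes "t \<noteq> 0" "j \<le> CARD('n)"
  shows "coeff (charpoly (t *\<^sub>R M)) (CARD('n) - j) = t ^ j * coeff (charpoly M) (CARD('n) - j)"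
proof -
  let ?n = "CARD('n)"
  have "poly (pcompose (charpoly (t *\<^sub>R M)) [:0, t:]) x = poly (smult (t ^ ?n) (charpoly M)) x" for x
  proof -
    have "t *\<^sub>R M - mat (t * x) = (\<chi> i. t *s (M - mat x) $ i)"
      by (simp add: vec_eq_iff mat_def algebra_simps)
    then have "det (t *\<^sub>R M - mat (t * x)) = t ^ ?n * det (M - mat x)"
      using det_rows_mul[of "\<lambda>_. t" "\<lambda>i. (M - mat x) $ i"]
      by (simp del: vector_minus_component vector_ssub_ldistrib)
    then show ?thesis by (simp add: poly_pcompose poly_charpoly mult.commute)
  qed
  then have "pcompose (charpoly (t *\<^sub>R M)) [:0, t:] = smult (t ^ ?n) (charpoly M)"
    by (simp add: poly_eq_poly_eq_iff[symmetric] fun_eq_iff)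
  then have "t ^ (?n - j) * coeff (charpoly (t *\<^sub>R M)) (?n - j) = t ^ ?n * coeff (charpoly M) (?n - j)"
    by (metis coeff_pcompose_scale coeff_smult)
  also have "t ^ ?n = t ^ (?n - j) * t ^ j" using assms(2) by (simp flip: power_add)
  finally show ?thesis using assms(1) by simp
qed

lemma degree_prod_entries_le:
  fixes M :: "real ^ 'n ^ 'n" and p :: "'n \<Rightarrow> 'n"
  defines "B \<equiv> \<lambda>i j. if i = j then [:M $ i $ j, -1:] else [:M $ i $ j:]"
  shows "degree (\<Prod>i\<in>UNIV. B i (p i)) \<le> card {i. p i = i}"
proof -
  have "degree (\<Prod>i\<in>UNIV. B i (p i)) \<le> sum (degree \<circ> (\<lambda>i. B i (p i))) UNIV"
    by (rule degree_prod_sum_le) simp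
  also have "\<dots> \<le> (\<Sum>i\<in>UNIV. if p i = i then 1 else 0)"
    by (intro sum_mono) (auto simp: B_def)
  also have "\<dots> = card {i. p i = i}" by (simp add: sum.If_cases)
  finally show ?thesis .
qed

text \<open>In the Leibniz formula a permutation other than the identity moves some index, so that fewer than n of
its factors contain the variable; only the identity contributes to the coefficient of degree n.\<close>

lemma degree_charpoly: 
  fixes M :: "real ^ 'n ^ 'n"
  shows "degree (charpoly M) = CARD('n)" and "coeff (charpoly M) CARD('n) = (-1) ^ CARD('n)"
proof -
  let ?n = "CARD('n)"
  define B where "B i j = (if i = j then [:M $ i $ j, -1:] else [:M $ i $ j:])" for i j
  have cp: "charpoly M = (\<Sum>p | p permutes UNIV. of_int (sign p) * (\<Prod>i\<in>UNIV. B i (p i)))"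
    by (simp add: charpoly_def det_def B_def)
  have deg: "degree (of_int (sign p) * (\<Prod>i\<in>UNIV. B i (p i))) \<le> card {i. p i = i}" for p :: "'n \<Rightarrow> 'n"
    using degree_mult_le[of "of_int (sign p)" "\<Prod>i\<in>UNIV. B i (p i)"] degree_prod_entries_le[of p M]
    by (simp add: B_def)
  have le: "degree (charpoly M) \<le> ?n"
    unfolding cp
    by (rule degree_sum_le) (auto intro!: order_trans[OF deg card_mono] simp: finite_permutations)
  have c: "coeff (of_int (sign p) * (\<Prod>i\<in>UNIV. B i (p i))) ?n = (if p = id then (-1) ^ ?n else 0)" for p :: "'n \<Rightarrow> 'n"
  proof (cases "p = id")
    case True
    have "degree (\<Prod>i\<in>UNIV. B i i) = (\<Sum>i\<in>UNIV. degree (B i i))"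
      by (rule degree_prod_eq_sum_degree) (auto simp: B_def)
    then have "degree (\<Prod>i\<in>UNIV. B i i) = ?n" by (simp add: B_def)
    then show ?thesis using True lead_coeff_prod[of "\<lambda>i. B i i" UNIV]
      by (simp add: sign_id B_def)
  next
    case False
    then obtain i where "p i \<noteq> i" by (auto simp: fun_eq_iff)
    then have "{i. p i = i} \<subset> UNIV" by auto
    then have "card {i. p i = i} < ?n" by (simp add: psubset_card_mono)
    then show ?thesis using False deg[of p] by (simp add: coeff_eq_0)
  qed
  show *: "coeff (charpoly M) ?n = (-1) ^ ?n"
    unfolding cp coeff_sum c by (simp add: finite_permutations permutes_id)
  show "degree (charpoly M) = ?n"
    using le le_degree[of "charpoly M" ?n] * by simp
qed

lemma smooth_on_coeff_charpoly:
  fixes M :: "'a::real_normed_vector \<Rightarrow> real ^ 'n ^ 'n"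
  assumes U: "open U" and M: "\<And>i j. smooth_on U (\<lambda>x. M x $ i $ j)"
  shows "smooth_on U (\<lambda>x. coeff (charpoly (M x)) k)"
proof -
  have mult: "\<forall>k. smooth_on U (\<lambda>x. coeff (f x * g x) k)"
    if "\<forall>k. smooth_on U (\<lambda>x. coeff (f x) k)" "\<forall>k. smooth_on U (\<lambda>x. coeff (g x) k)"
    for f g :: "'a \<Rightarrow> real poly"
    unfolding coeff_mult using that by (auto intro!: smooth_on_sum smooth_on_mult U)
  have prod: "\<forall>k. smooth_on U (\<lambda>x. coeff (\<Prod>i\<in>I. f i x) k)"
    if "\<forall>i. \<forall>k. smooth_on U (\<lambda>x. coeff (f i x) k)" for I and f :: "'n \<Rightarrow> 'a \<Rightarrow> real poly"
    using that
  proof (induction I rule: infinite_finite_induct)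
    case (insert i I)
    then show ?case using mult[of "f i" "\<lambda>x. \<Prod>i\<in>I. f i x"] by simp
  qed (simp_all add: smooth_on_const U)
  have entry: "\<forall>k. smooth_on U (\<lambda>x. coeff (if i = j then [:M x $ i $ j, -1:] else [:M x $ i $ j:]) k)" for i j
  proof
    fix k
    have "(\<lambda>x. coeff (if i = j then [:M x $ i $ j, -1:] else [:M x $ i $ j:]) k) =
        (if k = 0 then \<lambda>x. M x $ i $ j else (\<lambda>x. if i = j \<and> k = 1 then -1 else 0))"
      by (auto simp: fun_eq_iff coeff_pCons split: nat.splits)
    then show "smooth_on U (\<lambda>x. coeff (if i = j then [:M x $ i $ j, -1:] else [:M x $ i $ j:]) k)"
      by (cases "k = 0") (simp_all only: if_True if_False M smooth_on_const[OF U] refl)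
  qed
  define B where "B x i j = (if i = j then [:M x $ i $ j, -1:] else [:M x $ i $ j:])" for x i j
  have "smooth_on U (\<lambda>x. coeff (of_int (sign p) * (\<Prod>i\<in>UNIV. B x i (p i))) k)" for p
  proof (rule mult[rule_format])
    show "smooth_on U (\<lambda>x. coeff (of_int (sign p)) k)" for k by (rule smooth_on_const[OF U])
    have "\<forall>i. \<forall>k. smooth_on U (\<lambda>x. coeff (B x i (p i)) k)" using entry by (simp add: B_def)
    then show "smooth_on U (\<lambda>x. coeff (\<Prod>i\<in>UNIV. B x i (p i)) k)" for k
      using prod[of "\<lambda>i x. B x i (p i)" UNIV] by blast
  qed
  then show ?thesis
    by (simp add: charpoly_def det_def coeff_sum B_def smooth_on_sum[OF U])
qed

section \<open>Normalised coefficients\<close>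

text \<open>The coefficient of degree n - j is homogeneous of degree j in the roots. Hence this sum, like the
largest modulus of a root, is multiplied by t when all roots are multiplied by t > 0; but its continuous
dependence on the coefficients is evident.\<close>

definition weight :: "nat \<Rightarrow> real poly \<Rightarrow> real" where
  "weight n p = (\<Sum>j=1..n. \<bar>coeff p (n - j)\<bar> powr (1 / real j))"

text \<open>The coefficients after the roots have been rescaled to weight 1.\<close>

definition shape :: "nat \<Rightarrow> real poly \<Rightarrow> nat \<Rightarrow> real" where
  "shape n p j = coeff p (n - j) / weight n p ^ j"

lemma weight_scale:
  assumes "t > 0" and "\<And>j. j \<in> {1..n} \<Longrightarrow> coeff q (n - j) = t ^ j * coeff p (n - j)"
  shows "weight n q = t * weight n p"
proof -
  have "\<bar>coeff q (n - j)\<bar> powr (1 / real j) = t * \<bar>coeff p (n - j)\<bar> powr (1 / real j)" if "j \<in> {1..n}" for j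
    using assms(1) assms(2)[OF that] that
    by (simp add: abs_mult powr_mult powr_powr powr_realpow[symmetric])
  then show ?thesis by (simp add: weight_def sum_distrib_left)
qed

lemma shape_scale:
  assumes "t > 0" and "\<And>j. j \<in> {1..n} \<Longrightarrow> coeff q (n - j) = t ^ j * coeff p (n - j)" and "j \<in> {1..n}"
  shows "shape n q j = shape n p j"
  using assms(1,3) assms(2)[OF assms(3)] weight_scale[OF assms(1,2)]
  by (simp add: shape_def power_mult_distrib)

lemma weight_nonneg: "weight n p \<ge> 0"
  by (simp add: weight_def sum_nonneg)

lemma weight_eq_0_iff: "weight n p = 0 \<longleftrightarrow> (\<forall>j\<in>{1..n}. coeff p (n - j) = 0)"
  unfolding weight_def by (subst sum_nonneg_eq_0_iff) auto

text \<open>The relation between the coefficients says that q(t z) = t^n p(z).\<close>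

lemma complex_roots_scale:
  assumes "t \<noteq> 0" and deg: "degree p \<le> n" "degree q \<le> n"
    and c: "\<And>j. j \<le> n \<Longrightarrow> coeff q (n - j) = t ^ j * coeff p (n - j)"
  shows "complex_roots q = scale_set t (complex_roots p)"
proof -
  let ?C = "map_poly complex_of_real"
  have "poly (?C q) (of_real t * z) = of_real t ^ n * poly (?C p) z" for z
  proof -
    have d: "degree (?C p) \<le> n" "degree (?C q) \<le> n" using deg by (simp_all add: degree_map_poly)
    have ck: "coeff q k = t ^ (n - k) * coeff p k" if "k \<le> n" for k using c[of "n - k"] that by simp
    have "poly (?C q) (of_real t * z) = (\<Sum>k\<le>n. coeff (?C q) k * (of_real t * z) ^ k)"
      unfolding poly_altdef by (rule sum.mono_neutral_left) (use d in \<open>auto intro: coeff_eq_0\<close>)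
    also have "\<dots> = (\<Sum>k\<le>n. of_real t ^ n * (coeff (?C p) k * z ^ k))"
    proof (rule sum.cong)
      fix k assume "k \<in> {..n}"
      then have k: "k \<le> n" by simp
      have "(of_real t :: complex) ^ n = of_real t ^ (n - k) * of_real t ^ k" using k by (simp flip: power_add)
      then show "coeff (?C q) k * (of_real t * z) ^ k = of_real t ^ n * (coeff (?C p) k * z ^ k)"
        by (simp add: coeff_map_poly ck[OF k] power_mult_distrib)
    qed simp
    also have "\<dots> = of_real t ^ n * (\<Sum>k\<le>n. coeff (?C p) k * z ^ k)" by (simp add: sum_distrib_left)
    also have "(\<Sum>k\<le>n. coeff (?C p) k * z ^ k) = poly (?C p) z"
      unfolding poly_altdef by (rule sum.mono_neutral_right) (use d in \<open>auto intro: coeff_eq_0\<close>)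
    finally show ?thesis .
  qed
  note * = this
  show ?thesis unfolding complex_roots_def scale_set_def
  proof (intro set_eqI iffI)
    fix w assume "w \<in> {z. poly (?C q) z = 0}"
    then show "w \<in> (\<lambda>z. complex_of_real t * z) ` {z. poly (?C p) z = 0}"
      using *[of "w / of_real t"] assms(1) by (intro image_eqI[of _ _ "w / of_real t"]) auto
  qed (use * in auto)
qed

lemma complex_roots_trivial_iff:
  assumes "degree p = n" "n > 0"
  shows "complex_roots p = {0} \<longleftrightarrow> weight n p = 0"
proof
  let ?C = "map_poly complex_of_real"
  assume "complex_roots p = {0}"
  then have r: "\<And>z. poly (?C p) z = 0 \<longleftrightarrow> z = 0" by (auto simp: complex_roots_def)
  have nz: "?C p \<noteq> 0" using assms by (auto simp: map_poly_eq_0_iff)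
  have "(\<Prod>z | poly (?C p) z = 0. [:- z, 1:] ^ order z (?C p)) = [:0, 1:] ^ order 0 (?C p)"
    by (simp add: r)
  then have "?C p = smult (lead_coeff (?C p)) ([:0, 1:] ^ order 0 (?C p))"
    using complex_poly_decompose[of "?C p"] by simp
  then have m: "?C p = monom (lead_coeff (?C p)) (order 0 (?C p))"
    by (metis monom_altdef)
  then have "order 0 (?C p) = n"
    using degree_monom_eq[of "lead_coeff (?C p)" "order 0 (?C p)"] nz assms
    by (metis degree_map_poly leading_coeff_0_iff of_real_eq_0_iff)
  then have "coeff (?C p) (n - j) = 0" if "j \<in> {1..n}" for j
    using m that by (metis (no_types, lifting) atLeastAtMost_iff coeff_monom diff_less less_irrefl not_one_le_zero assms(2) gr0I)
  then show "weight n p = 0" by (simp add: weight_eq_0_iff coeff_map_poly)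
next
  let ?C = "map_poly complex_of_real"
  assume "weight n p = 0"
  then have z: "coeff p k = 0" if "k \<noteq> n" for k
    using that assms coeff_eq_0[of p k] by (cases "k < n") (auto simp: weight_eq_0_iff dest: bspec[of _ _ "n - k"])
  have "p = monom (lead_coeff p) n" by (rule poly_eqI) (use z assms in auto)
  then have "?C p = monom (of_real (lead_coeff p)) n" by (metis map_poly_monom of_real_0)
  moreover have "lead_coeff p \<noteq> 0" using assms by auto
  ultimately show "complex_roots p = {0}" using assms by (auto simp: complex_roots_def poly_monom)
qed

text \<open>Induction on the degree: split off one of the finitely many possible roots.\<close>

lemma finite_polys_with_roots_in:
  assumes "finite R"
  shows "finite {p::complex poly. degree p = n \<and> lead_coeff p = c \<and> (\<forall>z. poly p z = 0 \<longrightarrow> z \<in> R)}"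
proof (induction n)
  case 0
  have "{p::complex poly. degree p = 0 \<and> lead_coeff p = c \<and> (\<forall>z. poly p z = 0 \<longrightarrow> z \<in> R)} \<subseteq> {[:c:]}"
    by (auto elim: degree_eq_zeroE)
  then show ?case by (rule finite_subset) simp
next
  case (Suc n)
  let ?F = "\<lambda>n. {p::complex poly. degree p = n \<and> lead_coeff p = c \<and> (\<forall>z. poly p z = 0 \<longrightarrow> z \<in> R)}"
  have "?F (Suc n) \<subseteq> (\<Union>r\<in>R. (\<lambda>q. [:- r, 1:] * q) ` ?F n)"
  proof
    fix p assume p: "p \<in> ?F (Suc n)"
    then have "\<not> constant (poly p)" by (simp add: constant_degree)
    then obtain r where r: "poly p r = 0" using fundamental_theorem_of_algebra by blast
    then obtain q where q: "p = [:- r, 1:] * q" by (metis poly_eq_0_iff_dvd dvdE)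
    then have "q \<noteq> 0" using p by auto
    then have "degree p = Suc (degree q)" unfolding q by (subst degree_mult_eq) auto
    moreover have "lead_coeff p = lead_coeff q" unfolding q by (subst lead_coeff_mult) simp
    moreover have "\<forall>z. poly q z = 0 \<longrightarrow> z \<in> R" using p q by auto
    ultimately have "q \<in> ?F n" using p by auto
    then show "p \<in> (\<Union>r\<in>R. (\<lambda>q. [:- r, 1:] * q) ` ?F n)" using q r p by auto
  qed
  then show ?case by (rule finite_subset) (use Suc assms in auto)
qed

lemma finite_complex_roots: "p \<noteq> 0 \<Longrightarrow> finite (complex_roots p)"
  unfolding complex_roots_def by (rule poly_roots_finite) (simp add: map_poly_eq_0_iff)

text \<open>A set of roots does not determine a polynomial, because multiplicities are free, but it leaves only
finitely many polynomials. Here the set of roots is only known up to a real factor s: dividing the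
roots by the modulus of s does not change the shape and moves all of them into the fixed finite set of
the numbers z and -z with z in E.\<close>

lemma finite_shapes:
  assumes E: "finite E" and j: "j \<in> {1..n}"
  shows "finite {shape n p j | p. degree p = n \<and> lead_coeff p = c \<and> (\<exists>s. s \<noteq> 0 \<and> complex_roots p = scale_set s E)}"
    (is "finite ?A")
proof -
  let ?R = "E \<union> uminus ` E"
  let ?F = "{q. degree q = n \<and> lead_coeff q = of_real c \<and> (\<forall>z. poly q z = 0 \<longrightarrow> z \<in> ?R)}"
  let ?G = "{p. map_poly complex_of_real p \<in> ?F}"
  have "inj (map_poly complex_of_real)"
  proof (rule injI)
    fix p q assume "map_poly complex_of_real p = map_poly complex_of_real q"
    then have "coeff (map_poly complex_of_real p) k = coeff (map_poly complex_of_real q) k" for k by simp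
    then show "p = q" by (intro poly_eqI) (simp add: coeff_map_poly)
  qed
  then have fin: "finite ?G"
    using finite_vimageI[OF finite_polys_with_roots_in[of ?R n "of_real c"], of "map_poly complex_of_real"] E
    by (simp add: vimage_def)
  have "?A \<subseteq> (\<lambda>p. shape n p j) ` ?G"
  proof
    fix x assume "x \<in> ?A"
    then obtain p s where p: "x = shape n p j" "degree p = n" "lead_coeff p = c" "s \<noteq> 0"
      "complex_roots p = scale_set s E" by auto
    define t where "t = 1 / \<bar>s\<bar>"
    have t: "t > 0" using p by (simp add: t_def)
    \<comment> \<open>The polynomial whose roots are those of p multiplied by t.\<close>
    define q where "q = smult (t ^ n) (pcompose p [:0, 1 / t:])"
    have ck: "coeff q k = t ^ n * (1 / t) ^ k * coeff p k" for k
      by (simp add: q_def coeff_pcompose_scale)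
    have cj: "coeff q (n - j) = t ^ j * coeff p (n - j)" if "j \<le> n" for j
    proof -
      have "t ^ n = t ^ (n - j) * t ^ j" using that by (simp flip: power_add)
      then show ?thesis using ck[of "n - j"] t by (simp add: power_one_over)
    qed
    have dq: "degree q = n" using t p by (simp add: q_def degree_pcompose)
    have "complex_roots q = scale_set t (complex_roots p)"
      by (rule complex_roots_scale[of _ _ n]) (use t p dq cj in auto)
    also have "\<dots> = scale_set (t * s) E" by (simp add: p(5) scale_set_def image_image mult.assoc)
    also have "\<dots> \<subseteq> ?R"
    proof -
      have "t * s = 1 \<or> t * s = -1" using p(4) by (auto simp: t_def abs_if)
      then show ?thesis by (auto simp: scale_set_def simp flip: of_real_mult)
    qed
    finally have "q \<in> ?G"
      using dq cj[of 0] p by (auto simp: complex_roots_def degree_map_poly coeff_map_poly)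
    moreover have "x = shape n q j"
      using shape_scale[OF t, of n q p j] cj j p(1) by simp
    ultimately show "x \<in> (\<lambda>p. shape n p j) ` ?G" by blast
  qed
  then show ?thesis using fin by (meson finite_imageI finite_subset)
qed

text \<open>Polynomials of equal shape differ by a rescaling of their roots, and the factor is the quotient of
the weights. In particular it is positive.\<close>

lemma complex_roots_of_equal_shapes:
  assumes deg: "degree p = n" "degree q = n" and lead: "lead_coeff p = lead_coeff q"
    and w: "weight n p > 0" "weight n q > 0"
    and sh: "\<And>j. j \<in> {1..n} \<Longrightarrow> shape n p j = shape n q j"
  shows "complex_roots q = scale_set (weight n q / weight n p) (complex_roots p)"
proof (rule complex_roots_scale[of _ _ n])
  fix j assume "j \<le> n"
  show "coeff q (n - j) = (weight n q / weight n p) ^ j * coeff p (n - j)"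
  proof (cases "j = 0")
    case True
    then show ?thesis using deg lead by simp
  next
    case False
    then show ?thesis using sh[of j] \<open>j \<le> n\<close> w by (simp add: shape_def field_simps)
  qed
qed (use assms in auto)

section \<open>Charts and tangent vectors\<close>

abbreviation (input) loc :: "('m, 'n::finite) chart \<Rightarrow> ('m, 'n) vfield \<Rightarrow> real ^ 'n \<Rightarrow> real ^ 'n" where
  "loc c V \<equiv> \<lambda>x. V (chart_inv c x) c"

abbreviation (input) transition_deriv ::
  "('m, 'n::finite) chart \<Rightarrow> ('m, 'n) chart \<Rightarrow> 'm \<Rightarrow> real ^ 'n \<Rightarrow> real ^ 'n" where
  "transition_deriv c d p \<equiv> frechet_derivative (chart_map d \<circ> chart_inv c) (at (chart_map c p))"

locale atlas =
  fixes X :: "'m topology" and A :: "('m, 'n::finite) chart set"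
  assumes smooth_atlas: "smooth_atlas X A"
begin

lemma is_chart: "c \<in> A \<Longrightarrow> is_chart X c"
  using smooth_atlas by (simp add: smooth_atlas_def)

lemma openin_chart_dom: "c \<in> A \<Longrightarrow> openin X (chart_dom c)"
  using is_chart by (simp add: is_chart_def)

lemma homeomorphic_chart:
  "c \<in> A \<Longrightarrow> homeomorphic_map (subtopology X (chart_dom c)) (top_of_set (chart_map c ` chart_dom c)) (chart_map c)"
  using is_chart by (simp add: is_chart_def)

lemma inj_on_chart_map:
  assumes "c \<in> A" shows "inj_on (chart_map c) (chart_dom c)"
proof -
  have "topspace (subtopology X (chart_dom c)) = chart_dom c"
    using openin_subset[OF openin_chart_dom[OF assms]] by (simp add: Int_absorb1)
  then show ?thesis using homeomorphic_imp_injective_map[OF homeomorphic_chart[OF assms]] by simp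
qed

lemma chart_inv_chart_map [simp]: "c \<in> A \<Longrightarrow> p \<in> chart_dom c \<Longrightarrow> chart_inv c (chart_map c p) = p"
  by (simp add: chart_inv_def inj_on_chart_map)

lemma chart_map_chart_inv: "x \<in> chart_map c ` chart_dom c \<Longrightarrow> chart_map c (chart_inv c x) = x"
  by (simp add: chart_inv_def f_inv_into_f)

lemma chart_inv_in_dom: "x \<in> chart_map c ` chart_dom c \<Longrightarrow> chart_inv c x \<in> chart_dom c"
  by (simp add: chart_inv_def inv_into_into)

lemma open_chart_image_dom: "c \<in> A \<Longrightarrow> open (chart_map c ` chart_dom c)"
  using is_chart by (simp add: is_chart_def)

lemma open_chart_image:
  assumes "c \<in> A" "openin X U"
  shows "open (chart_map c ` (U \<inter> chart_dom c))"
proof -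
  have "openin (subtopology X (chart_dom c)) (U \<inter> chart_dom c)"
    using assms(2) by (auto simp: openin_subtopology)
  then have "openin (top_of_set (chart_map c ` chart_dom c)) (chart_map c ` (U \<inter> chart_dom c))"
    using homeomorphic_imp_open_map[OF homeomorphic_chart[OF assms(1)]] by (simp add: open_map_def)
  then show ?thesis using open_chart_image_dom[OF assms(1)] by (meson openin_open_trans)
qed

lemma openin_chart_preimage:
  assumes "c \<in> A" "open B"
  shows "openin X {p \<in> chart_dom c. chart_map c p \<in> B}"
proof -
  have "openin (subtopology X (chart_dom c)) {p \<in> topspace (subtopology X (chart_dom c)). chart_map c p \<in> B \<inter> chart_map c ` chart_dom c}"
    by (rule openin_continuous_map_preimage[OF homeomorphic_imp_continuous_map[OF homeomorphic_chart[OF assms(1)]]])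
      (use assms(2) in \<open>auto simp: openin_open\<close>)
  moreover have "{p \<in> topspace (subtopology X (chart_dom c)). chart_map c p \<in> B \<inter> chart_map c ` chart_dom c} = {p \<in> chart_dom c. chart_map c p \<in> B}"
    using openin_subset[OF openin_chart_dom[OF assms(1)]] by auto
  ultimately show ?thesis using openin_chart_dom[OF assms(1)] by (metis openin_trans_full)
qed

lemma smooth_transition:
  assumes "c \<in> A" "d \<in> A"
  shows "smooth_on (chart_map c ` (chart_dom c \<inter> chart_dom d)) (chart_map d \<circ> chart_inv c)"
  using smooth_atlas assms by (simp add: smooth_atlas_def)

lemma has_derivative_transition:
  assumes "c \<in> A" "d \<in> A" "p \<in> chart_dom c" "p \<in> chart_dom d"
  shows "((chart_map d \<circ> chart_inv c) has_derivative transition_deriv c d p) (at (chart_map c p))"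
  by (rule smooth_on_has_derivative[OF smooth_transition[OF assms(1,2)]]) (use assms in auto)

lemma linear_transition_deriv:
  "c \<in> A \<Longrightarrow> d \<in> A \<Longrightarrow> p \<in> chart_dom c \<Longrightarrow> p \<in> chart_dom d \<Longrightarrow> linear (transition_deriv c d p)"
  using has_derivative_transition by (blast intro: has_derivative_linear)

lemma open_chart_overlap:
  "c \<in> A \<Longrightarrow> d \<in> A \<Longrightarrow> open (chart_map c ` (chart_dom c \<inter> chart_dom d))"
  using open_chart_image[of c "chart_dom d"] openin_chart_dom[of d] by (simp add: Int_commute)

text \<open>The chain rule for the transition maps: the components of a tangent vector transform consistently.\<close>

lemma transition_deriv_trans:
  assumes "c \<in> A" "d \<in> A" "e \<in> A" "p \<in> chart_dom c" "p \<in> chart_dom d" "p \<in> chart_dom e"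
  shows "transition_deriv d e p (transition_deriv c d p a) = transition_deriv c e p a"
proof -
  let ?U = "chart_map c ` ((chart_dom c \<inter> chart_dom d) \<inter> chart_dom c)"
  have op: "open ?U" by (intro open_chart_image openin_Int openin_chart_dom assms)
  have x: "chart_map c p \<in> ?U" using assms by auto
  have "((chart_map e \<circ> chart_inv d) \<circ> (chart_map d \<circ> chart_inv c) has_derivative
      transition_deriv d e p \<circ> transition_deriv c d p) (at (chart_map c p))"
    by (rule diff_chain_at) (use has_derivative_transition assms in auto)
  then have "((chart_map e \<circ> chart_inv c) has_derivative
      transition_deriv d e p \<circ> transition_deriv c d p) (at (chart_map c p))"
    by (rule has_derivative_transform_within_open[OF _ op x]) (use assms in auto)
  then show ?thesis
    using has_derivative_transition[of c e p] assms has_derivative_unique by (metis comp_apply)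
qed

lemma transition_deriv_refl:
  assumes "c \<in> A" "p \<in> chart_dom c"
  shows "transition_deriv c c p a = a"
proof -
  have "((chart_map c \<circ> chart_inv c) has_derivative (\<lambda>v. v)) (at (chart_map c p))"
    by (rule has_derivative_transform_within_open[OF has_derivative_ident open_chart_image_dom[OF assms(1)]])
      (use assms in auto)
  then show ?thesis using has_derivative_transition[of c c p] assms has_derivative_unique by metis
qed

lemma tangent_of_apply:
  "d \<in> A \<Longrightarrow> p \<in> chart_dom d \<Longrightarrow> tangent_of A c p a d = transition_deriv c d p a"
  by (simp add: tangent_of_def)

lemma tangent_of_same: "c \<in> A \<Longrightarrow> p \<in> chart_dom c \<Longrightarrow> tangent_of A c p a c = a"
  by (simp add: tangent_of_apply transition_deriv_refl)

lemma tangent_of_in_tangent_space: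
  assumes "c \<in> A" "p \<in> chart_dom c"
  shows "tangent_of A c p a \<in> tangent_space A p"
  using assms by (auto simp: tangent_space_def tangent_of_def transition_deriv_trans)

lemma tangent_space_apply:
  "w \<in> tangent_space A p \<Longrightarrow> c \<in> A \<Longrightarrow> d \<in> A \<Longrightarrow> p \<in> chart_dom c \<Longrightarrow> p \<in> chart_dom d \<Longrightarrow>
    w d = transition_deriv c d p (w c)"
  unfolding tangent_space_def mem_Collect_eq by blast

lemma tangent_space_outside:
  "w \<in> tangent_space A p \<Longrightarrow> \<not> (c \<in> A \<and> p \<in> chart_dom c) \<Longrightarrow> w c = 0"
  unfolding tangent_space_def mem_Collect_eq by blast

lemma tangent_of_component:
  assumes "w \<in> tangent_space A p" "c \<in> A" "p \<in> chart_dom c"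
  shows "tangent_of A c p (w c) = w"
proof
  fix d
  show "tangent_of A c p (w c) d = w d"
    using tangent_space_apply[OF assms(1,2) _ assms(3)] tangent_space_outside[OF assms(1)]
    by (cases "d \<in> A \<and> p \<in> chart_dom d") (auto simp: tangent_of_def)
qed

lemma tangent_space_eqI:
  "v \<in> tangent_space A p \<Longrightarrow> w \<in> tangent_space A p \<Longrightarrow> c \<in> A \<Longrightarrow> p \<in> chart_dom c \<Longrightarrow> v c = w c \<Longrightarrow> v = w"
  by (metis tangent_of_component)

lemma tangent_space_lincomb:
  assumes "v \<in> tangent_space A p" "w \<in> tangent_space A p"
  shows "(\<lambda>c. a *\<^sub>R v c + b *\<^sub>R w c) \<in> tangent_space A p"
  unfolding tangent_space_def mem_Collect_eq
proof (intro conjI allI ballI impI)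
  fix c d assume cd: "c \<in> A" "d \<in> A" "p \<in> chart_dom c \<and> p \<in> chart_dom d"
  then show "a *\<^sub>R v d + b *\<^sub>R w d = transition_deriv c d p (a *\<^sub>R v c + b *\<^sub>R w c)"
    using linear_transition_deriv[of c d p] tangent_space_apply[OF assms(1), of c d]
      tangent_space_apply[OF assms(2), of c d]
    by (simp add: linear_add linear_scale)
next
  fix c assume "\<not> (c \<in> A \<and> p \<in> chart_dom c)"
  then show "a *\<^sub>R v c + b *\<^sub>R w c = 0"
    using tangent_space_outside[OF assms(1), of c] tangent_space_outside[OF assms(2), of c] by simp
qed

lemma tangent_space_zero: "(\<lambda>c. 0) \<in> tangent_space A p"
  using linear_transition_deriv by (auto simp: tangent_space_def linear_0)

lemma tangent_of_lincomb:
  assumes "c \<in> A" "p \<in> chart_dom c"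
  shows "tangent_of A c p (a *\<^sub>R v + b *\<^sub>R w) = (\<lambda>d. a *\<^sub>R tangent_of A c p v d + b *\<^sub>R tangent_of A c p w d)"
  by (rule tangent_space_eqI[of _ p _ c])
    (simp_all add: assms tangent_space_lincomb tangent_of_in_tangent_space tangent_of_same)

lemma chart_at:
  assumes "p \<in> topspace X"
  shows "chart_at A p \<in> A" "p \<in> chart_dom (chart_at A p)"
proof -
  have "p \<in> (\<Union>c\<in>A. chart_dom c)" using assms smooth_atlas by (simp add: smooth_atlas_def)
  then have "\<exists>c. c \<in> A \<and> p \<in> chart_dom c" by blast
  then show "chart_at A p \<in> A" "p \<in> chart_dom (chart_at A p)"
    unfolding chart_at_def by (metis (mono_tags, lifting) someI_ex)+
qed

lemma chart_dom_subset: "c \<in> A \<Longrightarrow> chart_dom c \<subseteq> topspace X"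
  using openin_chart_dom openin_subset by blast

section \<open>Smooth functions and vector fields in charts\<close>

lemma smooth_vfield_tangent: "smooth_vfield A U V \<Longrightarrow> p \<in> U \<Longrightarrow> V p \<in> tangent_space A p"
  by (simp add: smooth_vfield_def)

lemma smooth_vfield_loc:
  "smooth_vfield A U V \<Longrightarrow> c \<in> A \<Longrightarrow> smooth_on (chart_map c ` (U \<inter> chart_dom c)) (loc c V)"
  by (simp add: smooth_vfield_def)

lemma smooth_vfield_subset:
  assumes "smooth_vfield A U V" "T \<subseteq> U" shows "smooth_vfield A T V"
  unfolding smooth_vfield_def
proof (intro conjI ballI)
  fix c assume "c \<in> A"
  show "smooth_on (chart_map c ` (T \<inter> chart_dom c)) (loc c V)"
    by (rule smooth_on_subset[OF smooth_vfield_loc[OF assms(1) \<open>c \<in> A\<close>]]) (use assms(2) in blast)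
qed (use smooth_vfield_tangent[OF assms(1)] assms(2) in blast)

lemma smooth_vfield_cong:
  assumes "openin X U" "smooth_vfield A U V" "\<And>p. p \<in> U \<Longrightarrow> V' p = V p"
  shows "smooth_vfield A U V'"
  unfolding smooth_vfield_def
proof (intro conjI ballI)
  fix c assume c: "c \<in> A"
  show "smooth_on (chart_map c ` (U \<inter> chart_dom c)) (loc c V')"
    by (rule smooth_on_cong[OF open_chart_image[OF c assms(1)] _ smooth_vfield_loc[OF assms(2) c]])
      (use assms(3) c in auto)
qed (use assms smooth_vfield_tangent in auto)

lemma smooth_vfield_lincomb:
  assumes "openin X U" "smooth_vfield A U V" "smooth_vfield A U W"
  shows "smooth_vfield A U (\<lambda>p c. a *\<^sub>R V p c + b *\<^sub>R W p c)"
  using assms open_chart_image[OF _ assms(1)] unfolding smooth_vfield_def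
  by (auto intro!: tangent_space_lincomb smooth_on_add smooth_on_scaleR smooth_on_const)

lemma smooth_vfield_scale:
  assumes "openin X U" "smooth_fun A U f" "smooth_vfield A U V"
  shows "smooth_vfield A U (\<lambda>p c. f p *\<^sub>R V p c)"
  unfolding smooth_vfield_def
proof (intro conjI ballI)
  fix p assume "p \<in> U"
  then show "(\<lambda>c. f p *\<^sub>R V p c) \<in> tangent_space A p"
    using tangent_space_lincomb[of "V p" p "V p" "f p" 0] smooth_vfield_tangent[OF assms(3)] by simp
next
  fix c assume c: "c \<in> A"
  show "smooth_on (chart_map c ` (U \<inter> chart_dom c)) (\<lambda>x. f (chart_inv c x) *\<^sub>R V (chart_inv c x) c)"
    using assms open_chart_image[OF c assms(1)] c
    by (auto intro!: smooth_on_scaleR simp: smooth_fun_def smooth_vfield_def o_def)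
qed

lemma smooth_vfield_zero: "openin X U \<Longrightarrow> smooth_vfield A U (\<lambda>p c. 0)"
  unfolding smooth_vfield_def
  using tangent_space_zero open_chart_image smooth_on_const by blast

lemma smooth_vfield_sum:
  assumes "openin X U" "\<And>i. i \<in> I \<Longrightarrow> smooth_vfield A U (V i)"
  shows "smooth_vfield A U (\<lambda>p c. \<Sum>i\<in>I. V i p c)"
  using assms(2)
proof (induction I rule: infinite_finite_induct)
  case (insert i I)
  then show ?case
    using smooth_vfield_lincomb[OF assms(1), of "V i" "\<lambda>p c. \<Sum>i\<in>I. V i p c" 1 1] by simp
qed (simp_all add: smooth_vfield_zero assms(1))

lemma smooth_on_change_chart:
  assumes "c \<in> A" "d \<in> A" "openin X U" "U \<subseteq> chart_dom c" "smooth_on (chart_map c ` U) h"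
  shows "smooth_on (chart_map d ` (U \<inter> chart_dom d)) (\<lambda>x. h (chart_map c (chart_inv d x)))"
proof (rule smooth_on_compose[where T = "chart_map c ` U"])
  show "open (chart_map d ` (U \<inter> chart_dom d))" by (rule open_chart_image[OF assms(2,3)])
  show "open (chart_map c ` U)" using open_chart_image[OF assms(1,3)] assms(4) by (simp add: Int_absorb2)
  show "(\<lambda>x. chart_map c (chart_inv d x)) ` chart_map d ` (U \<inter> chart_dom d) \<subseteq> chart_map c ` U"
    using assms(2) by auto
  show "smooth_on (chart_map d ` (U \<inter> chart_dom d)) (\<lambda>x. chart_map c (chart_inv d x))"
    by (rule smooth_on_subset[OF smooth_transition[OF assms(2,1), unfolded o_def]]) (use assms(4) in blast)
qed (rule assms)

lemma smooth_fun_const: "openin X U \<Longrightarrow> smooth_fun A U (\<lambda>q. k)"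
  by (simp add: smooth_fun_def o_def smooth_on_const open_chart_image)

lemma smooth_fun_chartI:
  assumes "c \<in> A" "openin X U" "U \<subseteq> chart_dom c" "smooth_on (chart_map c ` U) (f \<circ> chart_inv c)"
  shows "smooth_fun A U f"
  unfolding smooth_fun_def
proof
  fix d assume d: "d \<in> A"
  show "smooth_on (chart_map d ` (U \<inter> chart_dom d)) (f \<circ> chart_inv d)"
    by (rule smooth_on_cong[OF open_chart_image[OF d assms(2)] _ smooth_on_change_chart[OF assms(1) d assms(2-4)]])
      (use assms d in auto)
qed

text \<open>In any other chart the components are obtained by applying the derivative of the transition map, which
depends smoothly on the point.\<close>

lemma smooth_vfield_chartI:
  assumes "c \<in> A" "openin X U" "U \<subseteq> chart_dom c" "smooth_on (chart_map c ` U) (loc c V)"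
    and "\<And>p. p \<in> U \<Longrightarrow> V p \<in> tangent_space A p"
  shows "smooth_vfield A U V"
  unfolding smooth_vfield_def
proof (intro conjI ballI)
  fix d assume d: "d \<in> A"
  let ?U = "chart_map d ` (U \<inter> chart_dom d)"
  have op: "open ?U" by (rule open_chart_image[OF d assms(2)])
  have "smooth_on ?U (\<lambda>x. frechet_derivative (chart_map d \<circ> chart_inv c)
      (at (chart_map c (chart_inv d x))) (V (chart_inv c (chart_map c (chart_inv d x))) c))"
  proof (rule smooth_on_frechet_derivative_apply[OF open_chart_overlap[OF assms(1) d] smooth_transition[OF assms(1) d] op])
    show "(\<lambda>x. chart_map c (chart_inv d x)) ` ?U \<subseteq> chart_map c ` (chart_dom c \<inter> chart_dom d)"
      using d assms(3) by auto
    show "smooth_on ?U (\<lambda>x. chart_map c (chart_inv d x))"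
      by (rule smooth_on_subset[OF smooth_transition[OF d assms(1), unfolded o_def]]) (use assms(3) in blast)
    show "smooth_on ?U (\<lambda>x. V (chart_inv c (chart_map c (chart_inv d x))) c)"
      by (rule smooth_on_change_chart[OF assms(1) d assms(2-4)])
  qed
  then show "smooth_on ?U (loc d V)"
  proof (rule smooth_on_cong[OF op, rotated])
    fix x assume "x \<in> ?U"
    then obtain p where p: "x = chart_map d p" "p \<in> U" "p \<in> chart_dom d" by auto
    then show "frechet_derivative (chart_map d \<circ> chart_inv c) (at (chart_map c (chart_inv d x)))
        (V (chart_inv c (chart_map c (chart_inv d x))) c) = V (chart_inv d x) d"
      using tangent_space_apply[OF assms(5)[OF p(2)] assms(1) d] assms d by auto
  qed
qed (rule assms(5))

lemma smooth_fun_component: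
  assumes "c \<in> A" "openin X U" "U \<subseteq> chart_dom c" "smooth_vfield A U V"
  shows "smooth_fun A U (\<lambda>p. V p c $ j)"
proof (rule smooth_fun_chartI[OF assms(1-3)])
  have "smooth_on (chart_map c ` U) (loc c V)"
    using smooth_vfield_loc[OF assms(4,1)] assms(3) by (simp add: Int_absorb2)
  then show "smooth_on (chart_map c ` U) ((\<lambda>p. V p c $ j) \<circ> chart_inv c)"
    using open_chart_image[OF assms(1,2)] assms(3) by (simp add: o_def Int_absorb2 smooth_on_vec_nth)
qed

lemma smooth_coordinate_field:
  assumes "c \<in> A"
  shows "smooth_vfield A (chart_dom c) (\<lambda>p. tangent_of A c p a)"
proof (rule smooth_vfield_chartI[OF assms openin_chart_dom[OF assms] subset_refl])
  show "smooth_on (chart_map c ` chart_dom c) (loc c (\<lambda>p. tangent_of A c p a))"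
    by (rule smooth_on_cong[OF open_chart_image_dom[OF assms] _ smooth_on_const[OF open_chart_image_dom[OF assms]]])
      (simp add: tangent_of_same[OF assms chart_inv_in_dom])
qed (rule tangent_of_in_tangent_space[OF assms])

lemma smooth_vfield_chart_constant:
  "c \<in> A \<Longrightarrow> U \<subseteq> chart_dom c \<Longrightarrow> smooth_vfield A U (\<lambda>p. tangent_of A c p a)"
  by (rule smooth_vfield_subset[OF smooth_coordinate_field])

lemma tangent_vector_expand:
  assumes "c \<in> A" "p \<in> chart_dom c" "v \<in> tangent_space A p"
  shows "v = (\<lambda>d. \<Sum>j\<in>UNIV. v c $ j *\<^sub>R tangent_of A c p (axis j 1) d)"
proof
  fix d
  have e: "v c = (\<Sum>j\<in>UNIV. v c $ j *\<^sub>R axis j 1)" by (simp only: basis_expansion scalar_mult_eq_scaleR[symmetric])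
  show "v d = (\<Sum>j\<in>UNIV. v c $ j *\<^sub>R tangent_of A c p (axis j 1) d)"
  proof (cases "d \<in> A \<and> p \<in> chart_dom d")
    case True
    then have "v d = transition_deriv c d p (\<Sum>j\<in>UNIV. v c $ j *\<^sub>R axis j 1)"
      using tangent_space_apply[OF assms(3,1) _ assms(2), of d] unfolding e[symmetric] by simp
    also have "\<dots> = (\<Sum>j\<in>UNIV. v c $ j *\<^sub>R transition_deriv c d p (axis j 1))"
      using linear_transition_deriv[of c d p] assms True by (simp add: linear_sum linear_scale)
    finally show ?thesis using True by (simp add: tangent_of_apply)
  next
    case False
    then have "tangent_of A c p a d = 0" for a by (auto simp: tangent_of_def)
    then show ?thesis using tangent_space_outside[OF assms(3) False] by simp
  qed
qed

text \<open>A directional derivative is defined by an arbitrarily chosen chart; the chain rule transports it to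
any other one.\<close>

lemma dir_deriv_chart:
  assumes "openin X U" "smooth_fun A U f" "p \<in> U" "c \<in> A" "p \<in> chart_dom c" "v \<in> tangent_space A p"
  shows "dir_deriv A p v f = frechet_derivative (f \<circ> chart_inv c) (at (chart_map c p)) (v c)"
proof -
  define d where "d = chart_at A p"
  have "p \<in> topspace X" using assms(1,3) openin_subset by blast
  from chart_at[OF this] have d: "d \<in> A" "p \<in> chart_dom d" unfolding d_def .
  have fc: "((f \<circ> chart_inv e) has_derivative frechet_derivative (f \<circ> chart_inv e) (at (chart_map e p))) (at (chart_map e p))"
    if "e \<in> A" "p \<in> chart_dom e" for e
    using assms(2,3) that by (intro smooth_on_has_derivative[of "chart_map e ` (U \<inter> chart_dom e)"]) (auto simp: smooth_fun_def)
  let ?U = "chart_map d ` (chart_dom c \<inter> chart_dom d)"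
  have op: "open ?U" by (rule open_chart_image[OF d(1) openin_chart_dom[OF assms(4)]])
  have "((f \<circ> chart_inv c) \<circ> (chart_map c \<circ> chart_inv d) has_derivative
      frechet_derivative (f \<circ> chart_inv c) (at (chart_map c p)) \<circ> transition_deriv d c p) (at (chart_map d p))"
    by (rule diff_chain_at) (use fc has_derivative_transition assms d in auto)
  then have "((f \<circ> chart_inv d) has_derivative
      frechet_derivative (f \<circ> chart_inv c) (at (chart_map c p)) \<circ> transition_deriv d c p) (at (chart_map d p))"
    by (rule has_derivative_transform_within_open[OF _ op]) (use assms d in auto)
  then have "frechet_derivative (f \<circ> chart_inv d) (at (chart_map d p)) (v d) =
      frechet_derivative (f \<circ> chart_inv c) (at (chart_map c p)) (transition_deriv d c p (v d))"
    using fc[OF d] has_derivative_unique by (metis comp_apply)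
  then show ?thesis
    using tangent_space_apply[OF assms(6) d(1) assms(4) d(2) assms(5)] by (simp add: dir_deriv_def d_def Let_def)
qed

end

section \<open>The curvature in a chart\<close>

text \<open>The product rule for the pairing of a derivative with a moving direction.\<close>

lemma has_derivative_frechet_derivative_apply:
  fixes f :: "'a::euclidean_space \<Rightarrow> 'b::real_normed_vector" and g :: "'a \<Rightarrow> 'a"
  assumes f: "smooth_on S f" and S: "open S" "x \<in> S"
    and g: "(g has_derivative g') (at x)"
  shows "((\<lambda>y. frechet_derivative f (at y) (g y)) has_derivative
    (\<lambda>h. frechet_derivative (\<lambda>y. frechet_derivative f (at y) (g x)) (at x) h
       + frechet_derivative f (at x) (g' h))) (at x)"
proof -
  let ?D = "\<lambda>y. frechet_derivative f (at y)"
  let ?E = "\<lambda>b. frechet_derivative (\<lambda>y. ?D y b) (at x)"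
  have lin: "linear (?D y)" if "y \<in> S" for y
    using smooth_on_has_derivative[OF f that] by (rule has_derivative_linear)
  have expand: "((\<lambda>y. ?D y (k y)) has_derivative
      (\<lambda>h. \<Sum>b\<in>Basis. (k x \<bullet> b) *\<^sub>R ?E b h + (k' h \<bullet> b) *\<^sub>R ?D x b)) (at x)"
    if k: "(k has_derivative k') (at x)" for k k'
  proof (rule has_derivative_transform_within_open[OF _ S])
    show "((\<lambda>y. \<Sum>b\<in>Basis. (k y \<bullet> b) *\<^sub>R ?D y b) has_derivative
        (\<lambda>h. \<Sum>b\<in>Basis. (k x \<bullet> b) *\<^sub>R ?E b h + (k' h \<bullet> b) *\<^sub>R ?D x b)) (at x)"
      by (intro has_derivative_sum has_derivative_scaleR has_derivative_inner_left k
          smooth_on_has_derivative[OF smooth_on_frechet_derivative[OF f] S(2)])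
    show "(\<Sum>b\<in>Basis. (k y \<bullet> b) *\<^sub>R ?D y b) = ?D y (k y)" if "y \<in> S" for y
      by (rule linear_euclidean_expand[OF lin[OF that], symmetric])
  qed
  have c: "frechet_derivative (\<lambda>y. ?D y (g x)) (at x) = (\<lambda>h. \<Sum>b\<in>Basis. (g x \<bullet> b) *\<^sub>R ?E b h)"
    using frechet_derivative_at[OF expand[OF has_derivative_const[of "g x"]]] by simp
  show ?thesis
    by (rule has_derivative_eq_rhs[OF expand[OF g]])
      (simp add: c sum.distrib linear_euclidean_expand[OF lin[OF S(2)], symmetric])
qed

locale connection_atlas = atlas X A for X :: "'m topology" and A :: "('m, 'n::finite) chart set" +
  fixes nabla :: "('m, 'n) vfield \<Rightarrow> ('m, 'n) vfield \<Rightarrow> ('m, 'n) vfield"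
  assumes connection: "connection X A nabla" and torsion_free: "torsion_free X A nabla"
begin

lemmas connection_rules = connection[unfolded connection_def, THEN spec, THEN mp]

lemma nabla_smooth:
  assumes "openin X U" "smooth_vfield A U V" "smooth_vfield A U W"
  shows "smooth_vfield A U (nabla V W)"
  using connection_rules[OF assms(1), THEN conjunct1] assms(2-) by blast

lemma nabla_cong:
  assumes "openin X U" "smooth_vfield A U V" "smooth_vfield A U W" "\<And>q. q \<in> U \<Longrightarrow> V' q = V q" "\<And>q. q \<in> U \<Longrightarrow> W' q = W q" "p \<in> U"
  shows "nabla V' W' p = nabla V W p"
  using connection_rules[OF assms(1), THEN conjunct2, THEN conjunct1] assms(2-) by blast

lemma nabla_add_left:
  assumes "openin X U" "smooth_vfield A U V" "smooth_vfield A U V'" "smooth_vfield A U W" "p \<in> U"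
  shows "nabla (\<lambda>q c. V q c + V' q c) W p = (\<lambda>c. nabla V W p c + nabla V' W p c)"
  using connection_rules[OF assms(1), THEN conjunct2, THEN conjunct2, THEN conjunct1] assms(2-) by blast

lemma nabla_scale_left:
  assumes "openin X U" "smooth_fun A U f" "smooth_vfield A U V" "smooth_vfield A U W" "p \<in> U"
  shows "nabla (\<lambda>q c. f q *\<^sub>R V q c) W p = (\<lambda>c. f p *\<^sub>R nabla V W p c)"
  using connection_rules[OF assms(1), THEN conjunct2, THEN conjunct2, THEN conjunct2, THEN conjunct1] assms(2-) by blast

lemma nabla_add_right:
  assumes "openin X U" "smooth_vfield A U V" "smooth_vfield A U W" "smooth_vfield A U W'" "p \<in> U"
  shows "nabla V (\<lambda>q c. W q c + W' q c) p = (\<lambda>c. nabla V W p c + nabla V W' p c)"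
  using connection_rules[OF assms(1), THEN conjunct2, THEN conjunct2, THEN conjunct2, THEN conjunct2, THEN conjunct1] assms(2-) by blast

lemma nabla_Leibniz:
  assumes "openin X U" "smooth_fun A U f" "smooth_vfield A U V" "smooth_vfield A U W" "p \<in> U"
  shows "nabla V (\<lambda>q c. f q *\<^sub>R W q c) p = (\<lambda>c. dir_deriv A p (V p) f *\<^sub>R W p c + f p *\<^sub>R nabla V W p c)"
  using connection_rules[OF assms(1), THEN conjunct2, THEN conjunct2, THEN conjunct2, THEN conjunct2, THEN conjunct2] assms(2-) by blast

lemma nabla_zero_left:
  assumes "openin X U" "smooth_vfield A U W" "p \<in> U"
  shows "nabla (\<lambda>q c. 0) W p = (\<lambda>c. 0)"
  using nabla_scale_left[OF assms(1) smooth_fun_const[OF assms(1), of 0] assms(2,2,3)] by simp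

lemma nabla_zero_right:
  assumes "openin X U" "smooth_vfield A U V" "p \<in> U"
  shows "nabla V (\<lambda>q c. 0) p = (\<lambda>c. 0)"
  using nabla_Leibniz[OF assms(1) smooth_fun_const[OF assms(1), of 0] assms(2,2,3)]
  by (simp add: dir_deriv_def o_def Let_def)

lemma nabla_sum_left:
  assumes U: "openin X U" "p \<in> U" and W: "smooth_vfield A U W" and V: "\<And>i. i \<in> I \<Longrightarrow> smooth_vfield A U (V i)"
  shows "nabla (\<lambda>q c. \<Sum>i\<in>I. V i q c) W p = (\<lambda>c. \<Sum>i\<in>I. nabla (V i) W p c)"
  using V
proof (induction I rule: infinite_finite_induct)
  case (insert i I)
  then show ?case
    using nabla_add_left[OF U(1), of "V i" "\<lambda>q c. \<Sum>i\<in>I. V i q c", OF _ smooth_vfield_sum[OF U(1)] W U(2)] by simp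
qed (simp_all add: nabla_zero_left[OF U(1) W U(2)])

lemma nabla_sum_right:
  assumes U: "openin X U" "p \<in> U" and V: "smooth_vfield A U V" and W: "\<And>i. i \<in> I \<Longrightarrow> smooth_vfield A U (W i)"
  shows "nabla V (\<lambda>q c. \<Sum>i\<in>I. W i q c) p = (\<lambda>c. \<Sum>i\<in>I. nabla V (W i) p c)"
  using W
proof (induction I rule: infinite_finite_induct)
  case (insert i I)
  then show ?case
    using nabla_add_right[OF U(1) V, of "W i" "\<lambda>q c. \<Sum>i\<in>I. W i q c", OF _ smooth_vfield_sum[OF U(1)] U(2)] by simp
qed (simp_all add: nabla_zero_right[OF U(1) V U(2)])

text \<open>The components of the covariant derivatives of the coordinate fields, that is, the Christoffel
symbols in the chart c.\<close>

definition christoffel_coeff :: "('m, 'n) chart \<Rightarrow> 'n \<Rightarrow> 'n \<Rightarrow> real ^ 'n \<Rightarrow> real ^ 'n" where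
  "christoffel_coeff c i j =
     loc c (nabla (\<lambda>p. tangent_of A c p (axis i 1)) (\<lambda>p. tangent_of A c p (axis j 1)))"

definition christoffel :: "('m, 'n) chart \<Rightarrow> real ^ 'n \<Rightarrow> real ^ 'n \<Rightarrow> real ^ 'n \<Rightarrow> real ^ 'n" where
  "christoffel c x a b = (\<Sum>i\<in>UNIV. \<Sum>j\<in>UNIV. (a $ i * b $ j) *\<^sub>R christoffel_coeff c i j x)"

lemma smooth_christoffel_coeff:
  assumes "c \<in> A"
  shows "smooth_on (chart_map c ` chart_dom c) (christoffel_coeff c i j)"
  using smooth_vfield_loc[OF nabla_smooth[OF openin_chart_dom[OF assms] smooth_coordinate_field smooth_coordinate_field] assms] assms
  by (simp add: christoffel_coeff_def)

lemma christoffel_add_left: "christoffel c x (a + a') b = christoffel c x a b + christoffel c x a' b"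
  by (simp add: christoffel_def algebra_simps sum.distrib)

lemma christoffel_add_right: "christoffel c x a (b + b') = christoffel c x a b + christoffel c x a b'"
  by (simp add: christoffel_def algebra_simps sum.distrib)

lemma christoffel_scale_left: "christoffel c x (r *\<^sub>R a) b = r *\<^sub>R christoffel c x a b"
  by (simp add: christoffel_def scaleR_sum_right mult.assoc)

lemma christoffel_scale_right: "christoffel c x a (r *\<^sub>R b) = r *\<^sub>R christoffel c x a b"
  by (simp add: christoffel_def scaleR_sum_right mult.left_commute)

lemma christoffel_diff_left: "christoffel c x (a - a') b = christoffel c x a b - christoffel c x a' b"
  by (simp add: christoffel_def algebra_simps sum_subtractf)

lemma has_derivative_christoffel:
  assumes c: "c \<in> A" "x \<in> chart_map c ` chart_dom c"
    and a: "(a has_derivative a') (at x)" and b: "(b has_derivative b') (at x)"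
  shows "((\<lambda>y. christoffel c y (a y) (b y)) has_derivative
    (\<lambda>h. (\<Sum>i\<in>UNIV. \<Sum>j\<in>UNIV. (a x $ i * b x $ j) *\<^sub>R frechet_derivative (christoffel_coeff c i j) (at x) h)
       + christoffel c x (a' h) (b x) + christoffel c x (a x) (b' h))) (at x)"
proof -
  have "((\<lambda>y. (a y $ i * b y $ j) *\<^sub>R christoffel_coeff c i j y) has_derivative
    (\<lambda>h. (a x $ i * b x $ j) *\<^sub>R frechet_derivative (christoffel_coeff c i j) (at x) h
       + (a x $ i * b' h $ j + a' h $ i * b x $ j) *\<^sub>R christoffel_coeff c i j x)) (at x)" for i j
    by (intro has_derivative_scaleR has_derivative_mult bounded_linear.has_derivative[OF bounded_linear_vec_nth] a b
        smooth_on_has_derivative[OF smooth_christoffel_coeff[OF c(1)] c(2)])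
  then have "((\<lambda>y. christoffel c y (a y) (b y)) has_derivative
    (\<lambda>h. \<Sum>i\<in>UNIV. \<Sum>j\<in>UNIV. (a x $ i * b x $ j) *\<^sub>R frechet_derivative (christoffel_coeff c i j) (at x) h
       + (a x $ i * b' h $ j + a' h $ i * b x $ j) *\<^sub>R christoffel_coeff c i j x)) (at x)"
    unfolding christoffel_def by (intro has_derivative_sum)
  then show ?thesis
    by (rule has_derivative_eq_rhs) (simp add: christoffel_def sum.distrib scaleR_add_left algebra_simps)
qed

lemma christoffel_frechet_derivative:
  assumes c: "c \<in> A" "x \<in> chart_map c ` chart_dom c"
  shows "frechet_derivative (\<lambda>y. christoffel c y a b) (at x) h =
    (\<Sum>i\<in>UNIV. \<Sum>j\<in>UNIV. (a $ i * b $ j) *\<^sub>R frechet_derivative (christoffel_coeff c i j) (at x) h)"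
proof -
  have zero: "christoffel c x 0 b = 0" "christoffel c x a 0 = 0" by (simp_all add: christoffel_def)
  show ?thesis
    using fun_cong[OF frechet_derivative_at[OF has_derivative_christoffel[OF c has_derivative_const[of a] has_derivative_const[of b]]], of h]
    by (simp add: zero)
qed

text \<open>Expand both fields in the coordinate fields and use that the connection is tensorial in its first and
a derivation in its second argument.\<close>

lemma nabla_chart:
  assumes c: "c \<in> A" "openin X U" "U \<subseteq> chart_dom c" "p \<in> U"
    and V: "smooth_vfield A U V" and W: "smooth_vfield A U W"
  shows "nabla V W p c =
    frechet_derivative (loc c W) (at (chart_map c p)) (V p c) + christoffel c (chart_map c p) (V p c) (W p c)"
proof -
  define e where "e j p = tangent_of A c p (axis j 1)" for j p
  have p: "p \<in> chart_dom c" using c by auto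
  have e: "smooth_vfield A U (e j)" for j
    unfolding e_def by (rule smooth_vfield_chart_constant[OF c(1,3)])
  have Vexp: "V q = (\<lambda>d. \<Sum>i\<in>UNIV. V q c $ i *\<^sub>R e i q d)" if "q \<in> U" for q
    unfolding e_def using tangent_vector_expand[OF c(1) _ smooth_vfield_tangent[OF V that]] that c(3) by blast
  have Wexp: "W q = (\<lambda>d. \<Sum>i\<in>UNIV. W q c $ i *\<^sub>R e i q d)" if "q \<in> U" for q
    unfolding e_def using tangent_vector_expand[OF c(1) _ smooth_vfield_tangent[OF W that]] that c(3) by blast
  have Vi: "smooth_fun A U (\<lambda>q. V q c $ i)" for i by (rule smooth_fun_component[OF c(1-3) V])
  have Wi: "smooth_fun A U (\<lambda>q. W q c $ i)" for i by (rule smooth_fun_component[OF c(1-3) W])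
  have Vie: "smooth_vfield A U (\<lambda>q d. V q c $ i *\<^sub>R e i q d)" for i by (rule smooth_vfield_scale[OF c(2) Vi e])
  have Wie: "smooth_vfield A U (\<lambda>q d. W q c $ i *\<^sub>R e i q d)" for i by (rule smooth_vfield_scale[OF c(2) Wi e])
  have nVe: "nabla V (e j) p c = (\<Sum>i\<in>UNIV. V p c $ i *\<^sub>R christoffel_coeff c i j (chart_map c p))" for j
  proof -
    have "nabla V (e j) p = nabla (\<lambda>q d. \<Sum>i\<in>UNIV. V q c $ i *\<^sub>R e i q d) (e j) p"
      by (rule nabla_cong[OF c(2) smooth_vfield_sum[OF c(2) Vie] e Vexp refl c(4)])
    also have "\<dots> = (\<lambda>d. \<Sum>i\<in>UNIV. nabla (\<lambda>q d. V q c $ i *\<^sub>R e i q d) (e j) p d)"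
      by (rule nabla_sum_left[OF c(2,4) e Vie])
    also have "\<dots> = (\<lambda>d. \<Sum>i\<in>UNIV. V p c $ i *\<^sub>R nabla (e i) (e j) p d)"
      by (simp add: nabla_scale_left[OF c(2) Vi e e c(4)])
    finally show ?thesis using c(1) p by (simp add: christoffel_coeff_def e_def[abs_def])
  qed
  have ddW: "dir_deriv A p (V p) (\<lambda>q. W q c $ j) = frechet_derivative (loc c W) (at (chart_map c p)) (V p c) $ j" for j
  proof -
    have "(loc c W has_derivative frechet_derivative (loc c W) (at (chart_map c p))) (at (chart_map c p))"
      by (rule smooth_on_has_derivative[OF smooth_vfield_loc[OF W c(1)]]) (use c in auto)
    from bounded_linear.has_derivative[OF bounded_linear_vec_nth this, of j]
    have "frechet_derivative ((\<lambda>q. W q c $ j) \<circ> chart_inv c) (at (chart_map c p)) =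
        (\<lambda>h. frechet_derivative (loc c W) (at (chart_map c p)) h $ j)"
      unfolding o_def by (rule frechet_derivative_at[symmetric])
    then show ?thesis using dir_deriv_chart[OF c(2) Wi c(4,1) p smooth_vfield_tangent[OF V c(4)]] by simp
  qed
  have "nabla V W p = nabla V (\<lambda>q d. \<Sum>i\<in>UNIV. W q c $ i *\<^sub>R e i q d) p"
    by (rule nabla_cong[OF c(2) V smooth_vfield_sum[OF c(2) Wie] refl Wexp c(4)])
  also have "\<dots> = (\<lambda>d. \<Sum>j\<in>UNIV. nabla V (\<lambda>q d. W q c $ j *\<^sub>R e j q d) p d)"
    by (rule nabla_sum_right[OF c(2,4) V Wie])
  also have "\<dots> = (\<lambda>d. \<Sum>j\<in>UNIV. dir_deriv A p (V p) (\<lambda>q. W q c $ j) *\<^sub>R e j p d + W p c $ j *\<^sub>R nabla V (e j) p d)"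
    by (simp add: nabla_Leibniz[OF c(2) Wi V e c(4)])
  finally have "nabla V W p c = (\<Sum>j\<in>UNIV. frechet_derivative (loc c W) (at (chart_map c p)) (V p c) $ j *\<^sub>R axis j 1)
      + (\<Sum>j\<in>UNIV. W p c $ j *\<^sub>R (\<Sum>i\<in>UNIV. V p c $ i *\<^sub>R christoffel_coeff c i j (chart_map c p)))"
    using c p by (simp add: ddW nVe e_def tangent_of_same sum.distrib)
  also have "(\<Sum>j\<in>UNIV. W p c $ j *\<^sub>R (\<Sum>i\<in>UNIV. V p c $ i *\<^sub>R christoffel_coeff c i j (chart_map c p))) =
      christoffel c (chart_map c p) (V p c) (W p c)"
    unfolding christoffel_def by (subst sum.swap) (simp add: scaleR_sum_right mult.commute)
  also have "(\<Sum>j\<in>UNIV. frechet_derivative (loc c W) (at (chart_map c p)) (V p c) $ j *\<^sub>R axis j 1) =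
      frechet_derivative (loc c W) (at (chart_map c p)) (V p c)"
    using basis_expansion[of "frechet_derivative (loc c W) (at (chart_map c p)) (V p c)"]
    by (simp add: scalar_mult_eq_scaleR)
  finally show ?thesis .
qed

text \<open>Torsion-freeness writes the bracket as a difference of covariant derivatives, which are smooth
fields by the axioms of a connection.\<close>

lemma smooth_lie_bracket:
  assumes "openin X U" "smooth_vfield A U V" "smooth_vfield A U W"
  shows "smooth_vfield A U (lie_bracket A V W)"
proof (rule smooth_vfield_cong[OF assms(1)])
  show "smooth_vfield A U (\<lambda>p c. 1 *\<^sub>R nabla V W p c + (-1) *\<^sub>R nabla W V p c)"
    by (intro smooth_vfield_lincomb nabla_smooth assms)
  show "lie_bracket A V W p = (\<lambda>c. 1 *\<^sub>R nabla V W p c + (-1) *\<^sub>R nabla W V p c)" if "p \<in> U" for p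
    using torsion_free that assms unfolding torsion_free_def by simp
qed

text \<open>The classical expression of the curvature by the Christoffel symbols and their first derivatives.\<close>

definition chart_curvature :: "('m, 'n) chart \<Rightarrow> real ^ 'n \<Rightarrow> real ^ 'n \<Rightarrow> real ^ 'n \<Rightarrow> real ^ 'n \<Rightarrow> real ^ 'n" where
  "chart_curvature c x u v w =
     frechet_derivative (\<lambda>y. christoffel c y v w) (at x) u - frechet_derivative (\<lambda>y. christoffel c y u w) (at x) v
     + christoffel c x u (christoffel c x v w) - christoffel c x v (christoffel c x u w)"

text \<open>The derivative of the local expression of a covariant derivative; its first term contains the second
derivatives of the field Z.\<close>

lemma frechet_derivative_loc_nabla:
  assumes c: "c \<in> A" "openin X U" "U \<subseteq> chart_dom c" "p \<in> U"
    and W: "smooth_vfield A U W" and Z: "smooth_vfield A U Z"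
  defines "x \<equiv> chart_map c p"
  shows "frechet_derivative (loc c (nabla W Z)) (at x) h =
    frechet_derivative (\<lambda>y. frechet_derivative (loc c Z) (at y) (W p c)) (at x) h
    + frechet_derivative (loc c Z) (at x) (frechet_derivative (loc c W) (at x) h)
    + (frechet_derivative (\<lambda>y. christoffel c y (W p c) (Z p c)) (at x) h
       + christoffel c x (frechet_derivative (loc c W) (at x) h) (Z p c)
       + christoffel c x (W p c) (frechet_derivative (loc c Z) (at x) h))"
proof -
  let ?B = "chart_map c ` U"
  have B: "open ?B" using open_chart_image[OF c(1,2)] c(3) by (simp add: Int_absorb2)
  have x: "x \<in> ?B" "x \<in> chart_map c ` chart_dom c" using c by (auto simp: x_def)
  have px: "chart_inv c x = p" using c by (auto simp: x_def)
  have sW: "smooth_on ?B (loc c W)" and sZ: "smooth_on ?B (loc c Z)"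
    using smooth_vfield_loc[OF W c(1)] smooth_vfield_loc[OF Z c(1)] c(3) by (simp_all add: Int_absorb2)
  have dW: "(loc c W has_derivative frechet_derivative (loc c W) (at x)) (at x)"
    and dZ: "(loc c Z has_derivative frechet_derivative (loc c Z) (at x)) (at x)"
    using smooth_on_has_derivative[OF sW x(1)] smooth_on_has_derivative[OF sZ x(1)] .
  have "((\<lambda>y. frechet_derivative (loc c Z) (at y) (loc c W y) + christoffel c y (loc c W y) (loc c Z y)) has_derivative
     (\<lambda>h. (frechet_derivative (\<lambda>y. frechet_derivative (loc c Z) (at y) (loc c W x)) (at x) h
       + frechet_derivative (loc c Z) (at x) (frechet_derivative (loc c W) (at x) h))
     + ((\<Sum>i\<in>UNIV. \<Sum>j\<in>UNIV. (loc c W x $ i * loc c Z x $ j) *\<^sub>R frechet_derivative (christoffel_coeff c i j) (at x) h)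
       + christoffel c x (frechet_derivative (loc c W) (at x) h) (loc c Z x)
       + christoffel c x (loc c W x) (frechet_derivative (loc c Z) (at x) h)))) (at x)"
    by (intro has_derivative_add has_derivative_frechet_derivative_apply[OF sZ B x(1) dW]
        has_derivative_christoffel[OF c(1) x(2) dW dZ])
  then have "(loc c (nabla W Z) has_derivative
     (\<lambda>h. (frechet_derivative (\<lambda>y. frechet_derivative (loc c Z) (at y) (loc c W x)) (at x) h
       + frechet_derivative (loc c Z) (at x) (frechet_derivative (loc c W) (at x) h))
     + ((\<Sum>i\<in>UNIV. \<Sum>j\<in>UNIV. (loc c W x $ i * loc c Z x $ j) *\<^sub>R frechet_derivative (christoffel_coeff c i j) (at x) h)
       + christoffel c x (frechet_derivative (loc c W) (at x) h) (loc c Z x)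
       + christoffel c x (loc c W x) (frechet_derivative (loc c Z) (at x) h)))) (at x)"
  proof (rule has_derivative_transform_within_open[OF _ B x(1)])
    fix y assume "y \<in> ?B"
    then obtain q where q: "y = chart_map c q" "q \<in> U" by auto
    then have "chart_inv c y = q" using c by auto
    then show "frechet_derivative (loc c Z) (at y) (loc c W y) + christoffel c y (loc c W y) (loc c Z y) =
        loc c (nabla W Z) y"
      using nabla_chart[OF c(1-3) q(2) W Z] q(1) by simp
  qed
  from frechet_derivative_at[OF this, symmetric] show ?thesis
    by (simp add: christoffel_frechet_derivative[OF c(1) x(2)] px)
qed

text \<open>All derivatives of the fields cancel: the second derivatives of Z because they are symmetric, the
first derivatives of V and W against the bracket term, and those of Z between the two iterated
covariant derivatives. What remains depends on the values of the fields at p only.\<close>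

lemma curvature_field_chart:
  assumes c: "c \<in> A" "openin X U" "U \<subseteq> chart_dom c" "p \<in> U"
    and V: "smooth_vfield A U V" and W: "smooth_vfield A U W" and Z: "smooth_vfield A U Z"
  shows "curvature_field A nabla V W Z p c = chart_curvature c (chart_map c p) (V p c) (W p c) (Z p c)"
proof -
  define x where "x = chart_map c p"
  have B: "open (chart_map c ` U)" using open_chart_image[OF c(1,2)] c(3) by (simp add: Int_absorb2)
  have x: "x \<in> chart_map c ` U" using c by (auto simp: x_def)
  have sZ: "smooth_on (chart_map c ` U) (loc c Z)"
    using smooth_vfield_loc[OF Z c(1)] c(3) by (simp add: Int_absorb2)
  have lZ: "linear (frechet_derivative (loc c Z) (at x))"
    using smooth_on_has_derivative[OF sZ x] by (rule has_derivative_linear)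
  have sym: "frechet_derivative (\<lambda>y. frechet_derivative (loc c Z) (at y) (W p c)) (at x) (V p c) =
      frechet_derivative (\<lambda>y. frechet_derivative (loc c Z) (at y) (V p c)) (at x) (W p c)"
    by (rule symmetric_second_derivative[OF sZ B x])
  have b: "lie_bracket A V W p c =
      frechet_derivative (loc c W) (at x) (V p c) - frechet_derivative (loc c V) (at x) (W p c)"
    using c by (auto simp: lie_bracket_def x_def)
  have WZ: "smooth_vfield A U (nabla W Z)" and VZ: "smooth_vfield A U (nabla V Z)"
    using nabla_smooth[OF c(2)] V W Z by auto
  show ?thesis
    unfolding curvature_field_def chart_curvature_def
      nabla_chart[OF c V WZ] nabla_chart[OF c W VZ] nabla_chart[OF c smooth_lie_bracket[OF c(2) V W] Z]
      nabla_chart[OF c W Z] nabla_chart[OF c V Z]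
      frechet_derivative_loc_nabla[OF c W Z] frechet_derivative_loc_nabla[OF c V Z]
    unfolding x_def[symmetric] b sym linear_diff[OF lZ] christoffel_diff_left christoffel_add_right
    by simp
qed

text \<open>By the local formula, any extensions of the three vectors lead to the same value, so that the definite
description in the definition of the curvature is meaningful. Coordinate fields with constant
coefficients show that extensions exist.\<close>

lemma curvature:
  assumes c: "c \<in> A" "p \<in> chart_dom c"
    and uvw: "u \<in> tangent_space A p" "v \<in> tangent_space A p" "w \<in> tangent_space A p"
  shows "curvature X A nabla p u v w c = chart_curvature c (chart_map c p) (u c) (v c) (w c)"
    and "curvature X A nabla p u v w \<in> tangent_space A p"
proof -
  let ?P = "\<lambda>r. \<exists>U V W Z. openin X U \<and> p \<in> U \<and>
     smooth_vfield A U V \<and> smooth_vfield A U W \<and> smooth_vfield A U Z \<and>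
     V p = u \<and> W p = v \<and> Z p = w \<and> r = curvature_field A nabla V W Z p"
  have *: "r \<in> tangent_space A p \<and> r c = chart_curvature c (chart_map c p) (u c) (v c) (w c)" if "?P r" for r
  proof -
    obtain U V W Z where U: "openin X U" "p \<in> U" and
      sm: "smooth_vfield A U V" "smooth_vfield A U W" "smooth_vfield A U Z" and
      at: "V p = u" "W p = v" "Z p = w" and r: "r = curvature_field A nabla V W Z p" using \<open>?P r\<close> by blast
    let ?U = "U \<inter> chart_dom c"
    have U': "openin X ?U" "p \<in> ?U" using U c by (auto intro: openin_Int openin_chart_dom)
    have sm': "smooth_vfield A ?U V" "smooth_vfield A ?U W" "smooth_vfield A ?U Z"
      using sm smooth_vfield_subset by blast+
    have t: "nabla V (nabla W Z) p \<in> tangent_space A p" "nabla W (nabla V Z) p \<in> tangent_space A p"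
      "nabla (lie_bracket A V W) Z p \<in> tangent_space A p"
      by (auto intro!: smooth_vfield_tangent[OF _ U(2)] nabla_smooth smooth_lie_bracket U sm)
    have "r \<in> tangent_space A p"
      using tangent_space_lincomb[OF tangent_space_lincomb[OF t(1,2), of 1 "-1"] t(3), of 1 "-1"]
      by (simp add: r curvature_field_def)
    then show ?thesis
      using curvature_field_chart[OF c(1) U'(1) _ U'(2) sm'] at r by simp
  qed
  let ?r = "curvature_field A nabla (\<lambda>q. tangent_of A c q (u c)) (\<lambda>q. tangent_of A c q (v c)) (\<lambda>q. tangent_of A c q (w c)) p"
  have ex: "?P ?r"
    using openin_chart_dom[OF c(1)] c smooth_coordinate_field[OF c(1)] tangent_of_component uvw by blast
  have "r = ?r" if "?P r" for r
    using *[OF that] *[OF ex] by (intro tangent_space_eqI[OF _ _ c]) simp_all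
  with ex have "?P (THE r. ?P r)" by (rule theI)
  then have "?P (curvature X A nabla p u v w)" unfolding curvature_def .
  from *[OF this] show "curvature X A nabla p u v w c = chart_curvature c (chart_map c p) (u c) (v c) (w c)"
    and "curvature X A nabla p u v w \<in> tangent_space A p" by auto
qed

lemma linear_chart_curvature:
  assumes "c \<in> A" "x \<in> chart_map c ` chart_dom c"
  shows "linear (\<lambda>u. chart_curvature c x u v w)"
proof (rule linearI)
  have l: "linear (frechet_derivative (\<lambda>y. christoffel c y v w) (at x))"
    using has_derivative_christoffel[OF assms has_derivative_const has_derivative_const]
    by (intro linear_frechet_derivative) (auto simp: differentiable_def)
  show "chart_curvature c x (u + u') v w = chart_curvature c x u v w + chart_curvature c x u' v w" for u u'
  proof -
    have D: "frechet_derivative (\<lambda>y. christoffel c y (u + u') w) (at x) v =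
        frechet_derivative (\<lambda>y. christoffel c y u w) (at x) v + frechet_derivative (\<lambda>y. christoffel c y u' w) (at x) v"
      unfolding christoffel_frechet_derivative[OF assms] by (simp add: distrib_right scaleR_add_left sum.distrib)
    show ?thesis
      unfolding chart_curvature_def D linear_add[OF l] by (simp add: christoffel_add_left christoffel_add_right)
  qed
  show "chart_curvature c x (r *\<^sub>R u) v w = r *\<^sub>R chart_curvature c x u v w" for r u
  proof -
    have D: "frechet_derivative (\<lambda>y. christoffel c y (r *\<^sub>R u) w) (at x) v =
        r *\<^sub>R frechet_derivative (\<lambda>y. christoffel c y u w) (at x) v"
      unfolding christoffel_frechet_derivative[OF assms] by (simp add: mult.assoc scaleR_sum_right)
    show ?thesis
      unfolding chart_curvature_def D linear_scale[OF l]
      by (simp add: christoffel_scale_left christoffel_scale_right scaleR_diff_right scaleR_add_right)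
  qed
qed

lemma chart_curvature_scale:
  assumes "c \<in> A" "x \<in> chart_map c ` chart_dom c"
  shows "chart_curvature c x u (t *\<^sub>R v) (t *\<^sub>R v) = (t * t) *\<^sub>R chart_curvature c x u v v"
proof -
  have "linear (frechet_derivative (christoffel_coeff c i j) (at x))" for i j
    using smooth_on_has_derivative[OF smooth_christoffel_coeff[OF assms(1)] assms(2)] by (rule has_derivative_linear)
  note lin = linear_scale[OF this]
  show ?thesis
    unfolding chart_curvature_def christoffel_frechet_derivative[OF assms]
    by (simp add: lin christoffel_scale_left christoffel_scale_right scaleR_sum_right
        scaleR_diff_right scaleR_add_right mult_ac)
qed

text \<open>The matrix of the Jacobi operator as a function of the bundle coordinates (base point, components of
the vector).\<close>

definition jacobi_matrix :: "('m, 'n) chart \<Rightarrow> (real ^ 'n) \<times> (real ^ 'n) \<Rightarrow> real ^ 'n ^ 'n" where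
  "jacobi_matrix c z = matrix (\<lambda>u. chart_curvature c (fst z) u (snd z) (snd z))"

text \<open>In bundle coordinates the Jacobi operator is quadratic in the vector, with coefficients that are
smooth in the base point.\<close>

lemma smooth_on_jacobi_matrix:
  assumes c: "c \<in> A"
  defines "S \<equiv> chart_map c ` chart_dom c \<times> UNIV"
  shows "smooth_on S (\<lambda>z. jacobi_matrix c z $ i $ j)"
proof -
  have op: "open S" unfolding S_def by (intro open_Times open_chart_image_dom[OF c] open_UNIV)
  have fst: "smooth_on S (\<lambda>z. F (fst z))" if "smooth_on (chart_map c ` chart_dom c) F" for F :: "real ^ 'n \<Rightarrow> real ^ 'n"
    by (rule smooth_on_compose[OF op open_chart_image_dom[OF c] _ smooth_on_bounded_linear[OF op bounded_linear_fst smooth_on_ident[OF op]] that])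
      (auto simp: S_def)
  have snd: "smooth_on S (\<lambda>z. snd z)"
    by (rule smooth_on_bounded_linear[OF op bounded_linear_snd smooth_on_ident[OF op]])
  have G: "smooth_on S (\<lambda>z. christoffel c (fst z) (f z) (g z))"
    if "smooth_on S f" "smooth_on S g" for f g
    unfolding christoffel_def using that
    by (intro smooth_on_sum smooth_on_scaleR smooth_on_mult smooth_on_vec_nth fst smooth_christoffel_coeff c op)
  have D: "smooth_on S (\<lambda>z. \<Sum>k\<in>UNIV. \<Sum>l\<in>UNIV. (f z $ k * g z $ l) *\<^sub>R
      frechet_derivative (christoffel_coeff c k l) (at (fst z)) (h z))"
    if "smooth_on S f" "smooth_on S g" "smooth_on S h" for f g h
    using that
    by (intro smooth_on_sum smooth_on_scaleR smooth_on_mult smooth_on_vec_nth op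
        smooth_on_frechet_derivative_apply[OF open_chart_image_dom[OF c] smooth_christoffel_coeff[OF c] op])
      (auto simp: S_def intro: fst[OF smooth_on_ident[OF open_chart_image_dom[OF c]], unfolded S_def])
  let ?a = "axis j 1 :: real ^ 'n"
  have "smooth_on S (\<lambda>z. ((\<Sum>k\<in>UNIV. \<Sum>l\<in>UNIV. (snd z $ k * snd z $ l) *\<^sub>R
        frechet_derivative (christoffel_coeff c k l) (at (fst z)) ?a)
      - (\<Sum>k\<in>UNIV. \<Sum>l\<in>UNIV. (?a $ k * snd z $ l) *\<^sub>R
        frechet_derivative (christoffel_coeff c k l) (at (fst z)) (snd z))
      + christoffel c (fst z) ?a (christoffel c (fst z) (snd z) (snd z))
      - christoffel c (fst z) (snd z) (christoffel c (fst z) ?a (snd z))) $ i)"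
    by (intro smooth_on_vec_nth smooth_on_diff smooth_on_add D G snd smooth_on_const op)
  then show ?thesis
  proof (rule smooth_on_cong[OF op, rotated])
    fix z assume "z \<in> S"
    then have "fst z \<in> chart_map c ` chart_dom c" by (auto simp: S_def)
    then show "((\<Sum>k\<in>UNIV. \<Sum>l\<in>UNIV. (snd z $ k * snd z $ l) *\<^sub>R
        frechet_derivative (christoffel_coeff c k l) (at (fst z)) ?a)
      - (\<Sum>k\<in>UNIV. \<Sum>l\<in>UNIV. (?a $ k * snd z $ l) *\<^sub>R
        frechet_derivative (christoffel_coeff c k l) (at (fst z)) (snd z))
      + christoffel c (fst z) ?a (christoffel c (fst z) (snd z) (snd z))
      - christoffel c (fst z) (snd z) (christoffel c (fst z) ?a (snd z))) $ i = jacobi_matrix c z $ i $ j"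
      by (simp only: jacobi_matrix_def chart_curvature_def christoffel_frechet_derivative[OF c] matrix_def vec_lambda_beta)
  qed
qed

definition jacobi_poly :: "'m \<times> ('m, 'n) tvec \<Rightarrow> real poly" where
  "jacobi_poly \<xi> = charpoly (jacobi_matrix (chart_at A (fst \<xi>)) (bundle_chart (chart_at A (fst \<xi>)) \<xi>))"

text \<open>The matrices of the Jacobi operator in two charts are conjugate by the derivative of the transition
map.\<close>

lemma charpoly_jacobi_matrix:
  assumes c: "c \<in> A" "p \<in> chart_dom c" and d: "d \<in> A" "p \<in> chart_dom d" and w: "w \<in> tangent_space A p"
  shows "charpoly (jacobi_matrix d (chart_map d p, w d)) = charpoly (jacobi_matrix c (chart_map c p, w c))"
proof -
  let ?P = "transition_deriv c d p" and ?Q = "transition_deriv d c p"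
  let ?T = "\<lambda>u. chart_curvature c (chart_map c p) u (w c) (w c)"
  have lin: "linear ?P" "linear ?Q" "linear ?T"
    using linear_transition_deriv c d linear_chart_curvature by auto
  have "chart_curvature d (chart_map d p) a (w d) (w d) = ?P (?T (?Q a))" for a
  proof -
    let ?u = "tangent_of A d p a"
    have u: "?u \<in> tangent_space A p" by (rule tangent_of_in_tangent_space[OF d])
    have "?u d = a" "?u c = ?Q a" using c d by (auto simp: tangent_of_apply transition_deriv_refl)
    then show ?thesis
      using curvature(1)[OF c u w w] curvature(1)[OF d u w w]
        tangent_space_apply[OF curvature(2)[OF c u w w] c(1) d(1) c(2) d(2)] by simp
  qed
  then have "jacobi_matrix d (chart_map d p, w d) = matrix (?P \<circ> (?T \<circ> ?Q))"
    by (simp add: jacobi_matrix_def o_def)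
  also have "\<dots> = matrix ?P ** jacobi_matrix c (chart_map c p, w c) ** matrix ?Q"
    using lin by (simp add: matrix_compose linear_compose jacobi_matrix_def matrix_mul_assoc)
  finally have eq: "jacobi_matrix d (chart_map d p, w d) =
    matrix ?P ** jacobi_matrix c (chart_map c p, w c) ** matrix ?Q" .
  have "?P \<circ> ?Q = id" using c d transition_deriv_trans[of d c d p] by (simp add: fun_eq_iff transition_deriv_refl)
  then have "matrix ?P ** matrix ?Q = mat 1"
    using lin by (metis matrix_compose matrix_id_mat_1)
  then show ?thesis unfolding eq by (rule charpoly_similar)
qed

lemma jacobi_poly_chart:
  assumes "\<xi> \<in> tangent_bundle X A" "c \<in> A" "fst \<xi> \<in> chart_dom c"
  shows "jacobi_poly \<xi> = charpoly (jacobi_matrix c (bundle_chart c \<xi>))"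
proof -
  have "fst \<xi> \<in> topspace X" "snd \<xi> \<in> tangent_space A (fst \<xi>)" using assms(1) by (auto simp: tangent_bundle_def)
  then show ?thesis
    unfolding jacobi_poly_def bundle_chart_def using charpoly_jacobi_matrix[OF assms(2,3) chart_at] by simp
qed

lemma jacobi_Spec_eq:
  assumes "\<xi> \<in> tangent_bundle X A"
  shows "jacobi_Spec X A nabla \<xi> = complex_roots (jacobi_poly \<xi>)"
proof -
  let ?p = "fst \<xi>" and ?w = "snd \<xi>" and ?c = "chart_at A (fst \<xi>)"
  have p: "?p \<in> topspace X" and w: "?w \<in> tangent_space A ?p" using assms by (auto simp: tangent_bundle_def)
  note c = chart_at[OF p]
  have "(\<lambda>a. jacobi_operator X A nabla \<xi> (tangent_of A ?c ?p a) ?c) =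
      (\<lambda>a. chart_curvature ?c (chart_map ?c ?p) a (?w ?c) (?w ?c))"
    unfolding jacobi_operator_def curvature(1)[OF c tangent_of_in_tangent_space[OF c] w w] tangent_of_same[OF c]
    by (rule refl)
  then show ?thesis
    by (simp add: jacobi_Spec_def tangent_Spec_def Let_def Spec_eq_complex_roots jacobi_poly_def
        jacobi_matrix_def bundle_chart_def)
qed

text \<open>The Jacobi operator is quadratic, so that its eigenvalues are multiplied by the positive number
t * t.\<close>

lemma coeff_jacobi_poly_scale:
  assumes "(p, w) \<in> tangent_bundle X A" "t \<noteq> 0" "j \<le> CARD('n)"
  shows "coeff (jacobi_poly (p, \<lambda>c. t *\<^sub>R w c)) (CARD('n) - j) = (t * t) ^ j * coeff (jacobi_poly (p, w)) (CARD('n) - j)"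
proof -
  have p: "p \<in> topspace X" using assms by (auto simp: tangent_bundle_def)
  let ?c = "chart_at A p"
  have "jacobi_matrix ?c (chart_map ?c p, t *\<^sub>R w ?c) = (t * t) *\<^sub>R jacobi_matrix ?c (chart_map ?c p, w ?c)"
    unfolding jacobi_matrix_def matrix_def fst_conv snd_conv
      chart_curvature_scale[OF chart_at(1)[OF p] imageI[OF chart_at(2)[OF p]]]
    by (simp add: vec_eq_iff)
  then show ?thesis
    using coeff_charpoly_scaleR[of "t * t" j] assms by (simp add: jacobi_poly_def bundle_chart_def)
qed

end

section \<open>Constancy of the normalised coefficients\<close>

context atlas
begin

text \<open>The inverse of the bundle chart: the tangent vector with given base point coordinates and
components.\<close>

definition bundle_point :: "('m, 'n) chart \<Rightarrow> (real ^ 'n) \<times> (real ^ 'n) \<Rightarrow> 'm \<times> ('m, 'n) tvec" where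
  "bundle_point c z = (chart_inv c (fst z), tangent_of A c (chart_inv c (fst z)) (snd z))"

lemma bundle_point_in_bundle:
  assumes "c \<in> A" "fst z \<in> chart_map c ` chart_dom c"
  shows "bundle_point c z \<in> tangent_bundle X A"
  using chart_inv_in_dom[OF assms(2)] chart_dom_subset[OF assms(1)] tangent_of_in_tangent_space[OF assms(1)]
  by (auto simp: bundle_point_def tangent_bundle_def)

lemma bundle_chart_bundle_point:
  assumes "c \<in> A" "fst z \<in> chart_map c ` chart_dom c"
  shows "bundle_chart c (bundle_point c z) = z"
  using chart_map_chart_inv[OF assms(2)] tangent_of_same[OF assms(1) chart_inv_in_dom[OF assms(2)]]
  by (simp add: bundle_point_def bundle_chart_def)

lemma bundle_point_bundle_chart:
  assumes "c \<in> A" "p \<in> chart_dom c" "w \<in> tangent_space A p"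
  shows "bundle_point c (chart_map c p, w c) = (p, w)"
  using assms by (simp add: bundle_point_def tangent_of_component)

end

context connection_atlas
begin

abbreviation jacobi_shape :: "'m \<times> ('m, 'n) tvec \<Rightarrow> nat \<Rightarrow> real" where
  "jacobi_shape \<xi> \<equiv> shape CARD('n) (jacobi_poly \<xi>)"

abbreviation jacobi_weight :: "'m \<times> ('m, 'n) tvec \<Rightarrow> real" where
  "jacobi_weight \<xi> \<equiv> weight CARD('n) (jacobi_poly \<xi>)"

lemma degree_jacobi_poly: "degree (jacobi_poly \<xi>) = CARD('n)" "lead_coeff (jacobi_poly \<xi>) = (-1) ^ CARD('n)"
  by (simp_all add: jacobi_poly_def degree_charpoly)

lemma jacobi_weight_scale:
  assumes "(p, w) \<in> tangent_bundle X A" "t \<noteq> 0"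
  shows "jacobi_weight (p, \<lambda>c. t *\<^sub>R w c) = (t * t) * jacobi_weight (p, w)"
  by (rule weight_scale) (use assms coeff_jacobi_poly_scale[OF assms] in \<open>auto simp: zero_less_mult_iff\<close>)

lemma jacobi_shape_scale:
  assumes "(p, w) \<in> tangent_bundle X A" "t \<noteq> 0" "j \<in> {1..CARD('n)}"
  shows "jacobi_shape (p, \<lambda>c. t *\<^sub>R w c) j = jacobi_shape (p, w) j"
  by (rule shape_scale[where t = "t * t"])
    (use assms coeff_jacobi_poly_scale[OF assms(1,2)] in \<open>auto simp: zero_less_mult_iff\<close>)

lemma smooth_on_coeff_jacobi_matrix:
  "c \<in> A \<Longrightarrow> smooth_on (chart_map c ` chart_dom c \<times> UNIV) (\<lambda>z. coeff (charpoly (jacobi_matrix c z)) k)"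
  by (intro smooth_on_coeff_charpoly smooth_on_jacobi_matrix open_Times open_chart_image_dom open_UNIV)

lemma jacobi_poly_bundle_point:
  assumes "c \<in> A" "fst z \<in> chart_map c ` chart_dom c"
  shows "jacobi_poly (bundle_point c z) = charpoly (jacobi_matrix c z)"
  using jacobi_poly_chart[OF bundle_point_in_bundle[OF assms] assms(1)] chart_inv_in_dom[OF assms(2)]
    bundle_chart_bundle_point[OF assms] by (simp add: bundle_point_def)

end

text \<open>The vectors in S are normalised, and S need not be connected even when the manifold is. But the
shape does not distinguish the non-zero multiples of a vector, and so the arguments by continuity can
take place in the cone T of all these multiples, which is open in the tangent bundle. Up to the sign of
one vector, any two vectors of T over the same point are joined by a segment in T.\<close>

locale osserman_cone = connection_atlas X A nabla
  for X :: "'m topology" and A :: "('m, 'n::finite) chart set" and nabla +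
  fixes S T :: "('m \<times> ('m, 'n) tvec) set"
  assumes S_subset: "S \<subseteq> T" and T_bundle: "T \<subseteq> tangent_bundle X A"
    and rescale: "(p, v) \<in> T \<Longrightarrow> \<exists>t. t \<noteq> 0 \<and> (p, \<lambda>c. t *\<^sub>R v c) \<in> S"
    and open_cone: "c \<in> A \<Longrightarrow> open {z. fst z \<in> chart_map c ` chart_dom c \<and>
        bundle_point c z \<in> T}"
    and segment: "(p, u) \<in> T \<Longrightarrow> (p, v) \<in> T \<Longrightarrow>
        \<exists>e\<in>{1, -1}. \<forall>r\<in>{0..1}. (p, \<lambda>c. (1 - r) *\<^sub>R u c + (r * e) *\<^sub>R v c) \<in> T"
    and no_vectors_open: "openin X {p \<in> topspace X. \<forall>v. (p, v) \<notin> T}"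
    and osserman: "projective_osserman_on X A nabla S"
begin

lemma cone_point: "(p, v) \<in> T \<Longrightarrow> p \<in> topspace X \<and> v \<in> tangent_space A p"
  using T_bundle by (auto simp: tangent_bundle_def)

text \<open>A spectrum different from the singleton of 0 forces a non-zero coefficient besides the leading one.\<close>

lemma weight_pos:
  assumes "(p, v) \<in> T" shows "jacobi_weight (p, v) > 0"
proof -
  obtain t where t: "t \<noteq> 0" "(p, \<lambda>c. t *\<^sub>R v c) \<in> S" using rescale[OF assms] by blast
  let ?y = "(p, \<lambda>c. t *\<^sub>R v c)"
  have "jacobi_Spec X A nabla ?y \<noteq> {0}" using osserman t(2) by (auto simp: projective_osserman_on_def)
  then have "complex_roots (jacobi_poly ?y) \<noteq> {0}"
    using jacobi_Spec_eq[of ?y] t(2) S_subset T_bundle by auto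
  then have "jacobi_weight ?y \<noteq> 0"
    using complex_roots_trivial_iff[OF degree_jacobi_poly(1)] by simp
  then have "jacobi_weight (p, v) \<noteq> 0"
    using jacobi_weight_scale[of p v t] t(1) assms T_bundle by auto
  then show ?thesis using weight_nonneg[of "CARD('n)"] by (simp add: order_less_le)
qed

lemma finite_jacobi_shapes:
  assumes "j \<in> {1..CARD('n)}" shows "finite ((\<lambda>\<xi>. jacobi_shape \<xi> j) ` T)"
proof (cases "S = {}")
  case True
  then have "T = {}" using rescale by auto
  then show ?thesis by simp
next
  case False
  then obtain x where x: "x \<in> S" by blast
  let ?E = "complex_roots (jacobi_poly x)"
  let ?F = "{shape CARD('n) p j | p. degree p = CARD('n) \<and> lead_coeff p = (-1) ^ CARD('n) \<and>
      (\<exists>s. s \<noteq> 0 \<and> complex_roots p = scale_set s ?E)}"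
  have "jacobi_poly x \<noteq> 0" using degree_jacobi_poly(1)[of x] by auto
  then have fin: "finite ?F" by (intro finite_shapes assms finite_complex_roots)
  have S: "jacobi_shape y j \<in> ?F" if y: "y \<in> S" for y
  proof -
    obtain s where s: "s \<noteq> 0" "jacobi_Spec X A nabla y = scale_set s (jacobi_Spec X A nabla x)"
      using osserman x y unfolding projective_osserman_on_def by blast
    have "complex_roots (jacobi_poly y) = scale_set s ?E"
      using s(2) jacobi_Spec_eq[of x] jacobi_Spec_eq[of y] x y S_subset T_bundle by (metis subsetD)
    then show ?thesis using s(1) degree_jacobi_poly[of y] by blast
  qed
  have "(\<lambda>\<xi>. jacobi_shape \<xi> j) ` T \<subseteq> ?F"
  proof (rule image_subsetI)
    fix \<xi> assume \<xi>: "\<xi> \<in> T"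
    obtain p v where pv: "\<xi> = (p, v)" by (cases \<xi>)
    obtain t where t: "t \<noteq> 0" "(p, \<lambda>c. t *\<^sub>R v c) \<in> S" using rescale \<xi> pv by blast
    have "jacobi_shape (p, \<lambda>c. t *\<^sub>R v c) j = jacobi_shape \<xi> j"
      unfolding pv by (rule jacobi_shape_scale) (use \<xi> pv T_bundle t assms in auto)
    then show "jacobi_shape \<xi> j \<in> ?F" using S[OF t(2)] by simp
  qed
  then show ?thesis using fin by (rule finite_subset)
qed

definition chart_cone :: "('m, 'n) chart \<Rightarrow> ((real ^ 'n) \<times> (real ^ 'n)) set" where
  "chart_cone c = {z. fst z \<in> chart_map c ` chart_dom c \<and> bundle_point c z \<in> T}"

lemma open_chart_cone: "c \<in> A \<Longrightarrow> open (chart_cone c)"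
  using open_cone by (simp add: chart_cone_def)

lemma bundle_chart_in_chart_cone:
  assumes "c \<in> A" "p \<in> chart_dom c" "w \<in> tangent_space A p"
  shows "(chart_map c p, w c) \<in> chart_cone c \<longleftrightarrow> (p, w) \<in> T"
  using assms bundle_point_bundle_chart[OF assms] by (simp add: chart_cone_def)

text \<open>A continuous function with finitely many values is constant on a connected set. Continuity of the
shape needs the weight to be non-zero.\<close>

lemma shape_constant_on_connected:
  assumes c: "c \<in> A" and K: "connected K" "K \<subseteq> chart_cone c" and z: "z \<in> K" "z' \<in> K" and j: "j \<in> {1..CARD('n)}"
  shows "jacobi_shape (bundle_point c z) j = jacobi_shape (bundle_point c z') j"
proof -
  let ?f = "\<lambda>z. shape CARD('n) (charpoly (jacobi_matrix c z)) j"
  have f: "?f z = jacobi_shape (bundle_point c z) j" if "z \<in> K" for z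
    using jacobi_poly_bundle_point[OF c, of z] that K(2) by (auto simp: chart_cone_def)
  have sub: "K \<subseteq> chart_map c ` chart_dom c \<times> UNIV" using K(2) by (auto simp: chart_cone_def)
  have co: "continuous_on K (\<lambda>z. coeff (charpoly (jacobi_matrix c z)) k)" for k
    by (rule continuous_on_subset[OF smooth_on_continuous_on[OF smooth_on_coeff_jacobi_matrix[OF c]] sub])
  have nz: "weight CARD('n) (charpoly (jacobi_matrix c z)) \<noteq> 0" if "z \<in> K" for z
  proof -
    have "bundle_point c z \<in> T" "fst z \<in> chart_map c ` chart_dom c" using that K(2) by (auto simp: chart_cone_def)
    then show ?thesis
      using weight_pos[of "fst (bundle_point c z)" "snd (bundle_point c z)"] jacobi_poly_bundle_point[OF c, of z] by simp
  qed
  have w: "continuous_on K (\<lambda>z. weight CARD('n) (charpoly (jacobi_matrix c z)))"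
    unfolding weight_def by (intro continuous_on_sum continuous_on_powr' continuous_on_rabs co continuous_on_const) auto
  have "continuous_on K ?f"
    unfolding shape_def by (intro continuous_on_divide continuous_on_power co w) (use nz in auto)
  moreover have "finite (?f ` K)"
    by (rule finite_subset[OF _ finite_jacobi_shapes[OF j]]) (use f K(2) in \<open>auto simp: chart_cone_def\<close>)
  ultimately have "?f constant_on K" by (rule continuous_finite_range_constant[OF K(1)])
  then show ?thesis using z f by (auto simp: constant_on_def)
qed

text \<open>Move from u to v, or from u to -v, along a segment in the cone; the shapes at v and -v agree because
the Jacobi operator is even.\<close>

lemma shape_constant_on_fibre:
  assumes u: "(p, u) \<in> T" and v: "(p, v) \<in> T" and j: "j \<in> {1..CARD('n)}"
  shows "jacobi_shape (p, u) j = jacobi_shape (p, v) j"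
proof -
  obtain e where e: "e \<in> {1, -1::real}"
    and seg: "\<And>r. r \<in> {0..1} \<Longrightarrow> (p, \<lambda>c. (1 - r) *\<^sub>R u c + (r * e) *\<^sub>R v c) \<in> T"
    using segment[OF u v] by blast
  let ?c = "chart_at A p"
  have p: "p \<in> topspace X" using cone_point u by blast
  note c = chart_at[OF p]
  define \<gamma> where "\<gamma> r = (chart_map ?c p, (1 - r) *\<^sub>R u ?c + (r * e) *\<^sub>R v ?c)" for r
  have K: "connected (\<gamma> ` {0..1})" unfolding \<gamma>_def
    by (intro connected_continuous_image continuous_intros) auto
  have pt: "bundle_point ?c (\<gamma> r) = (p, \<lambda>c. (1 - r) *\<^sub>R u c + (r * e) *\<^sub>R v c)" if "r \<in> {0..1}" for r
    unfolding \<gamma>_def by (rule bundle_point_bundle_chart[OF c]) (use cone_point[OF seg[OF that]] in blast)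
  have "\<gamma> ` {0..1} \<subseteq> chart_cone ?c"
    using pt seg c by (auto simp: chart_cone_def \<gamma>_def)
  then have "jacobi_shape (bundle_point ?c (\<gamma> 0)) j = jacobi_shape (bundle_point ?c (\<gamma> 1)) j"
    by (intro shape_constant_on_connected[OF c(1) K _ _ _ j]) auto
  then have "jacobi_shape (p, u) j = jacobi_shape (p, \<lambda>c. e *\<^sub>R v c) j" by (simp add: pt)
  also have "\<dots> = jacobi_shape (p, v) j"
    by (rule jacobi_shape_scale) (use v T_bundle e j in auto)
  finally show ?thesis .
qed

text \<open>Keep the components of the vector in a chart fixed and move the base point: since the cone is open,
the vector stays in it for a while.\<close>

lemma shape_locally_constant:
  assumes v: "(p, v) \<in> T"
  shows "\<exists>U. openin X U \<and> p \<in> U \<and>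
    (\<forall>q\<in>U. \<exists>w. (q, w) \<in> T \<and> (\<forall>j\<in>{1..CARD('n)}. jacobi_shape (q, w) j = jacobi_shape (p, v) j))"
proof -
  let ?c = "chart_at A p"
  have p: "p \<in> topspace X" "v \<in> tangent_space A p" using cone_point v by auto
  note c = chart_at[OF p(1)]
  have "(chart_map ?c p, v ?c) \<in> chart_cone ?c" using bundle_chart_in_chart_cone[OF c p(2)] v by simp
  moreover have "open ((\<lambda>x. (x, v ?c)) -` chart_cone ?c)"
    by (intro open_vimage open_chart_cone c continuous_intros)
  ultimately obtain e where e: "e > 0" "ball (chart_map ?c p) e \<subseteq> (\<lambda>x. (x, v ?c)) -` chart_cone ?c"
    unfolding open_contains_ball by blast
  let ?B = "ball (chart_map ?c p) e"
  let ?U = "{q \<in> chart_dom ?c. chart_map ?c q \<in> ?B}"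
  have K: "connected ((\<lambda>x. (x, v ?c)) ` ?B)"
    by (intro connected_continuous_image continuous_intros connected_ball)
  have sub: "(\<lambda>x. (x, v ?c)) ` ?B \<subseteq> chart_cone ?c" using e(2) by auto
  have "\<exists>w. (q, w) \<in> T \<and> (\<forall>j\<in>{1..CARD('n)}. jacobi_shape (q, w) j = jacobi_shape (p, v) j)" if q: "q \<in> ?U" for q
  proof (intro exI conjI ballI)
    let ?w = "tangent_of A ?c q (v ?c)"
    have w: "bundle_point ?c (chart_map ?c q, v ?c) = (q, ?w)"
      using q c by (simp add: bundle_point_def)
    have "(chart_map ?c q, v ?c) \<in> chart_cone ?c" using sub q by blast
    then show "(q, ?w) \<in> T" using w by (simp add: chart_cone_def)
    fix j assume j: "j \<in> {1..CARD('n)}"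
    have "jacobi_shape (bundle_point ?c (chart_map ?c q, v ?c)) j = jacobi_shape (bundle_point ?c (chart_map ?c p, v ?c)) j"
      by (rule shape_constant_on_connected[OF c(1) K sub _ _ j]) (use q e(1) in auto)
    then show "jacobi_shape (q, ?w) j = jacobi_shape (p, v) j"
      using w bundle_point_bundle_chart[OF c p(2)] by simp
  qed
  moreover have "openin X ?U" by (rule openin_chart_preimage[OF c(1) open_ball])
  ultimately show ?thesis using c e(1) by (intro exI[of _ ?U]) auto
qed

text \<open>The points whose vectors in the cone have a given shape form an open set. So does the rest of the
manifold, which consists of points with vectors of another shape and of points without any vector in the
cone. Connectedness therefore leaves a single shape.\<close>

lemma shape_constant:
  assumes conn: "connected_space X" and \<xi>: "\<xi> \<in> T" and \<eta>: "\<eta> \<in> T" and j: "j \<in> {1..CARD('n)}"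
  shows "jacobi_shape \<xi> j = jacobi_shape \<eta> j"
proof -
  let ?P = "\<lambda>p v. (p, v) \<in> T \<and> jacobi_shape (p, v) j = jacobi_shape \<xi> j"
  let ?Q = "\<lambda>p v. (p, v) \<in> T \<and> jacobi_shape (p, v) j \<noteq> jacobi_shape \<xi> j"
  let ?G = "{p. \<exists>v. ?P p v}" and ?H = "{p. \<exists>v. ?Q p v}"
  have "openin X {p. \<exists>v. (p, v) \<in> T \<and> R (jacobi_shape (p, v) j)}" for R
  proof (subst openin_subopen, intro ballI)
    fix p assume "p \<in> {p. \<exists>v. (p, v) \<in> T \<and> R (jacobi_shape (p, v) j)}"
    then obtain v where v: "(p, v) \<in> T" "R (jacobi_shape (p, v) j)" by blast
    obtain U where U: "openin X U" "p \<in> U"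
      "\<And>q. q \<in> U \<Longrightarrow> \<exists>w. (q, w) \<in> T \<and> (\<forall>j\<in>{1..CARD('n)}. jacobi_shape (q, w) j = jacobi_shape (p, v) j)"
      using shape_locally_constant[OF v(1)] by blast
    have "U \<subseteq> {p. \<exists>v. (p, v) \<in> T \<and> R (jacobi_shape (p, v) j)}"
    proof
      fix q assume "q \<in> U"
      then obtain w where w: "(q, w) \<in> T" "\<forall>j\<in>{1..CARD('n)}. jacobi_shape (q, w) j = jacobi_shape (p, v) j"
        using U(3) by blast
      then have "jacobi_shape (q, w) j = jacobi_shape (p, v) j" using j by blast
      then show "q \<in> {p. \<exists>v. (p, v) \<in> T \<and> R (jacobi_shape (p, v) j)}" using w(1) v(2) by auto
    qed
    then show "\<exists>U. openin X U \<and> p \<in> U \<and> U \<subseteq> {p. \<exists>v. (p, v) \<in> T \<and> R (jacobi_shape (p, v) j)}"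
      using U by blast
  qed
  note op = this[of "\<lambda>r. r = jacobi_shape \<xi> j"] this[of "\<lambda>r. r \<noteq> jacobi_shape \<xi> j"]
  have disjoint: "\<not> ?Q p w" if "?P p v" for p v w
    using shape_constant_on_fibre[of p v w j] that j by simp
  have "topspace X - ?G = {p \<in> topspace X. \<forall>v. (p, v) \<notin> T} \<union> ?H"
  proof (intro set_eqI iffI)
    fix p assume "p \<in> {p \<in> topspace X. \<forall>v. (p, v) \<notin> T} \<union> ?H"
    then show "p \<in> topspace X - ?G" using cone_point disjoint by blast
  qed blast
  then have "openin X (topspace X - ?G)" using op(2) no_vectors_open by auto
  then have "closedin X ?G" using op(1) openin_subset by (simp add: closedin_def)
  moreover have "fst \<xi> \<in> ?G" using \<xi> by (auto intro: exI[of _ "snd \<xi>"])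
  ultimately have "?G = topspace X" using conn op(1) unfolding connected_space_clopen_in by blast
  then have "fst \<eta> \<in> ?G" using cone_point[of "fst \<eta>" "snd \<eta>"] \<eta> by simp
  then obtain v where "(fst \<eta>, v) \<in> T" "jacobi_shape (fst \<eta>, v) j = jacobi_shape \<xi> j" by blast
  then show ?thesis using shape_constant_on_fibre[of "fst \<eta>" v "snd \<eta>" j] \<eta> j by simp
qed

section \<open>The scaling function\<close>

lemma smooth_scaling_in_charts:
  fixes \<sigma> :: real and k :: nat
  assumes c: "c \<in> A" and d: "d \<in> A"
  defines "a \<equiv> \<lambda>c z. \<sigma> * coeff (charpoly (jacobi_matrix c z)) k"
  defines "N \<equiv> \<lambda>c. (chart_map c ` chart_dom c \<times> UNIV) \<inter> a c -` {0<..}"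
  shows "open (N c \<times> N d)"
    and "smooth_on (N c \<times> N d) (\<lambda>z. a d (snd z) powr r * a c (fst z) powr s)"
proof -
  have sm: "smooth_on (chart_map c ` chart_dom c \<times> UNIV) (a c)" if "c \<in> A" for c
    unfolding a_def
    by (intro smooth_on_mult smooth_on_const smooth_on_coeff_jacobi_matrix that open_Times open_chart_image_dom open_UNIV)
  have op: "open (N c)" if "c \<in> A" for c
    unfolding N_def
    by (rule continuous_open_preimage[OF smooth_on_continuous_on[OF sm[OF that]]])
      (intro open_Times open_chart_image_dom open_UNIV that open_greaterThan)+
  show opN: "open (N c \<times> N d)" by (intro open_Times op c d)
  have pw: "smooth_on (N c) (\<lambda>z. a c z powr r)" if "c \<in> A" for c r
    by (rule smooth_on_compose[OF op[OF that] open_greaterThan _ smooth_on_subset[OF sm[OF that]] smooth_on_powr])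
      (auto simp: N_def)
  have "smooth_on (N c \<times> N d) (\<lambda>z. a c (fst z) powr s)"
    by (rule smooth_on_compose[OF opN op[OF c] _ smooth_on_bounded_linear[OF opN bounded_linear_fst smooth_on_ident[OF opN]] pw[OF c]])
      auto
  moreover have "smooth_on (N c \<times> N d) (\<lambda>z. a d (snd z) powr r)"
    by (rule smooth_on_compose[OF opN op[OF d] _ smooth_on_bounded_linear[OF opN bounded_linear_snd smooth_on_ident[OF opN]] pw[OF d]])
      auto
  ultimately show "smooth_on (N c \<times> N d) (\<lambda>z. a d (snd z) powr r * a c (fst z) powr s)"
    by (intro smooth_on_mult opN)
qed

text \<open>As all shapes coincide, the quotient of the weights is a scaling function. It is positive. Moreover
there is one index j for which the coefficient of degree n - j vanishes nowhere on S; its modulus is a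
constant multiple of the j-th power of the weight, and its sign is constant. Hence the quotient of the
weights is the j-th root of the quotient of two smooth functions that are positive after multiplication
with the common sign.\<close>

theorem ex_positive_smooth_scaling:
  assumes conn: "connected_space X"
  shows "\<exists>s. positive_smooth_scaling X A nabla S s"
proof (cases "S = {}")
  case True
  then show ?thesis by (simp add: positive_smooth_scaling_def smooth_on_pairs_def)
next
  case False
  then obtain x0 where x0: "x0 \<in> S" by blast
  let ?n = "CARD('n)"
  have T: "\<xi> \<in> T" "\<xi> \<in> tangent_bundle X A" if "\<xi> \<in> S" for \<xi> using that S_subset T_bundle by auto
  have wpos: "jacobi_weight \<xi> > 0" if "\<xi> \<in> S" for \<xi>
    using weight_pos[of "fst \<xi>" "snd \<xi>"] T(1)[OF that] by simp
  obtain j where j: "j \<in> {1..?n}" "coeff (jacobi_poly x0) (?n - j) \<noteq> 0"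
    using wpos[OF x0] weight_eq_0_iff[of ?n "jacobi_poly x0"] by auto
  \<comment> \<open>The common sign of the chosen coefficient on all of S.\<close>
  define \<sigma> where "\<sigma> = sgn (coeff (jacobi_poly x0) (?n - j))"
  define a where "a \<xi> = \<sigma> * coeff (jacobi_poly \<xi>) (?n - j)" for \<xi>
  define \<kappa> where "\<kappa> = \<sigma> * jacobi_shape x0 j"
  have "\<sigma> * coeff (jacobi_poly x0) (?n - j) > 0" using j(2) by (simp add: \<sigma>_def sgn_if)
  then have \<kappa>: "\<kappa> > 0" using wpos[OF x0] by (simp add: \<kappa>_def shape_def)
  have a: "a \<xi> = \<kappa> * jacobi_weight \<xi> ^ j" if "\<xi> \<in> S" for \<xi>
    using shape_constant[OF conn T(1)[OF x0] T(1)[OF that] j(1)] wpos[OF that] by (simp add: a_def \<kappa>_def shape_def)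
  have apos: "a \<xi> > 0" if "\<xi> \<in> S" for \<xi> using a[OF that] \<kappa> wpos[OF that] by simp
  define s where "s x y = a y powr (1 / j) * a x powr (- (1 / j))" for x y
  have s: "s x y = jacobi_weight y / jacobi_weight x" if "x \<in> S" "y \<in> S" for x y
  proof -
    have root: "a \<xi> powr (1 / j) = \<kappa> powr (1 / j) * jacobi_weight \<xi>" if "\<xi> \<in> S" for \<xi>
      using \<kappa> wpos[OF that] j(1) by (simp add: a[OF that] powr_mult powr_powr powr_realpow[symmetric])
    show ?thesis using root[OF that(1)] root[OF that(2)] \<kappa> by (simp add: s_def powr_minus divide_simps)
  qed
  have "jacobi_Spec X A nabla y = scale_set (s x y) (jacobi_Spec X A nabla x)" if "x \<in> S" "y \<in> S" for x y
  proof -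
    have "complex_roots (jacobi_poly y) =
        scale_set (jacobi_weight y / jacobi_weight x) (complex_roots (jacobi_poly x))"
      by (rule complex_roots_of_equal_shapes)
        (use degree_jacobi_poly wpos that shape_constant[OF conn T(1)[OF that(1)] T(1)[OF that(2)]] in auto)
    then show ?thesis using s[OF that] jacobi_Spec_eq T(2) that by simp
  qed
  moreover have "s x y > 0" if "x \<in> S" "y \<in> S" for x y using s[OF that] wpos that by simp
  moreover have "smooth_on_pairs A S s"
    unfolding smooth_on_pairs_def
  proof (intro ballI impI)
    fix x y c d
    assume xy: "x \<in> S" "y \<in> S" and cd: "c \<in> A" "d \<in> A" and dom: "fst x \<in> chart_dom c \<and> fst y \<in> chart_dom d"
    define b where "b c z = \<sigma> * coeff (charpoly (jacobi_matrix c z)) (?n - j)" for c z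
    define N where "N c = (chart_map c ` chart_dom c \<times> UNIV) \<inter> b c -` {0<..}" for c
    let ?F = "\<lambda>z. b d (snd z) powr (1 / j) * b c (fst z) powr (- (1 / j))"
    have b: "b c (bundle_chart c \<xi>) = a \<xi>" if "c \<in> A" "\<xi> \<in> S" "fst \<xi> \<in> chart_dom c" for c \<xi>
      using jacobi_poly_chart[OF T(2)[OF that(2)] that(1,3)] by (simp add: a_def b_def)
    have N: "bundle_chart c \<xi> \<in> N c" if "c \<in> A" "\<xi> \<in> S" "fst \<xi> \<in> chart_dom c" for c \<xi>
      using b[OF that] apos[OF that(2)] that(3) by (simp add: N_def bundle_chart_def)
    show "\<exists>N F. open N \<and> (bundle_chart c x, bundle_chart d y) \<in> N \<and> smooth_on N F \<and>
          (\<forall>x'\<in>S. \<forall>y'\<in>S. fst x' \<in> chart_dom c \<and> fst y' \<in> chart_dom d \<and>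
             (bundle_chart c x', bundle_chart d y') \<in> N \<longrightarrow>
             s x' y' = F (bundle_chart c x', bundle_chart d y'))"
    proof (intro exI conjI ballI impI)
      show "open (N c \<times> N d)" "smooth_on (N c \<times> N d) ?F"
        using smooth_scaling_in_charts[OF cd, of \<sigma> "?n - j"] unfolding N_def b_def by blast+
      show "(bundle_chart c x, bundle_chart d y) \<in> N c \<times> N d" using N xy cd dom by simp
    next
      fix x' y'
      assume *: "x' \<in> S" "y' \<in> S" "fst x' \<in> chart_dom c \<and> fst y' \<in> chart_dom d \<and>
             (bundle_chart c x', bundle_chart d y') \<in> N c \<times> N d"
      show "s x' y' = ?F (bundle_chart c x', bundle_chart d y')" using * b cd by (simp add: s_def)
    qed
  qed
  ultimately show ?thesis unfolding positive_smooth_scaling_def by blast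
qed

end

section \<open>The cones of non-zero and of spacelike vectors\<close>

text \<open>The value of a quadratic form on the segment between two vectors on which it is positive, when the
mixed term is non-negative.\<close>

lemma inner_segment_pos:
  fixes \<alpha> \<beta> \<gamma> r :: real
  assumes "\<alpha> > 0" "\<beta> > 0" "\<gamma> \<ge> 0" "r \<in> {0..1}"
  shows "(1 - r) * (1 - r) * \<alpha> + 2 * ((1 - r) * r * \<gamma>) + r * r * \<beta> > 0"
proof (cases "r = 0")
  case False
  then have "r * r * \<beta> > 0" using assms by simp
  moreover have "(1 - r) * (1 - r) * \<alpha> \<ge> 0" "(1 - r) * r * \<gamma> \<ge> 0" using assms by simp_all
  ultimately show ?thesis by linarith
qed (use assms in simp)

context atlas
begin

lemma bundle_point_nonzero_iff:
  assumes c: "c \<in> A" "fst z \<in> chart_map c ` chart_dom c"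
  shows "bundle_point c z \<in> nonzero_vectors X A \<longleftrightarrow> snd z \<noteq> 0"
proof -
  let ?p = "chart_inv c (fst z)"
  have p: "?p \<in> chart_dom c" by (rule chart_inv_in_dom[OF c(2)])
  have "tangent_of A c ?p (snd z) = (\<lambda>d. 0) \<longleftrightarrow> tangent_of A c ?p (snd z) c = 0"
    using tangent_space_eqI[OF tangent_of_in_tangent_space[OF c(1) p] tangent_space_zero c(1) p] by auto
  then show ?thesis
    using bundle_point_in_bundle[OF c]
    by (simp add: nonzero_vectors_def tangent_of_same[OF c(1) p]) (simp add: bundle_point_def)
qed

end

context connection_atlas
begin

text \<open>The Euclidean inner product in a chart selects the sign for which the segment from u to v or to -v
avoids the origin.\<close>

lemma osserman_cone_nonzero:
  assumes "projective_osserman_on X A nabla (nonzero_vectors X A)"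
  shows "osserman_cone X A nabla (nonzero_vectors X A) (nonzero_vectors X A)"
proof unfold_locales
  show "\<exists>t. t \<noteq> 0 \<and> (p, \<lambda>c. t *\<^sub>R v c) \<in> nonzero_vectors X A" if "(p, v) \<in> nonzero_vectors X A" for p v
    using that by (intro exI[of _ 1]) simp
  show "open {z. fst z \<in> chart_map c ` chart_dom c \<and> bundle_point c z \<in> nonzero_vectors X A}" if c: "c \<in> A" for c
  proof -
    have "{z. fst z \<in> chart_map c ` chart_dom c \<and> bundle_point c z \<in> nonzero_vectors X A} =
        chart_map c ` chart_dom c \<times> (- {0})"
      using bundle_point_nonzero_iff[OF c] by auto
    then show ?thesis by (simp add: open_Times open_chart_image_dom[OF c] open_Compl)
  qed
  show "\<exists>e\<in>{1, -1}. \<forall>r\<in>{0..1}. (p, \<lambda>c. (1 - r) *\<^sub>R u c + (r * e) *\<^sub>R v c) \<in> nonzero_vectors X A"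
    if uv: "(p, u) \<in> nonzero_vectors X A" "(p, v) \<in> nonzero_vectors X A" for p u v
  proof -
    let ?c = "chart_at A p"
    have p: "p \<in> topspace X" "u \<in> tangent_space A p" "v \<in> tangent_space A p" "u \<noteq> (\<lambda>c. 0)" "v \<noteq> (\<lambda>c. 0)"
      using uv by (auto simp: nonzero_vectors_def tangent_bundle_def)
    note c = chart_at[OF p(1)]
    have nz: "w ?c \<noteq> 0" if "w \<in> tangent_space A p" "w \<noteq> (\<lambda>c. 0)" for w
      using tangent_space_eqI[OF that(1) tangent_space_zero c] that(2) by auto
    define e :: real where "e = (if u ?c \<bullet> v ?c \<ge> 0 then 1 else -1)"
    have e: "e * e = 1" "e * (u ?c \<bullet> v ?c) \<ge> 0" by (auto simp: e_def)
    have "(p, \<lambda>c. (1 - r) *\<^sub>R u c + (r * e) *\<^sub>R v c) \<in> nonzero_vectors X A" if r: "r \<in> {0..1}" for r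
    proof -
      let ?w = "(1 - r) *\<^sub>R u ?c + (r * e) *\<^sub>R v ?c"
      have "?w \<bullet> ?w = (1 - r) * (1 - r) * (u ?c \<bullet> u ?c) + 2 * ((1 - r) * r * (e * (u ?c \<bullet> v ?c)))
          + r * r * (e * e) * (v ?c \<bullet> v ?c)"
        by (simp add: inner_add_left inner_add_right inner_commute algebra_simps)
      also have "\<dots> > 0"
        unfolding e(1) mult_1_right by (rule inner_segment_pos) (use nz p e r in auto)
      finally have "?w \<noteq> 0" by auto
      then have "(\<lambda>c. (1 - r) *\<^sub>R u c + (r * e) *\<^sub>R v c) \<noteq> (\<lambda>c. 0)" by (auto dest: fun_cong)
      then show ?thesis
        using tangent_space_lincomb[OF p(2,3)] p(1) by (simp add: nonzero_vectors_def tangent_bundle_def)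
    qed
    then show ?thesis by (intro bexI[of _ e]) (auto simp: e_def)
  qed
  have "\<exists>v. (p, v) \<in> nonzero_vectors X A" if p: "p \<in> topspace X" for p
  proof -
    let ?c = "chart_at A p"
    note c = chart_at[OF p]
    obtain b :: "real ^ 'n" where "b \<noteq> 0" using nonzero_Basis SOME_Basis by blast
    then have "bundle_point ?c (chart_map ?c p, b) \<in> nonzero_vectors X A"
      using bundle_point_nonzero_iff[OF c(1), of "(chart_map ?c p, b)"] c(2) by simp
    then show ?thesis using c by (auto simp: bundle_point_def)
  qed
  then have "{p \<in> topspace X. \<forall>v. (p, v) \<notin> nonzero_vectors X A} = {}" by blast
  then show "openin X {p \<in> topspace X. \<forall>v. (p, v) \<notin> nonzero_vectors X A}" by (simp only: openin_empty)
  show "nonzero_vectors X A \<subseteq> tangent_bundle X A" by (auto simp: nonzero_vectors_def)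
  show "projective_osserman_on X A nabla (nonzero_vectors X A)" by (rule assms)
qed simp

end

locale metric_atlas = atlas X A for X :: "'m topology" and A :: "('m, 'n::finite) chart set" +
  fixes g :: "'m \<Rightarrow> ('m, 'n) tvec \<Rightarrow> ('m, 'n) tvec \<Rightarrow> real"
  assumes metric: "pseudo_riemannian_metric X A g"
begin

lemmas metric_rules = metric[unfolded pseudo_riemannian_metric_def]

lemma metric_commute:
  "p \<in> topspace X \<Longrightarrow> u \<in> tangent_space A p \<Longrightarrow> v \<in> tangent_space A p \<Longrightarrow> g p u v = g p v u"
  using metric_rules[THEN conjunct1] by blast

lemma metric_lincomb_left:
  "p \<in> topspace X \<Longrightarrow> u \<in> tangent_space A p \<Longrightarrow> u' \<in> tangent_space A p \<Longrightarrow> v \<in> tangent_space A p \<Longrightarrow>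
    g p (\<lambda>c. a *\<^sub>R u c + b *\<^sub>R u' c) v = a * g p u v + b * g p u' v"
  using metric_rules[THEN conjunct2, THEN conjunct1] by blast

lemma metric_lincomb_right:
  assumes "p \<in> topspace X" "u \<in> tangent_space A p" "u' \<in> tangent_space A p" "v \<in> tangent_space A p"
  shows "g p v (\<lambda>c. a *\<^sub>R u c + b *\<^sub>R u' c) = a * g p v u + b * g p v u'"
  using metric_lincomb_left[OF assms] metric_commute[OF assms(1) assms(4) tangent_space_lincomb[OF assms(2,3)]]
    metric_commute[OF assms(1,4,2)] metric_commute[OF assms(1,4,3)] by simp

lemma metric_lincomb:
  assumes "p \<in> topspace X" "u \<in> tangent_space A p" "v \<in> tangent_space A p"
  shows "g p (\<lambda>c. a *\<^sub>R u c + b *\<^sub>R v c) (\<lambda>c. a *\<^sub>R u c + b *\<^sub>R v c) =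
    a * a * g p u u + 2 * (a * b * g p u v) + b * b * g p v v"
  using assms tangent_space_lincomb[OF assms(2,3)]
  by (simp add: metric_lincomb_left metric_lincomb_right metric_commute[of p v u] algebra_simps)

lemma metric_scale:
  assumes "p \<in> topspace X" "u \<in> tangent_space A p"
  shows "g p (\<lambda>c. a *\<^sub>R u c) (\<lambda>c. a *\<^sub>R u c) = a * a * g p u u"
  using metric_lincomb[OF assms assms(2), of a 0] by simp

lemma metric_nondegenerate:
  "p \<in> topspace X \<Longrightarrow> u \<in> tangent_space A p \<Longrightarrow> (\<And>v. v \<in> tangent_space A p \<Longrightarrow> g p u v = 0) \<Longrightarrow> u = (\<lambda>c. 0)"
  using metric_rules[THEN conjunct2, THEN conjunct2, THEN conjunct1] by blast

lemma smooth_metric: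
  "openin X U \<Longrightarrow> smooth_vfield A U V \<Longrightarrow> smooth_vfield A U W \<Longrightarrow> smooth_fun A U (\<lambda>q. g q (V q) (W q))"
  using metric_rules[THEN conjunct2, THEN conjunct2, THEN conjunct2] by blast

definition chart_metric :: "('m, 'n) chart \<Rightarrow> real ^ 'n \<Rightarrow> real ^ 'n \<Rightarrow> real ^ 'n \<Rightarrow> real" where
  "chart_metric c x a b =
     g (chart_inv c x) (tangent_of A c (chart_inv c x) a) (tangent_of A c (chart_inv c x) b)"

lemma linear_chart_metric:
  assumes c: "c \<in> A" "x \<in> chart_map c ` chart_dom c"
  shows "linear (\<lambda>a. chart_metric c x a b)" "linear (\<lambda>b. chart_metric c x a b)"
proof -
  have p: "chart_inv c x \<in> chart_dom c" "chart_inv c x \<in> topspace X"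
    using chart_inv_in_dom[OF c(2)] chart_dom_subset[OF c(1)] by auto
  note t = tangent_of_in_tangent_space[OF c(1) p(1)]
  have l: "chart_metric c x (r *\<^sub>R u + s *\<^sub>R v) b = r * chart_metric c x u b + s * chart_metric c x v b" for r s u v b
    unfolding chart_metric_def tangent_of_lincomb[OF c(1) p(1)] by (rule metric_lincomb_left[OF p(2) t t t])
  have r: "chart_metric c x a (r *\<^sub>R u + s *\<^sub>R v) = r * chart_metric c x a u + s * chart_metric c x a v" for r s u v a
    unfolding chart_metric_def tangent_of_lincomb[OF c(1) p(1)] by (rule metric_lincomb_right[OF p(2) t t t])
  show "linear (\<lambda>a. chart_metric c x a b)"
    by (rule linearI) (use l[of 1 _ 1 _ b] l[of _ _ 0 0 b] in simp_all)
  show "linear (\<lambda>b. chart_metric c x a b)"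
    by (rule linearI) (use r[of a 1 _ 1] r[of a _ _ 0 0] in simp_all)
qed

lemma continuous_on_chart_metric:
  assumes c: "c \<in> A"
  shows "continuous_on (chart_map c ` chart_dom c \<times> UNIV) (\<lambda>z. chart_metric c (fst z) (snd z) (snd z))"
proof -
  let ?S = "chart_map c ` chart_dom c \<times> (UNIV :: (real ^ 'n) set)"
  have co: "continuous_on (chart_map c ` chart_dom c) (\<lambda>x. chart_metric c x a b)" for a b
  proof -
    have "smooth_fun A (chart_dom c) (\<lambda>q. g q (tangent_of A c q a) (tangent_of A c q b))"
      by (intro smooth_metric smooth_coordinate_field openin_chart_dom c)
    then have "smooth_on (chart_map c ` (chart_dom c \<inter> chart_dom c)) ((\<lambda>q. g q (tangent_of A c q a) (tangent_of A c q b)) \<circ> chart_inv c)"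
      using c unfolding smooth_fun_def by blast
    then show ?thesis unfolding chart_metric_def Int_absorb o_def by (rule smooth_on_continuous_on)
  qed
  have "chart_metric c x a a = (\<Sum>i\<in>Basis. \<Sum>j\<in>Basis. (a \<bullet> i) * ((a \<bullet> j) * chart_metric c x i j))"
    if "x \<in> chart_map c ` chart_dom c" for x a
  proof -
    have "chart_metric c x a a = (\<Sum>i\<in>Basis. (a \<bullet> i) * chart_metric c x i a)"
      using linear_euclidean_expand[OF linear_chart_metric(1)[OF c that, of a], of a] by simp
    also have "\<dots> = (\<Sum>i\<in>Basis. (a \<bullet> i) * (\<Sum>j\<in>Basis. (a \<bullet> j) * chart_metric c x i j))"
    proof (rule sum.cong)
      fix i :: "real ^ 'n"
      show "(a \<bullet> i) * chart_metric c x i a = (a \<bullet> i) * (\<Sum>j\<in>Basis. (a \<bullet> j) * chart_metric c x i j)"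
        using linear_euclidean_expand[OF linear_chart_metric(2)[OF c that, of i], of a] by simp
    qed simp
    finally show ?thesis by (simp add: sum_distrib_left)
  qed
  then have eq: "chart_metric c (fst z) (snd z) (snd z) =
      (\<Sum>i\<in>Basis. \<Sum>j\<in>Basis. (snd z \<bullet> i) * ((snd z \<bullet> j) * chart_metric c (fst z) i j))" if "z \<in> ?S" for z
    using that by auto
  have co': "continuous_on ?S (\<lambda>z. chart_metric c (fst z) a b)" for a b
    by (rule continuous_on_compose2[OF co continuous_on_fst[OF continuous_on_id]]) auto
  have "continuous_on ?S (\<lambda>z. \<Sum>i\<in>Basis. \<Sum>j\<in>Basis. (snd z \<bullet> i) * ((snd z \<bullet> j) * chart_metric c (fst z) i j))"
    by (intro continuous_on_sum continuous_on_mult co' continuous_on_inner continuous_on_snd continuous_on_id continuous_on_const)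
  then show ?thesis using eq by (simp cong: continuous_on_cong)
qed

lemma open_chart_metric:
  assumes "c \<in> A" "open B"
  shows "open {z. fst z \<in> chart_map c ` chart_dom c \<and> chart_metric c (fst z) (snd z) (snd z) \<in> B}"
proof -
  have "open ((chart_map c ` chart_dom c \<times> UNIV) \<inter> (\<lambda>z. chart_metric c (fst z) (snd z) (snd z)) -` B)"
    by (rule continuous_open_preimage[OF continuous_on_chart_metric[OF assms(1)] open_Times[OF open_chart_image_dom[OF assms(1)] open_UNIV] assms(2)])
  moreover have "(chart_map c ` chart_dom c \<times> UNIV) \<inter> (\<lambda>z. chart_metric c (fst z) (snd z) (snd z)) -` B =
      {z. fst z \<in> chart_map c ` chart_dom c \<and> chart_metric c (fst z) (snd z) (snd z) \<in> B}" by auto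
  ultimately show ?thesis by simp
qed

text \<open>Otherwise u would be a null vector of a semidefinite form, hence orthogonal to everything.\<close>

lemma negative_definite:
  assumes p: "p \<in> topspace X" and le: "\<And>v. v \<in> tangent_space A p \<Longrightarrow> g p v v \<le> 0"
    and u: "u \<in> tangent_space A p" "u \<noteq> (\<lambda>c. 0)"
  shows "g p u u < 0"
proof (rule ccontr)
  assume "\<not> g p u u < 0"
  then have 0: "g p u u = 0" using le[OF u(1)] by simp
  have "g p u v = 0" if v: "v \<in> tangent_space A p" for v
  proof (rule ccontr)
    assume nz: "g p u v \<noteq> 0"
    have *: "2 * (t * g p u v) + g p v v \<le> 0" for t
      using le[OF tangent_space_lincomb[OF u(1) v, of t 1]] metric_lincomb[OF p u(1) v, of t 1] 0 by simp
    \<comment> \<open>The left-hand side is affine in t; this value of t makes it equal to 1.\<close>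
    show False using *[of "(1 - g p v v) / (2 * g p u v)"] nz by (simp add: field_simps)
  qed
  then show False using metric_nondegenerate[OF p u(1)] u(2) by blast
qed

definition spacelike_cone :: "('m \<times> ('m, 'n) tvec) set" where
  "spacelike_cone = {\<xi> \<in> tangent_bundle X A. g (fst \<xi>) (snd \<xi>) (snd \<xi>) > 0}"

text \<open>Without spacelike vectors the metric is semidefinite, hence negative definite, at the point. Being
negative on the compact unit sphere of a chart persists at nearby points by the tube lemma.\<close>

lemma openin_no_spacelike:
  "openin X {p \<in> topspace X. \<forall>v. (p, v) \<notin> spacelike_cone}" (is "openin X ?N")
proof (subst openin_subopen, intro ballI)
  fix p assume "p \<in> ?N"
  then have p: "p \<in> topspace X" and le: "\<And>v. v \<in> tangent_space A p \<Longrightarrow> g p v v \<le> 0"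
    by (auto simp: spacelike_cone_def tangent_bundle_def not_less)
  let ?c = "chart_at A p"
  note c = chart_at[OF p]
  let ?W = "{z. fst z \<in> chart_map ?c ` chart_dom ?c \<and> chart_metric ?c (fst z) (snd z) (snd z) \<in> {..<0}}"
  have neg: "chart_metric ?c (chart_map ?c p) a a < 0" if "a \<noteq> 0" for a
  proof -
    have "tangent_of A ?c p a \<noteq> (\<lambda>c. 0)" using tangent_of_same[OF c, of a] that by auto
    then show ?thesis
      using negative_definite[OF p le tangent_of_in_tangent_space[OF c]] c by (simp add: chart_metric_def)
  qed
  have "{chart_map ?c p} \<times> sphere 0 1 \<subseteq> ?W"
  proof
    fix z assume z: "z \<in> {chart_map ?c p} \<times> sphere (0 :: real ^ 'n) 1"
    then have "snd z \<noteq> 0" by auto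
    then show "z \<in> ?W" using neg[of "snd z"] z c(2) by auto
  qed
  then obtain B where B: "chart_map ?c p \<in> B" "open B" "B \<times> sphere 0 1 \<subseteq> ?W"
    using Elementary_Topology.tube_lemma[OF compact_sphere open_chart_metric[OF c(1) open_lessThan]] by meson
  let ?U = "{q \<in> chart_dom ?c. chart_map ?c q \<in> B}"
  have "?U \<subseteq> ?N"
  proof
    fix q assume q: "q \<in> ?U"
    then have qX: "q \<in> topspace X" using chart_dom_subset[OF c(1)] by auto
    have "g q v v \<le> 0" if v: "v \<in> tangent_space A q" for v
    proof (cases "v ?c = 0")
      case True
      then have "v = (\<lambda>c. 0)" using tangent_space_eqI[OF v tangent_space_zero c(1)] q by auto
      then show ?thesis using metric_scale[OF qX tangent_space_zero, of 0] by simp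
    next
      case False
      let ?r = "1 / norm (v ?c)"
      let ?a = "?r *\<^sub>R v ?c"
      have "(chart_map ?c q, ?a) \<in> B \<times> sphere 0 1" using q False by simp
      then have "(chart_map ?c q, ?a) \<in> ?W" using B(3) by blast
      then have "g q (tangent_of A ?c q ?a) (tangent_of A ?c q ?a) < 0" using q c(1) by (simp add: chart_metric_def)
      moreover have "tangent_of A ?c q ?a = (\<lambda>d. ?r *\<^sub>R v d)"
        using tangent_of_lincomb[OF c(1), of q ?r "v ?c" 0 0] tangent_of_component[OF v c(1)] q by simp
      ultimately have "?r * ?r * g q v v < 0" using metric_scale[OF qX v, of ?r] by simp
      moreover have "?r * ?r > 0" using False by simp
      ultimately show ?thesis by (meson linorder_not_le mult_pos_pos less_asym)
    qed
    then show "q \<in> ?N" using qX by (auto simp: spacelike_cone_def tangent_bundle_def not_less)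
  qed
  moreover have "openin X ?U" by (rule openin_chart_preimage[OF c(1) B(2)])
  ultimately show "\<exists>U. openin X U \<and> p \<in> U \<and> U \<subseteq> ?N" using c(2) B(1) by blast
qed

text \<open>For the segments the metric itself selects the sign: the one that makes the product of u with v or
with -v non-negative.\<close>

lemma osserman_cone_spacelike:
  assumes "connection_atlas X A nabla"
    and osserman: "projective_osserman_on X A nabla (spacelike_unit_vectors X A g)"
  shows "osserman_cone X A nabla (spacelike_unit_vectors X A g) spacelike_cone"
proof -
  interpret connection_atlas X A nabla by fact
  show ?thesis
  proof unfold_locales
    show "\<exists>t. t \<noteq> 0 \<and> (p, \<lambda>c. t *\<^sub>R v c) \<in> spacelike_unit_vectors X A g" if "(p, v) \<in> spacelike_cone" for p v
    proof -
      have pv: "p \<in> topspace X" "v \<in> tangent_space A p" "g p v v > 0"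
        using that by (auto simp: spacelike_cone_def tangent_bundle_def)
      let ?t = "1 / sqrt (g p v v)"
      have "(\<lambda>c. ?t *\<^sub>R v c) \<in> tangent_space A p" using tangent_space_lincomb[OF pv(2,2), of ?t 0] by simp
      then have "(p, \<lambda>c. ?t *\<^sub>R v c) \<in> spacelike_unit_vectors X A g"
        using pv metric_scale[OF pv(1,2), of ?t] by (simp add: spacelike_unit_vectors_def tangent_bundle_def)
      then show ?thesis using pv(3) by (intro exI[of _ ?t]) auto
    qed
    show "open {z. fst z \<in> chart_map c ` chart_dom c \<and> bundle_point c z \<in> spacelike_cone}" if c: "c \<in> A" for c
    proof -
      have "{z. fst z \<in> chart_map c ` chart_dom c \<and> bundle_point c z \<in> spacelike_cone} =
          {z. fst z \<in> chart_map c ` chart_dom c \<and> chart_metric c (fst z) (snd z) (snd z) \<in> {0<..}}"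
        using bundle_point_in_bundle[OF c] by (auto simp: spacelike_cone_def chart_metric_def) (auto simp: bundle_point_def)
      then show ?thesis using open_chart_metric[OF c open_greaterThan] by simp
    qed
    show "\<exists>e\<in>{1, -1}. \<forall>r\<in>{0..1}. (p, \<lambda>c. (1 - r) *\<^sub>R u c + (r * e) *\<^sub>R v c) \<in> spacelike_cone"
      if uv: "(p, u) \<in> spacelike_cone" "(p, v) \<in> spacelike_cone" for p u v
    proof -
      have p: "p \<in> topspace X" "u \<in> tangent_space A p" "v \<in> tangent_space A p" "g p u u > 0" "g p v v > 0"
        using uv by (auto simp: spacelike_cone_def tangent_bundle_def)
      define e :: real where "e = (if g p u v \<ge> 0 then 1 else -1)"
      have e: "e * e = 1" "e * g p u v \<ge> 0" by (auto simp: e_def)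
      have "(p, \<lambda>c. (1 - r) *\<^sub>R u c + (r * e) *\<^sub>R v c) \<in> spacelike_cone" if r: "r \<in> {0..1}" for r
      proof -
        let ?w = "\<lambda>c. (1 - r) *\<^sub>R u c + (r * e) *\<^sub>R v c"
        have "g p ?w ?w = (1 - r) * (1 - r) * g p u u + 2 * ((1 - r) * r * (e * g p u v)) + r * r * (e * e) * g p v v"
          unfolding metric_lincomb[OF p(1-3)] by (simp add: algebra_simps)
        also have "\<dots> > 0"
          unfolding e(1) mult_1_right by (rule inner_segment_pos) (use p e r in auto)
        finally show ?thesis
          using tangent_space_lincomb[OF p(2,3)] p(1) by (simp add: spacelike_cone_def tangent_bundle_def)
      qed
      then show ?thesis by (intro bexI[of _ e]) (auto simp: e_def)
    qed
    show "spacelike_unit_vectors X A g \<subseteq> spacelike_cone"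
      by (auto simp: spacelike_unit_vectors_def spacelike_cone_def)
    show "spacelike_cone \<subseteq> tangent_bundle X A" by (auto simp: spacelike_cone_def)
  qed (rule openin_no_spacelike osserman)+
qed

end

text \<open>This turns the timelike vectors of g into spacelike ones.\<close>

lemma pseudo_riemannian_metric_minus:
  assumes "atlas X A" "pseudo_riemannian_metric X A g"
  shows "pseudo_riemannian_metric X A (\<lambda>p u v. - g p u v)"
proof -
  interpret metric_atlas X A g using assms by (simp add: metric_atlas_def metric_atlas_axioms_def)
  show ?thesis unfolding pseudo_riemannian_metric_def
  proof (intro conjI allI ballI impI)
    fix U V W assume *: "openin X U \<and> smooth_vfield A U V \<and> smooth_vfield A U W"
    then have "smooth_fun A U (\<lambda>q. g q (V q) (W q))" by (intro smooth_metric) auto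
    then show "smooth_fun A U (\<lambda>q. - g q (V q) (W q))"
      unfolding smooth_fun_def o_def using * by (intro ballI smooth_on_minus open_chart_image) auto
  next
    fix p u assume "p \<in> topspace X" "u \<in> tangent_space A p" "\<forall>v\<in>tangent_space A p. - g p u v = 0"
    then show "u = (\<lambda>c. 0)" by (intro metric_nondegenerate) auto
  qed (simp_all add: metric_commute metric_lincomb_left)
qed

lemma spacelike_scaling:
  assumes "connected_space X" "smooth_manifold X A" "pseudo_riemannian_metric X A g"
    and "connection X A nabla" "torsion_free X A nabla"
    and "projective_osserman_on X A nabla (spacelike_unit_vectors X A g)"
  shows "\<exists>s. positive_smooth_scaling X A nabla (spacelike_unit_vectors X A g) s"
proof -
  interpret connection_atlas X A nabla
    by unfold_locales (use assms in \<open>simp_all add: smooth_manifold_def\<close>)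
  interpret metric_atlas X A g by unfold_locales (rule assms)
  interpret osserman_cone X A nabla "spacelike_unit_vectors X A g" spacelike_cone
    by (rule osserman_cone_spacelike[OF connection_atlas_axioms assms(6)])
  show ?thesis by (rule ex_positive_smooth_scaling[OF assms(1)])
qed

theorem theorem1p6:
  fixes X :: "'m topology"
    and A :: "('m, 'n::finite) chart set"
  assumes "connected_space X"
  shows
    "(\<forall>nabla. affine_projective_osserman X A nabla \<longrightarrow>
        (\<exists>s. positive_smooth_scaling X A nabla (nonzero_vectors X A) s)) \<and>
     (\<forall>g nabla. spacelike_projective_osserman X A g nabla \<longrightarrow>
        (\<exists>s. positive_smooth_scaling X A nabla (spacelike_unit_vectors X A g) s)) \<and>
     (\<forall>g nabla. timelike_projective_osserman X A g nabla \<longrightarrow>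
        (\<exists>s. positive_smooth_scaling X A nabla (timelike_unit_vectors X A g) s))"
proof (intro conjI allI impI)
  fix nabla assume o: "affine_projective_osserman X A nabla"
  then interpret connection_atlas X A nabla
    by unfold_locales (simp_all add: affine_projective_osserman_def affine_manifold_def smooth_manifold_def)
  interpret osserman_cone X A nabla "nonzero_vectors X A" "nonzero_vectors X A"
    using o by (intro osserman_cone_nonzero) (simp add: affine_projective_osserman_def)
  show "\<exists>s. positive_smooth_scaling X A nabla (nonzero_vectors X A) s"
    by (rule ex_positive_smooth_scaling[OF assms])
next
  fix g nabla assume "spacelike_projective_osserman X A g nabla"
  then show "\<exists>s. positive_smooth_scaling X A nabla (spacelike_unit_vectors X A g) s"
    by (intro spacelike_scaling[OF assms])
      (simp_all add: spacelike_projective_osserman_def pseudo_riemannian_manifold_def levi_civita_connection_def)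
next
  fix g nabla assume o: "timelike_projective_osserman X A g nabla"
  let ?g = "\<lambda>p u v. - g p u v"
  have eq: "timelike_unit_vectors X A g = spacelike_unit_vectors X A ?g"
    by (auto simp: timelike_unit_vectors_def spacelike_unit_vectors_def)
  have m: "smooth_manifold X A" "pseudo_riemannian_metric X A g" "connection X A nabla" "torsion_free X A nabla"
      "projective_osserman_on X A nabla (timelike_unit_vectors X A g)"
    using o by (simp_all add: timelike_projective_osserman_def pseudo_riemannian_manifold_def levi_civita_connection_def)
  have "pseudo_riemannian_metric X A ?g"
    by (rule pseudo_riemannian_metric_minus[OF _ m(2)]) (use m(1) in \<open>simp add: atlas_def smooth_manifold_def\<close>)
  then show "\<exists>s. positive_smooth_scaling X A nabla (timelike_unit_vectors X A g) s"
    using m unfolding eq by (intro spacelike_scaling[OF assms])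
qed

end
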